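(* Let $Q_n$ be the region defined in the context and $\operatorname{T}$ the number of tilings. For every integer $q\ge0$, $$\operatorname{T}(Q_{4q})=3^{4q^2}29^{4q^2},$$ $$\operatorname{T}(Q_{8q+2})=3^{2q(8q+4)}29^{(4q+1)^2},$$ $$\operatorname{T}(Q_{8q+6})=3^{8(q+1)(2q+1)+2}29^{(4q+3)^2},$$ $$\operatorname{T}(Q_{4q+1})=2\cdot3^{2q(2q+1)}29^{2q(2q+1)},$$ $$\operatorname{T}(Q_{4q+3})=5\cdot3^{(2q+1)(2q+2)}29^{(2q+1)(2q+2)}.$$
   Context: Tilings: given a subdivision of the plane into elementary regions, a tile is the union of two elementary regions sharing an edge; a tiling of a region (finite connected union of elementary regions) is a covering of it by tiles without gaps or overlaps; $\operatorname{T}(R)$ is the number of tilings of $R$. Node replacements for the unit square lattice (nodes $\mathbb{Z}^2$). First node replacement at a node $O$: add new vertices $O\pm(\tfrac12,0)$ at the midpoints of the two horizontal unit edges at $O$, and join each of them by straight segments to $O+(0,1)$ and to $O-(0,1)$; all existing segments are kept. Second node replacement at $O$: add new vertices $O\pm(0,\tfrac12)$ and join each of them by straight segments to $O+(1,0)$ and to $O-(1,0)$; all existing segments are kept. The lattice: start with the unit square lattice with every second diagonal drawn in, i.e. with all lines $y-x=2c$ and $x+y=2c$ ($c\in\mathbb{Z}$) added. For all integers $k,l$, apply the first node replacement at the nodes $(8k+5,4l)$, $(8k+7,4l)$, $(8k,4l+1)$, $(8k+2,4l+1)$, $(8k+3,4l+2)$, $(8k+5,4l+2)$, $(8k+6,4l+3)$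 and $(8k,4l+3)$; apply the second node replacement at all remaining nodes whose $x$- and $y$-coordinates have different parity. The elementary regions are the cells of the resulting subdivision. For $n\ge1$ let $\mathbb{D}_n(0,0)=\{(x,y):|x-n|+|y|\le n\}$ be the diamond of side-length $n\sqrt2$ whose western vertex is the node $(0,0)$. $Q_n$ is the variant of the fortress of order $n$ based on $\mathbb{D}_n(0,0)$: the union of all elementary regions lying inside $\mathbb{D}_n(0,0)$ together with those elementary regions outside $\mathbb{D}_n(0,0)$ that have an edge on the boundary of $\mathbb{D}_n(0,0)$ and are contained in a unit diamond $\{|x-x_0|+|y-y_0|\le1\}$ centred at a node $(x_0,y_0)$ with $x_0$ even and $y_0$ odd. Convention: $Q_0$ is empty with $\operatorname{T}(Q_0)=1$.
   Formalization: In the list of nodes for the first replacement, 4l is added to every x-coordinate (e.g. (8k+4l+5,4l) for (8k+5,4l)), so the pattern shifts by 4 every four rows; with the list as printed, (2,-1) gets the second replacement and T(Q_2)=37, not 29. *)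

theory Defs
  imports "HOL-Analysis.Analysis"
begin

text \<open>
  A subdivision of the plane is given by its set \<open>V\<close> of vertices and its skeleton \<open>S\<close>, the union
  of all drawn lines and segments.  The skeleton is a union of straight segments, any two of which
  meet in vertices only or along a common segment.
\<close>

type_synonym plane = "real \<times> real"

definition subdiv_edges :: "plane set \<Rightarrow> plane set \<Rightarrow> plane set set" where
  "subdiv_edges V S =
     {closed_segment a b | a b. a \<in> V \<and> b \<in> V \<and> a \<noteq> b \<and> open_segment a b \<subseteq> S - V}"

definition elementary_regions :: "plane set \<Rightarrow> plane set set" where
  "elementary_regions S = closure ` components (- S)"

definition tiles :: "plane set \<Rightarrow> plane set \<Rightarrow> plane set set" where
  "tiles V S =
     {C \<union> D | C D. C \<in> elementary_regions S \<and> D \<in> elementary_regions S \<and> C \<noteq> D \<and>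
                   (\<exists>e \<in> subdiv_edges V S. e \<subseteq> C \<and> e \<subseteq> D)}"

definition tilings :: "plane set \<Rightarrow> plane set \<Rightarrow> plane set \<Rightarrow> plane set set set" where
  "tilings V S R =
     {P. P \<subseteq> tiles V S \<and> \<Union>P = R \<and>
         (\<forall>t \<in> P. \<forall>u \<in> P. t \<noteq> u \<longrightarrow> interior t \<inter> interior u = {})}"

definition tiling_number :: "plane set \<Rightarrow> plane set \<Rightarrow> plane set \<Rightarrow> nat" where
  "tiling_number V S R = card (tilings V S R)"

definition node :: "int \<times> int \<Rightarrow> plane" where
  "node p = (of_int (fst p), of_int (snd p))"

text \<open>The unit square lattice with every second diagonal drawn in.\<close>

definition base_skeleton :: "plane set" where
  "base_skeleton =
     {(x, y). x \<in> \<int> \<or> y \<in> \<int> \<or>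
              (\<exists>c::int. y - x = 2 * of_int c) \<or> (\<exists>c::int. x + y = 2 * of_int c)}"

text \<open>
  The node replacements: each of the new vertices is joined to each of the two listed
  neighbours of the node.
\<close>

definition first_new_vertices :: "plane \<Rightarrow> plane set" where
  "first_new_vertices p = {p + (1/2, 0), p - (1/2, 0)}"

definition first_new_segments :: "plane \<Rightarrow> plane set set" where
  "first_new_segments p =
     {closed_segment v w | v w. v \<in> first_new_vertices p \<and> w \<in> {p + (0, 1), p - (0, 1)}}"

definition second_new_vertices :: "plane \<Rightarrow> plane set" where
  "second_new_vertices p = {p + (0, 1/2), p - (0, 1/2)}"

definition second_new_segments :: "plane \<Rightarrow> plane set set" where
  "second_new_segments p =
     {closed_segment v w | v w. v \<in> second_new_vertices p \<and> w \<in> {p + (1, 0), p - (1, 0)}}"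

text \<open>
  The periods of the pattern are \<open>(8, 0)\<close> and \<open>(4, 4)\<close>: going up four rows shifts it by 4
  horizontally, whence the summand \<open>4 * l\<close> in the first coordinates.  In the printed list of nodes
  this summand is missing, and every \<open>(8 * k + 4 * l + a, 4 * l + b)\<close> below reads
  \<open>(8 * k + a, 4 * l + b)\<close>.  The two lists agree in the rows 0 to 3, but with the printed one the
  region of order 2 has 37 tilings, not 29: it makes the node \<open>(2, -1)\<close> subject to the second
  instead of the first replacement.
\<close>

definition first_nodes :: "(int \<times> int) set" where
  "first_nodes =
     (\<Union>k. \<Union>l. {(8 * k + 4 * l + 5, 4 * l), (8 * k + 4 * l + 7, 4 * l),
               (8 * k + 4 * l, 4 * l + 1), (8 * k + 4 * l + 2, 4 * l + 1),
               (8 * k + 4 * l + 3, 4 * l + 2), (8 * k + 4 * l + 5, 4 * l + 2),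
               (8 * k + 4 * l + 6, 4 * l + 3), (8 * k + 4 * l, 4 * l + 3)})"

definition second_nodes :: "(int \<times> int) set" where
  "second_nodes = {(a, b). even a \<noteq> even b} - first_nodes"

definition L_vertices :: "plane set" where
  "L_vertices =
     range node \<union> (\<Union>p \<in> first_nodes. first_new_vertices (node p))
       \<union> (\<Union>p \<in> second_nodes. second_new_vertices (node p))"

definition L_skeleton :: "plane set" where
  "L_skeleton =
     base_skeleton \<union> (\<Union>p \<in> first_nodes. \<Union>(first_new_segments (node p)))
       \<union> (\<Union>p \<in> second_nodes. \<Union>(second_new_segments (node p)))"

abbreviation L_regions :: "plane set set" where
  "L_regions \<equiv> elementary_regions L_skeleton"

abbreviation L_edges :: "plane set set" where
  "L_edges \<equiv> subdiv_edges L_vertices L_skeleton"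

text \<open>\<open>\<D>\<^sub>n(0,0)\<close>; its western vertex is the origin.\<close>

definition diamond :: "nat \<Rightarrow> plane set" where
  "diamond n = {(x, y). \<bar>x - of_nat n\<bar> + \<bar>y\<bar> \<le> of_nat n}"

definition unit_diamond :: "int \<times> int \<Rightarrow> plane set" where
  "unit_diamond p = {(x, y). \<bar>x - of_int (fst p)\<bar> + \<bar>y - of_int (snd p)\<bar> \<le> 1}"

definition outer_cells :: "nat \<Rightarrow> plane set set" where
  "outer_cells n =
     {C \<in> L_regions. interior C \<inter> diamond n = {} \<and>
        (\<exists>e \<in> L_edges. e \<subseteq> C \<and> e \<subseteq> frontier (diamond n)) \<and>
        (\<exists>a b. even a \<and> odd b \<and> C \<subseteq> unit_diamond (a, b))}"

definition Q :: "nat \<Rightarrow> plane set" where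
  "Q n = (if n = 0 then {} else \<Union>({C \<in> L_regions. C \<subseteq> diamond n} \<union> outer_cells n))"

definition T :: "plane set \<Rightarrow> nat" where
  "T R = tiling_number L_vertices L_skeleton R"

lemma T_empty: "T {} = 1"
proof -
  have "{} \<notin> tiles L_vertices L_skeleton"
    by (auto simp: tiles_def elementary_regions_def dest: in_components_nonempty)
  then have "tilings L_vertices L_skeleton {} = {{}}"
    by (auto simp: tilings_def)
  then show ?thesis by (simp add: T_def tiling_number_def)
qed

end

theory Submission
  imports Defs
begin

text \<open>
  The subdivision cuts every unit diamond centred at a node of odd coordinate sum into eight triangles
  whose dual graph is a ladder with four rungs, and only the four corners of the ladder have neighbours
  in other diamonds.  With the corners in a given set matched outwards a ladder has 5, 3, 1, 2 or 0
  perfect matchings.  Since \<open>5 * 2 = 3 * 3 + 1 * 1\<close>, these numbers are, up to a factor, the matching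
  sums of a weighted 4-cycle, so that \<open>T (Q n)\<close> becomes a sum over the weighted domino tilings of an
  Aztec diamond of order \<open>n - 1\<close>.

  Complementing the matched vertices in every 4-cycle (urban renewal) lowers the order of an Aztec diamond
  by one.  The weights arising here are, up to a scalar, restored by two renewals and a translation; the
  factors split off are 29, 87 or 261 in the first renewal and 250 or 40 in the second.
\<close>

section \<open>The cells of the subdivision\<close>

text \<open>A tile joining two diamonds removes one corner from each of two ladders, whereas a
  square of the Aztec diamond is matched at exactly one of its two nodes. The pictures agree because
  a joining square touches one node with even and one with odd first coordinate: the set of removed
  corners is read directly at the former and complemented at the latter. The outer cells of
  \<open>Q\<close> fit this reading. Sitting at (even, odd) nodes only, they make the boundary
  squares of the (odd, even) diamonds removed corners, which vanish in the complement; so the order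
  drops to \<open>n - 1\<close>.

  At a node of even coordinate sum the weights 5 and 2 stand on perpendicular edges, whence 29 = 25
  + 4 up to a power of 3. That power depends on the diagonal row modulo 4. In an Aztec diamond of
  odd order the deviations do not cancel within a row, and this separates the even \<open>n\<close>
  by residues modulo 8. In even order they do cancel; the residues 1 and 3 modulo 4 are then told
  apart by one unpaired factor 250 or 40.\<close>

definition loc :: "int \<Rightarrow> real \<Rightarrow> real" where
  "loc i x = (if even i then x - of_int i else of_int i + 1 - x)"

definition even_of :: "int \<Rightarrow> int" where "even_of i = (if even i then i else i + 1)"
definition odd_of :: "int \<Rightarrow> int" where "odd_of i = (if even i then i + 1 else i)"

definition cell_node :: "int \<times> int \<Rightarrow> bool \<Rightarrow> int \<times> int" where
  "cell_node f b = (if b then (even_of (fst f), odd_of (snd f)) else (odd_of (fst f), even_of (snd f)))"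

lemma weighted_sum_le: "2 * p + q = 1 \<Longrightarrow> 0 \<le> p \<Longrightarrow> q \<le> (1::real)"
  by linarith

text \<open>The four new segments form the rhombus around the node with half-diagonals 1/2 and 1, a
  circle of a weighted l1 norm. The signs \<open>s\<close> and \<open>t\<close> in the proof select
  the side by quadrant.\<close>

lemma new_segments_first:
  "(x, y) \<in> \<Union>(first_new_segments (a, b)) \<longleftrightarrow> 2 * \<bar>x - a\<bar> + \<bar>y - b\<bar> = 1"
proof
  assume "(x, y) \<in> \<Union>(first_new_segments (a, b))"
  then show "2 * \<bar>x - a\<bar> + \<bar>y - b\<bar> = 1"
    by (auto simp: first_new_segments_def first_new_vertices_def closed_segment_def algebra_simps abs_if split: if_splits)
next
  assume h: "2 * \<bar>x - a\<bar> + \<bar>y - b\<bar> = 1"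
  define s :: real where "s = (if x \<ge> a then 1 else -1)"
  define t :: real where "t = (if y \<ge> b then 1 else -1)"
  define u where "u = \<bar>y - b\<bar>"
  have "u \<le> 1" unfolding u_def by (rule weighted_sum_le[OF h]) simp
  then have u: "0 \<le> u" "u \<le> 1" by (auto simp: u_def)
  have x: "x = a + s * (1 - u) / 2" using h by (auto simp: s_def u_def abs_if field_simps split: if_splits)
  have y: "y = b + t * u" by (auto simp: t_def u_def)
  have "(x, y) \<in> closed_segment ((a, b) + (s/2, 0)) ((a, b) + (0, t))"
    unfolding closed_segment_def using u x y by (auto intro!: exI[of _ u] simp: field_simps)
  moreover have "closed_segment ((a, b) + (s/2, 0)) ((a, b) + (0, t)) \<in> first_new_segments (a, b)"
    unfolding first_new_segments_def first_new_vertices_def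
    by (rule CollectI, rule exI[of _ "(a, b) + (s/2, 0)"], rule exI[of _ "(a, b) + (0, t)"]) (auto simp: s_def t_def)
  ultimately show "(x, y) \<in> \<Union>(first_new_segments (a, b))" by blast
qed

lemma new_segments_second:
  "(x, y) \<in> \<Union>(second_new_segments (a, b)) \<longleftrightarrow> \<bar>x - a\<bar> + 2 * \<bar>y - b\<bar> = 1"
proof
  assume "(x, y) \<in> \<Union>(second_new_segments (a, b))"
  then show "\<bar>x - a\<bar> + 2 * \<bar>y - b\<bar> = 1"
    by (auto simp: second_new_segments_def second_new_vertices_def closed_segment_def algebra_simps abs_if split: if_splits)
next
  assume h: "\<bar>x - a\<bar> + 2 * \<bar>y - b\<bar> = 1"
  define s :: real where "s = (if x \<ge> a then 1 else -1)"
  define t :: real where "t = (if y \<ge> b then 1 else -1)"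
  define u where "u = \<bar>x - a\<bar>"
  have "u \<le> 1" unfolding u_def by (rule weighted_sum_le[OF h[unfolded add.commute[of "\<bar>x - a\<bar>"]]]) simp
  then have u: "0 \<le> u" "u \<le> 1" by (auto simp: u_def)
  have y: "y = b + t * (1 - u) / 2" using h by (auto simp: t_def u_def abs_if field_simps split: if_splits)
  have x: "x = a + s * u" by (auto simp: s_def u_def)
  have "(x, y) \<in> closed_segment ((a, b) + (0, t/2)) ((a, b) + (s, 0))"
    unfolding closed_segment_def using u x y by (auto intro!: exI[of _ u] simp: field_simps)
  moreover have "closed_segment ((a, b) + (0, t/2)) ((a, b) + (s, 0)) \<in> second_new_segments (a, b)"
    unfolding second_new_segments_def second_new_vertices_def
    by (rule CollectI, rule exI[of _ "(a, b) + (0, t/2)"], rule exI[of _ "(a, b) + (s, 0)"]) (auto simp: s_def t_def)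
  ultimately show "(x, y) \<in> \<Union>(second_new_segments (a, b))" by blast
qed

lemma first_nodes_odd: "(a, b) \<in> first_nodes \<Longrightarrow> odd (a + b)"
  by (auto simp: first_nodes_def)

lemma second_nodes_iff: "z \<in> second_nodes \<longleftrightarrow> odd (fst z + snd z) \<and> z \<notin> first_nodes"
  by (cases z) (auto simp: second_nodes_def)

definition on_replacement :: "int \<times> int \<Rightarrow> plane \<Rightarrow> bool" where
  "on_replacement z p \<longleftrightarrow>
    (if z \<in> first_nodes then 2 * \<bar>fst p - of_int (fst z)\<bar> + \<bar>snd p - of_int (snd z)\<bar> = 1
     else \<bar>fst p - of_int (fst z)\<bar> + 2 * \<bar>snd p - of_int (snd z)\<bar> = 1)"

lemma L_skeleton_iff:
  "(x, y) \<in> L_skeleton \<longleftrightarrow> x \<in> \<int> \<or> y \<in> \<int> \<or> (\<exists>c::int. y - x = 2 * of_int c) \<or> (\<exists>c::int. x + y = 2 * of_int c)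
    \<or> (\<exists>z. odd (fst z + snd z) \<and> on_replacement z (x, y))"
proof -
  have first: "z \<in> first_nodes \<and> (x, y) \<in> \<Union>(first_new_segments (node z)) \<longleftrightarrow>
      z \<in> first_nodes \<and> odd (fst z + snd z) \<and> on_replacement z (x, y)" for z
    using first_nodes_odd[of "fst z" "snd z"] unfolding node_def new_segments_first on_replacement_def
    by (auto simp del: even_add odd_add)
  have second: "z \<in> second_nodes \<and> (x, y) \<in> \<Union>(second_new_segments (node z)) \<longleftrightarrow>
      z \<notin> first_nodes \<and> odd (fst z + snd z) \<and> on_replacement z (x, y)" for z
    unfolding second_nodes_iff node_def new_segments_second on_replacement_def by auto
  have "(x, y) \<in> L_skeleton \<longleftrightarrow> (x, y) \<in> base_skeleton \<or>
     (\<exists>z. z \<in> first_nodes \<and> (x, y) \<in> \<Union>(first_new_segments (node z))) \<or>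
     (\<exists>z. z \<in> second_nodes \<and> (x, y) \<in> \<Union>(second_new_segments (node z)))"
    by (simp only: L_skeleton_def Un_iff UN_iff Bex_def disj_assoc)
  also have "\<dots> \<longleftrightarrow> (x, y) \<in> base_skeleton \<or> (\<exists>z. odd (fst z + snd z) \<and> on_replacement z (x, y))"
    unfolding first second by blast
  finally show ?thesis by (simp add: base_skeleton_def)
qed

lemmas node_defs = cell_node_def even_of_def odd_of_def

text \<open>The reflection of the unit square that moves the node of the cell to \<open>(0, 1)\<close> and the axis
  carrying the new vertices to the top side; the new vertex becomes \<open>(1/2, 1)\<close>.\<close>

definition coord :: "bool \<Rightarrow> bool \<Rightarrow> real \<Rightarrow> real \<Rightarrow> real \<times> real" where
  "coord b h p q = (if b then if h then (p, q) else (1 - q, 1 - p) else if h then (1 - p, 1 - q) else (q, p))"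

text \<open>A cell is given by its unit square (named by the lower left corner), a flag telling whether it lies
  in the unit diamond of the (even, odd) or of the (odd, even) corner of that square, and a flag telling
  whether it touches the boundary of that diamond.\<close>

type_synonym cell = "(int \<times> int) \<times> bool \<times> bool"

section \<open>Affine charts and the two model triangles\<close>

definition cell_coord :: "int \<times> int \<Rightarrow> bool \<Rightarrow> plane \<Rightarrow> real \<times> real" where
  "cell_coord f b p = coord b (cell_node f b \<in> first_nodes) (loc (fst f) (fst p)) (loc (snd f) (snd p))"

definition open_tri :: "bool \<Rightarrow> (real \<times> real) set" where
  "open_tri d = {(s, t). if d then s < t \<and> t < 1 \<and> t < 2 * s else 0 < s \<and> t < 1 \<and> 2 * s < t}"
definition closed_tri :: "bool \<Rightarrow> (real \<times> real) set" where
  "closed_tri d = {(s, t). if d then s \<le> t \<and> t \<le> 1 \<and> t \<le> 2 * s else 0 \<le> s \<and> t \<le> 1 \<and> 2 * s \<le> t}"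

fun open_cell :: "cell \<Rightarrow> plane set" where
  "open_cell (f, b, d) = cell_coord f b -` open_tri d"
fun closed_cell :: "cell \<Rightarrow> plane set" where
  "closed_cell (f, b, d) = cell_coord f b -` closed_tri d"

text \<open>\<open>loc\<close> is affine on the whole line, not folded at the ends of its interval,
  so a chart is an affine bijection of the plane. Convexity, closures and segments can be treated in
  the model triangles.\<close>

lemma cell_coord_affine:
  "cell_coord f b ((1 - u) *\<^sub>R p + u *\<^sub>R q) = (1 - u) *\<^sub>R cell_coord f b p + u *\<^sub>R cell_coord f b q"
  by (cases p; cases q) (simp add: cell_coord_def coord_def loc_def algebra_simps)

lemma continuous_cell_coord: "continuous_on UNIV (cell_coord f b)"
proof -
  have [continuous_intros]: "continuous_on UNIV (\<lambda>p::plane. loc i (fst p))"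
    "continuous_on UNIV (\<lambda>p::plane. loc i (snd p))" for i
    unfolding loc_def by (cases "even i"; simp; intro continuous_intros)+
  show ?thesis unfolding cell_coord_def coord_def
    by (cases b; cases "cell_node f b \<in> first_nodes") (simp_all add: continuous_intros)
qed

lemma open_open_tri: "open (open_tri d)"
  by (cases d) (auto simp: open_tri_def case_prod_unfold intro!: open_Collect_conj open_Collect_less continuous_intros)

lemma closed_closed_tri: "closed (closed_tri d)"
  by (cases d) (auto simp: closed_tri_def case_prod_unfold intro!: closed_Collect_conj closed_Collect_le continuous_intros)

lemma open_open_cell: "open (open_cell c)"
proof (cases c)
  case (fields f b d)
  have "open (cell_coord f b -` open_tri d)"
    by (rule open_vimage) (use open_open_tri continuous_cell_coord in auto)
  then show ?thesis by (simp only: fields open_cell.simps)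
qed

lemma closed_closed_cell: "closed (closed_cell c)"
proof (cases c)
  case (fields f b d)
  have "closed (cell_coord f b -` closed_tri d)"
    by (rule closed_vimage) (use closed_closed_tri continuous_cell_coord in auto)
  then show ?thesis by (simp only: fields closed_cell.simps)
qed

lemma mix_less: fixes a b :: real assumes "a \<le> b" "a' < b'" "0 < u" "u \<le> 1"
  shows "(1 - u) * a + u * a' < (1 - u) * b + u * b'"
  using assms by (meson add_le_less_mono diff_ge_0_iff_ge mult_left_mono mult_strict_left_mono)

text \<open>Weak inequalities at one end and strict ones at the other mix to strict ones. This one
  fact gives both the convexity of open cells and their density in the closed cells.\<close>

lemma mix_tri:
  assumes "p \<in> closed_tri d" "q \<in> open_tri d" "0 < u" "u \<le> 1"
  shows "(1 - u) *\<^sub>R p + u *\<^sub>R q \<in> open_tri d"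
proof -
  obtain s t s' t' where pq: "p = (s, t)" "q = (s', t')" by fastforce
  have a: "(1 - u) * 1 + u * 1 = 1" "(1 - u) * 0 + u * 0 = 0" by auto
  show ?thesis
  proof (cases d)
    case True
    then have "s \<le> t" "t \<le> 1" "t \<le> 2 * s" "s' < t'" "t' < 1" "t' < 2 * s'"
      using assms pq by (auto simp: open_tri_def closed_tri_def)
    from mix_less[OF \<open>s \<le> t\<close> \<open>s' < t'\<close> assms(3,4)] mix_less[OF \<open>t \<le> 1\<close> \<open>t' < 1\<close> assms(3,4)]
      mix_less[OF \<open>t \<le> 2 * s\<close> \<open>t' < 2 * s'\<close> assms(3,4)]
    show ?thesis using True by (simp add: pq open_tri_def algebra_simps)
  next
    case False
    then have "0 \<le> s" "t \<le> 1" "2 * s \<le> t" "0 < s'" "t' < 1" "2 * s' < t'"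
      using assms pq by (auto simp: open_tri_def closed_tri_def)
    from mix_less[OF \<open>0 \<le> s\<close> \<open>0 < s'\<close> assms(3,4)] mix_less[OF \<open>t \<le> 1\<close> \<open>t' < 1\<close> assms(3,4)]
      mix_less[OF \<open>2 * s \<le> t\<close> \<open>2 * s' < t'\<close> assms(3,4)]
    show ?thesis using False by (simp add: pq open_tri_def algebra_simps)
  qed
qed

lemma open_tri_subset: "open_tri d \<subseteq> closed_tri d"
  by (auto simp: open_tri_def closed_tri_def split: if_splits)

lemma open_cell_subset: "open_cell c \<subseteq> closed_cell c"
  using open_tri_subset by (cases c) auto

lemma mix_cell:
  assumes "p \<in> closed_cell c" "q \<in> open_cell c" "0 < u" "u \<le> 1"
  shows "(1 - u) *\<^sub>R p + u *\<^sub>R q \<in> open_cell c"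
proof (cases c)
  case (fields f b d)
  then have "(1 - u) *\<^sub>R cell_coord f b p + u *\<^sub>R cell_coord f b q \<in> open_tri d"
    using mix_tri assms by auto
  then show ?thesis by (simp only: fields open_cell.simps vimage_eq cell_coord_affine)
qed

lemma convex_closed_tri: "convex (closed_tri d)"
proof (cases d)
  case True
  then have "closed_tri d = {p. (1, -1) \<bullet> p \<le> 0} \<inter> {p. (0, 1) \<bullet> p \<le> 1} \<inter> {p. (-2, 1) \<bullet> p \<le> 0}"
    by (auto simp: closed_tri_def)
  then show ?thesis by (auto intro!: convex_Int convex_halfspace_le)
next
  case False
  then have "closed_tri d = {p. (-1, 0) \<bullet> p \<le> 0} \<inter> {p. (0, 1) \<bullet> p \<le> 1} \<inter> {p. (2, -1) \<bullet> p \<le> 0}"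
    by (auto simp: closed_tri_def)
  then show ?thesis by (auto intro!: convex_Int convex_halfspace_le)
qed

lemma convex_closed_cell: "convex (closed_cell c)"
proof (cases c)
  case (fields f b d)
  show ?thesis
    unfolding convex_alt fields closed_cell.simps vimage_eq cell_coord_affine
    using convex_closed_tri[of d] unfolding convex_alt by blast
qed

lemma convex_open_cell: "convex (open_cell c)"
  unfolding convex_alt
proof (intro ballI allI impI)
  fix p q u assume *: "p \<in> open_cell c" "q \<in> open_cell c" "0 \<le> u \<and> u \<le> (1::real)"
  show "(1 - u) *\<^sub>R p + u *\<^sub>R q \<in> open_cell c"
  proof (cases "u = 0")
    case False
    moreover have "p \<in> closed_cell c" using * open_cell_subset by blast
    ultimately show ?thesis using * mix_cell by auto
  qed (use * in simp)
qed

definition unloc :: "int \<Rightarrow> real \<Rightarrow> real" where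
  "unloc i s = (if even i then of_int i + s else of_int i + 1 - s)"

lemma loc_unloc [simp]: "loc i (unloc i s) = s" and unloc_loc [simp]: "unloc i (loc i x) = x"
  by (auto simp: loc_def unloc_def)

lemma coord_involution:
  "coord b h (fst (coord b h s t)) (snd (coord b h s t)) = (s, t)"
  by (simp add: coord_def)

lemma cell_coord_surj: "\<exists>p. cell_coord f b p = (s, t)"
proof -
  let ?q = "coord b (cell_node f b \<in> first_nodes) s t"
  have "cell_coord f b (unloc (fst f) (fst ?q), unloc (snd f) (snd ?q)) = (s, t)"
    by (simp add: cell_coord_def coord_involution)
  then show ?thesis ..
qed

lemma open_cell_nonempty: "open_cell c \<noteq> {}"
proof (cases c)
  case (fields f b d)
  have "\<exists>p. cell_coord f b p = (if d then (2/3, 5/6) else (1/6, 2/3))"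
    using cell_coord_surj by (cases d) simp_all
  then obtain p where "cell_coord f b p = (if d then (2/3, 5/6) else (1/6, 2/3))" ..
  then have "p \<in> open_cell c" by (auto simp: fields open_tri_def)
  then show ?thesis by blast
qed

lemma closure_open_cell: "closure (open_cell c) = closed_cell c"
proof
  show "closure (open_cell c) \<subseteq> closed_cell c"
    by (simp add: closure_minimal open_cell_subset closed_closed_cell)
  show "closed_cell c \<subseteq> closure (open_cell c)"
  proof
    fix p assume p: "p \<in> closed_cell c"
    obtain q where q: "q \<in> open_cell c" using open_cell_nonempty by blast
    show "p \<in> closure (open_cell c)"
    proof (cases "p = q")
      case True then show ?thesis using q closure_subset by auto
    next
      case False
      have "open_segment p q \<subseteq> open_cell c"
        using mix_cell[OF p q] False by (force simp: in_segment)
      then have "closure (open_segment p q) \<subseteq> closure (open_cell c)" by (rule closure_mono)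
      then show ?thesis using False by auto
    qed
  qed
qed

lemma interior_closed_cell: "interior (closed_cell c) = open_cell c"
  using convex_interior_closure[OF convex_open_cell[of c]] open_open_cell[of c]
  by (simp add: closure_open_cell interior_open)

lemma closed_tri_bounds: "(s, t) \<in> closed_tri d \<Longrightarrow> 0 \<le> s \<and> s \<le> t \<and> t \<le> 1"
  by (auto simp: closed_tri_def split: if_splits)
lemma open_tri_bounds: "(s, t) \<in> open_tri d \<Longrightarrow> 0 < s \<and> s < t \<and> t < 1"
  by (auto simp: open_tri_def split: if_splits)

lemma closed_cell_bounds:
  assumes "(x, y) \<in> closed_cell (f, b, d)"
  shows "0 \<le> loc (fst f) x" "loc (fst f) x \<le> 1" "0 \<le> loc (snd f) y" "loc (snd f) y \<le> 1"
    "if b then loc (fst f) x \<le> loc (snd f) y else loc (snd f) y \<le> loc (fst f) x"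
  using closed_tri_bounds[of "fst (cell_coord f b (x, y))" "snd (cell_coord f b (x, y))" d] assms
  by (auto simp: cell_coord_def coord_def split: if_splits)

lemma open_cell_bounds:
  assumes "(x, y) \<in> open_cell (f, b, d)"
  shows "0 < loc (fst f) x" "loc (fst f) x < 1" "0 < loc (snd f) y" "loc (snd f) y < 1"
    "if b then loc (fst f) x < loc (snd f) y else loc (snd f) y < loc (fst f) x"
  using open_tri_bounds[of "fst (cell_coord f b (x, y))" "snd (cell_coord f b (x, y))" d] assms
  by (auto simp: cell_coord_def coord_def split: if_splits)

lemma loc_01: "0 \<le> loc i x \<and> loc i x \<le> 1 \<longleftrightarrow> of_int i \<le> x \<and> x \<le> of_int i + 1"
  "0 < loc i x \<and> loc i x < 1 \<longleftrightarrow> of_int i < x \<and> x < of_int i + 1"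
  by (auto simp: loc_def)

text \<open>The integer parts of an interior point fix the square, its side of the diagonal fixes
  \<open>b\<close>, and its side of the replacement segment fixes \<open>d\<close>.\<close>

lemma open_closed_cell_disjoint:
  assumes "p \<in> open_cell c" "p \<in> closed_cell c'"
  shows "c = c'"
proof -
  obtain x y where p: "p = (x, y)" by fastforce
  obtain f b d where c: "c = (f, b, d)" by (metis prod_cases3)
  obtain f' b' d' where c': "c' = (f', b', d')" by (metis prod_cases3)
  note O = open_cell_bounds[OF assms(1)[unfolded p c]] and C = closed_cell_bounds[OF assms(2)[unfolded p c']]
  have "of_int (fst f) < x \<and> x < of_int (fst f) + 1" "of_int (snd f) < y \<and> y < of_int (snd f) + 1"
    using O loc_01 by blast+
  moreover have "of_int (fst f') \<le> x \<and> x \<le> of_int (fst f') + 1" "of_int (snd f') \<le> y \<and> y \<le> of_int (snd f') + 1"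
    using C loc_01 by blast+
  ultimately have "fst f = fst f'" "snd f = snd f'" by linarith+
  then have f: "f = f'" by (simp add: prod_eq_iff)
  then have b: "b = b'" using O C by (auto split: if_splits)
  have "d = d'" using assms by (auto simp: c c' f b open_tri_def closed_tri_def split: if_splits)
  then show ?thesis by (simp add: c c' f b)
qed

text \<open>The other pieces form an open set, so each piece is clopen in the union; a connected
  superset of it inside the union cannot be larger.\<close>

lemma components_disjoint_open_Union:
  assumes opn: "\<And>c. c \<in> I \<Longrightarrow> open (U c)" and con: "\<And>c. c \<in> I \<Longrightarrow> connected (U c)"
    and ne: "\<And>c. c \<in> I \<Longrightarrow> U c \<noteq> {}"
    and disj: "\<And>c c'. c \<in> I \<Longrightarrow> c' \<in> I \<Longrightarrow> c \<noteq> c' \<Longrightarrow> U c \<inter> U c' = {}"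
  shows "components (\<Union>c\<in>I. U c) = U ` I"
proof -
  have comp: "U c \<in> components (\<Union>c\<in>I. U c)" if c: "c \<in> I" for c
    unfolding in_components_maximal
  proof (intro conjI allI impI)
    fix d assume d: "d \<noteq> {} \<and> U c \<subseteq> d \<and> d \<subseteq> (\<Union>c\<in>I. U c) \<and> connected d"
    define W where "W = (\<Union>c'\<in>I - {c}. U c')"
    have "open W" "U c \<inter> W \<inter> d = {}" "d \<subseteq> U c \<union> W"
      using opn disj[OF c] d by (auto simp: W_def)
    then have "U c \<inter> d = {} \<or> W \<inter> d = {}" using connectedD[of d "U c" W] opn[OF c] d by blast
    then show "d = U c" using d ne[OF c] \<open>d \<subseteq> U c \<union> W\<close> by blast
  qed (use that ne con in auto)
  show ?thesis
  proof (intro equalityI subsetI)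
    fix K assume K: "K \<in> components (\<Union>c\<in>I. U c)"
    then obtain x where x: "x \<in> K" using in_components_nonempty by blast
    then obtain c where "c \<in> I" "x \<in> U c" using in_components_subset[OF K] by blast
    then have "K = U c" using components_nonoverlap[OF K comp] x by blast
    then show "K \<in> U ` I" using \<open>c \<in> I\<close> by blast
  qed (use comp in auto)
qed

section \<open>The complement of the skeleton\<close>

lemma abs_loc:
  assumes "0 \<le> loc i x" "loc i x \<le> 1"
  shows "\<bar>x - of_int (even_of i)\<bar> = loc i x" "\<bar>x - of_int (odd_of i)\<bar> = 1 - loc i x"
  using assms by (auto simp: loc_def even_of_def odd_of_def)

lemma odd_cell_node: "odd (fst (cell_node f b) + snd (cell_node f b))"
  by (auto simp: node_defs)

text \<open>A rhombus has one side in each square at its node, and \<open>coord\<close> moves that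
  side to the line through \<open>(0, 0)\<close> and \<open>(1/2, 1)\<close>.\<close>

lemma on_replacement_coord:
  assumes "0 \<le> loc (fst f) (fst p)" "loc (fst f) (fst p) \<le> 1" "0 \<le> loc (snd f) (snd p)" "loc (snd f) (snd p) \<le> 1"
  shows "on_replacement (cell_node f b) p \<longleftrightarrow> snd (cell_coord f b p) = 2 * fst (cell_coord f b p)"
proof -
  note A = abs_loc[OF assms(1,2)] abs_loc[OF assms(3,4)]
  have 1: "\<bar>fst p - of_int (fst (cell_node f b))\<bar> = (if b then loc (fst f) (fst p) else 1 - loc (fst f) (fst p))"
    "\<bar>snd p - of_int (snd (cell_node f b))\<bar> = (if b then 1 - loc (snd f) (snd p) else loc (snd f) (snd p))"
    by (simp_all add: cell_node_def A)
  show ?thesis unfolding on_replacement_def 1 cell_coord_def coord_def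
    by (cases b; cases "cell_node f b \<in> first_nodes") auto
qed

text \<open>In every unit square the drawn diagonal joins the corner with two even coordinates to
  the one with two odd coordinates. It is of type \<open>y - x = 2c\<close> or
  \<open>x + y = 2c\<close> according to the parity of \<open>i + j\<close>.\<close>

lemma loc_eq_imp_diagonal:
  assumes "loc i x = loc j y"
  shows "(\<exists>c::int. y - x = 2 * of_int c) \<or> (\<exists>c::int. x + y = 2 * of_int c)"
proof (cases "even i = even j")
  case True
  then have "even (j - i)" by simp
  then obtain c where c: "j - i = 2 * c" by (rule evenE)
  have "y - x = of_int (j - i)" using assms True by (auto simp: loc_def split: if_splits)
  then have "y - x = 2 * of_int c" by (simp add: c)
  then show ?thesis by blast
next
  case False
  then have "even (i + j + 1)" by simp
  then obtain c where c: "i + j + 1 = 2 * c" by (rule evenE)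
  have "x + y = of_int (i + j + 1)" using assms False by (auto simp: loc_def split: if_splits)
  then have "x + y = 2 * of_int c" by (simp only: c)
  then show ?thesis by blast
qed

lemma diagonal_imp_loc_eq:
  assumes "0 < loc i x" "loc i x < 1" "0 < loc j y" "loc j y < 1"
    and "(\<exists>c::int. y - x = 2 * of_int c) \<or> (\<exists>c::int. x + y = 2 * of_int c)"
  shows "loc i x = loc j y"
  using assms(5)
proof
  assume "\<exists>c::int. y - x = 2 * of_int c"
  then obtain c :: int where c: "y - x = 2 * of_int c" ..
  have "of_int (j - i - 1) < (of_int (2 * c) :: real)" "(of_int (2 * c) :: real) < of_int (j - i + 1)"
    using c assms by (auto simp: loc_def split: if_splits)
  then have d: "2 * c = j - i" unfolding of_int_less_iff by linarith
  then have "even i = even j" by presburger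
  moreover have "y - x = of_int (j - i)" using c by (simp flip: d)
  ultimately show ?thesis by (auto simp: loc_def)
next
  assume "\<exists>c::int. x + y = 2 * of_int c"
  then obtain c :: int where c: "x + y = 2 * of_int c" ..
  have "of_int (i + j) < (of_int (2 * c) :: real)" "(of_int (2 * c) :: real) < of_int (i + j + 2)"
    using c assms by (auto simp: loc_def split: if_splits)
  then have d: "2 * c = i + j + 1" unfolding of_int_less_iff by linarith
  then have "even i \<noteq> even j" by presburger
  moreover have "x + y = of_int (i + j + 1)" using c by (simp flip: d)
  ultimately show ?thesis by (auto simp: loc_def)
qed

lemma floor_loc:
  assumes "x \<notin> \<int>"
  shows "0 < loc \<lfloor>x\<rfloor> x \<and> loc \<lfloor>x\<rfloor> x < 1"
proof -
  have "of_int \<lfloor>x\<rfloor> \<noteq> x" using assms by (metis Ints_of_int)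
  moreover have "of_int \<lfloor>x\<rfloor> \<le> x" "x < of_int \<lfloor>x\<rfloor> + 1" by linarith+
  ultimately show ?thesis unfolding loc_01 by linarith
qed

lemma weighted_less: "2 * p + q = 1 \<Longrightarrow> 0 < p \<Longrightarrow> 0 < q \<Longrightarrow> p < 1 \<and> q < (1::real)"
  "p + 2 * q = 1 \<Longrightarrow> 0 < p \<Longrightarrow> 0 < q \<Longrightarrow> p < 1 \<and> q < (1::real)"
  by auto

lemma compl_L_skeleton: "- L_skeleton = (\<Union>c. open_cell c)"
proof (intro equalityI subsetI)
  fix p assume "p \<in> - L_skeleton"
  obtain x y where p: "p = (x, y)" by fastforce
  with \<open>p \<in> - L_skeleton\<close> have n: "x \<notin> \<int>" "y \<notin> \<int>"
    "\<not> ((\<exists>c::int. y - x = 2 * of_int c) \<or> (\<exists>c::int. x + y = 2 * of_int c))"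
    "\<And>z. odd (fst z + snd z) \<Longrightarrow> \<not> on_replacement z (x, y)"
    unfolding p Compl_iff L_skeleton_iff by blast+
  define f where "f = (\<lfloor>x\<rfloor>, \<lfloor>y\<rfloor>)"
  define b where "b \<longleftrightarrow> loc (fst f) x < loc (snd f) y"
  obtain s t where st: "cell_coord f b p = (s, t)" by fastforce
  have l: "0 < loc (fst f) x \<and> loc (fst f) x < 1" "0 < loc (snd f) y \<and> loc (snd f) y < 1"
    using floor_loc n(1,2) by (auto simp: f_def)
  have "loc (fst f) x \<noteq> loc (snd f) y" using loc_eq_imp_diagonal n(3) by blast
  then have "0 < s \<and> s < t \<and> t < 1" using l st by (auto simp: b_def p cell_coord_def coord_def split: if_splits)
  moreover have "t \<noteq> 2 * s"
    using n(4)[OF odd_cell_node, of f b] on_replacement_coord[of f p b] l st by (auto simp: p)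
  ultimately have "p \<in> open_cell (f, b, t < 2 * s)" by (auto simp: st open_tri_def)
  then show "p \<in> (\<Union>c. open_cell c)" by blast
next
  fix p assume "p \<in> (\<Union>c. open_cell c)"
  then obtain f b d where c: "p \<in> open_cell (f, b, d)" by (metis UN_E prod_cases3)
  obtain x y where p: "p = (x, y)" by fastforce
  obtain s t where st: "cell_coord f b p = (s, t)" by fastforce
  note l = open_cell_bounds[OF c[unfolded p]]
  have x: "of_int (fst f) < x" "x < of_int (fst f) + 1" and y: "of_int (snd f) < y" "y < of_int (snd f) + 1"
    using l loc_01 by blast+
  have nx: "x \<notin> \<int>" using x by (force elim: Ints_cases)
  have ny: "y \<notin> \<int>" using y by (force elim: Ints_cases)
  have "loc (fst f) x \<noteq> loc (snd f) y" using l(5) by (auto split: if_splits)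
  then have diag: "\<not> ((\<exists>c::int. y - x = 2 * of_int c) \<or> (\<exists>c::int. x + y = 2 * of_int c))"
    using diagonal_imp_loc_eq l by blast
  \<comment> \<open>The replacements at all nodes must be avoided. A point of a rhombus with
    non-integral coordinates is less than one unit away from the node in each coordinate, so only
    the two odd corners of the square matter.\<close>
  have "\<not> on_replacement z (x, y)" if odd: "odd (fst z + snd z)" for z
  proof
    assume r: "on_replacement z (x, y)"
    have "x \<noteq> of_int (fst z)" "y \<noteq> of_int (snd z)" using nx ny by auto
    then have "\<bar>x - of_int (fst z)\<bar> < 1 \<and> \<bar>y - of_int (snd z)\<bar> < 1"
      using r weighted_less[of "\<bar>x - of_int (fst z)\<bar>" "\<bar>y - of_int (snd z)\<bar>"]
      by (auto simp: on_replacement_def split: if_splits)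
    then have "fst f - 1 < fst z" "fst z < fst f + 2" "snd f - 1 < snd z" "snd z < snd f + 2"
      using x y by linarith+
    then have "fst z = fst f \<or> fst z = fst f + 1" "snd z = snd f \<or> snd z = snd f + 1" by auto
    then have "z = cell_node f True \<or> z = cell_node f False"
      using odd by (cases z; cases f) (auto simp: node_defs)
    then consider "z = cell_node f b" | "z = cell_node f (\<not> b)" by (cases b) auto
    then show False
    proof cases
      case 1
      then have "t = 2 * s" using r on_replacement_coord[of f p b] l st by (simp add: p)
      then show False using c st by (auto simp: open_tri_def split: if_splits)
    next
      case 2
      \<comment> \<open>The replacement at the opposite odd corner stays in the other half of the
        square.\<close>
      then have "snd (cell_coord f (\<not> b) p) = 2 * fst (cell_coord f (\<not> b) p)"
        using r on_replacement_coord[of f p "\<not> b"] l by (simp add: p)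
      then show False using l by (cases b) (auto simp: p cell_coord_def coord_def split: if_splits)
    qed
  qed
  then show "p \<in> - L_skeleton" using nx ny diag unfolding p Compl_iff L_skeleton_iff by blast
qed

lemma components_L: "components (- L_skeleton) = range open_cell"
  unfolding compl_L_skeleton
proof (rule components_disjoint_open_Union)
  fix c c' :: cell assume "c \<noteq> c'"
  then show "open_cell c \<inter> open_cell c' = {}"
    using open_closed_cell_disjoint open_cell_subset by blast
qed (auto simp: open_open_cell convex_connected convex_open_cell open_cell_nonempty)

lemma L_regions_eq: "L_regions = range closed_cell"
  by (simp add: elementary_regions_def components_L image_image closure_open_cell)

section \<open>Vertices, edges and adjacency of cells\<close>

lemma L_vertices_iff:
  "(x, y) \<in> L_vertices \<longleftrightarrow> x \<in> \<int> \<and> y \<in> \<int>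
    \<or> (\<exists>a b. (a, b) \<in> first_nodes \<and> \<bar>x - of_int a\<bar> = 1/2 \<and> y = of_int b)
    \<or> (\<exists>a b. (a, b) \<in> second_nodes \<and> x = of_int a \<and> \<bar>y - of_int b\<bar> = 1/2)"
proof -
  have 1: "(x, y) \<in> range node \<longleftrightarrow> x \<in> \<int> \<and> y \<in> \<int>"
    by (auto simp: node_def image_iff elim!: Ints_cases)
  have h: "x = a + 1/2 \<or> x = a - 1/2 \<longleftrightarrow> \<bar>x - a\<bar> = 1/2" for x a :: real by (auto simp: abs_if)
  have "(x, y) \<in> first_new_vertices (node (a, b)) \<longleftrightarrow> \<bar>x - of_int a\<bar> = 1/2 \<and> y = of_int b" for a b
    unfolding first_new_vertices_def node_def h[symmetric] by auto
  then have 2: "(x, y) \<in> (\<Union>p \<in> first_nodes. first_new_vertices (node p)) \<longleftrightarrow>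
      (\<exists>a b. (a, b) \<in> first_nodes \<and> \<bar>x - of_int a\<bar> = 1/2 \<and> y = of_int b)"
    unfolding UN_iff Bex_def split_paired_Ex by simp
  have "(x, y) \<in> second_new_vertices (node (a, b)) \<longleftrightarrow> x = of_int a \<and> \<bar>y - of_int b\<bar> = 1/2" for a b
    unfolding second_new_vertices_def node_def h[symmetric] by auto
  then have 3: "(x, y) \<in> (\<Union>p \<in> second_nodes. second_new_vertices (node p)) \<longleftrightarrow>
      (\<exists>a b. (a, b) \<in> second_nodes \<and> x = of_int a \<and> \<bar>y - of_int b\<bar> = 1/2)"
    unfolding UN_iff Bex_def split_paired_Ex by simp
  show ?thesis unfolding L_vertices_def Un_iff 1 2 3 by blast
qed

lemma inj_cell_coord: "cell_coord f b p = cell_coord f b q \<Longrightarrow> p = q"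
proof (cases p; cases q)
  fix x y x' y' assume p: "p = (x, y)" "q = (x', y')" and *: "cell_coord f b p = cell_coord f b q"
  then have "loc (fst f) x = loc (fst f) x'" "loc (snd f) y = loc (snd f) y'"
    by (auto simp: cell_coord_def coord_def split: if_splits)
  then show "p = q" by (metis p unloc_loc)
qed

lemma Ints_of_int_minus: "of_int k - x \<in> \<int> \<longleftrightarrow> (x::real) \<in> \<int>"
proof
  assume "of_int k - x \<in> \<int>"
  then have "of_int k - (of_int k - x) \<in> \<int>" by (intro Ints_diff) auto
  then show "x \<in> \<int>" by simp
qed (auto intro: Ints_diff)

lemma Ints_1_minus [simp]: "1 - (x::real) \<in> \<int> \<longleftrightarrow> x \<in> \<int>"
  using Ints_of_int_minus[of 1 x] by simp

lemma Ints_loc [simp]: "loc i x \<in> \<int> \<longleftrightarrow> x \<in> \<int>"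
  using Ints_of_int_minus[of i x] Ints_of_int_minus[of "i + 1" x] minus_in_Ints_iff[of "of_int i - x"]
  by (simp add: loc_def)

lemma not_Ints_between: "0 < (x::real) \<Longrightarrow> x < 1 \<Longrightarrow> x \<notin> \<int>"
  by (force elim: Ints_cases)

definition corners :: "(real \<times> real) set" where
  "corners = {(0, 0), (0, 1), (1, 1), (1/2, 1)}"

definition sides :: "((real \<times> real) \<times> real \<times> real) set" where
  "sides = {((0, 1), (1/2, 1)), ((1/2, 1), (1, 1)), ((0, 1), (0, 0)), ((0, 0), (1, 1)), ((1/2, 1), (0, 0))}"

lemma half_int_loc: "\<bar>x - of_int a\<bar> = 1/2 \<Longrightarrow> 0 \<le> loc i x \<Longrightarrow> loc i x \<le> 1 \<Longrightarrow> loc i x = 1/2 \<and> (a = i \<or> a = i + 1)"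
proof -
  assume *: "\<bar>x - of_int a\<bar> = 1/2" "0 \<le> loc i x" "loc i x \<le> 1"
  then have x: "of_int i \<le> x" "x \<le> of_int i + 1" using loc_01 by blast+
  have "i - 1 < a" "a < i + 2" using x * by linarith+
  then have a: "a = i \<or> a = i + 1" by auto
  then have "x = of_int i + 1/2"
  proof
    assume "a = i"
    then have "\<bar>x - of_int a\<bar> = x - of_int i" using x by simp
    with *(1) show ?thesis by linarith
  next
    assume "a = i + 1"
    then have "\<bar>x - of_int a\<bar> = of_int i + 1 - x" using x by simp
    with *(1) show ?thesis by linarith
  qed
  then show ?thesis using a by (simp add: loc_def)
qed

text \<open>This keeps the sides of the triangles from being subdivided. A unit lattice edge has
  exactly one end of odd coordinate sum, so only that node can place a new vertex on it; parity then
  shows that the vertex is the chart corner \<open>(1/2, 1)\<close>.\<close>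

lemma vertex_coord:
  assumes "p \<in> L_vertices" "cell_coord f b p = (s, t)" "0 \<le> s" "s \<le> t" "t \<le> 1"
  shows "(s, t) \<in> corners"
proof -
  obtain x y where p: "p = (x, y)" by fastforce
  obtain i j where f: "f = (i, j)" by fastforce
  define h where "h \<longleftrightarrow> cell_node f b \<in> first_nodes"
  have l: "0 \<le> loc i x" "loc i x \<le> 1" "0 \<le> loc j y" "loc j y \<le> 1"
    using assms by (auto simp: p f cell_coord_def coord_def split: if_splits)
  have st: "coord b h (loc i x) (loc j y) = (s, t)" using assms(2) by (simp add: cell_coord_def p f h_def)
  have int01: "u = 0 \<or> u = 1" if "u \<in> \<int>" "0 \<le> u" "u \<le> (1::real)" for u
    using that not_Ints_between[of u] by fastforce
  consider "x \<in> \<int>" "y \<in> \<int>" | a c where "(a, c) \<in> first_nodes" "\<bar>x - of_int a\<bar> = 1/2" "y = of_int c"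
    | a c where "(a, c) \<in> second_nodes" "x = of_int a" "\<bar>y - of_int c\<bar> = 1/2"
    using assms(1) unfolding p L_vertices_iff by blast
  then show ?thesis
  proof cases
    case 1
    then have "(loc i x = 0 \<or> loc i x = 1) \<and> (loc j y = 0 \<or> loc j y = 1)" using int01 l by auto
    then show ?thesis using st assms(3-5) by (auto simp: coord_def corners_def split: if_splits)
  next
    case 2
    have x: "loc i x = 1/2" "a = i \<or> a = i + 1" using half_int_loc[OF 2(2)] l by auto
    have y: "loc j y = 0 \<or> loc j y = 1" using int01 l 2(3) by auto
    have "c = (if loc j y = 0 then even_of j else odd_of j)"
      using y 2(3) by (auto simp: loc_def even_of_def odd_of_def split: if_splits)
    moreover have "odd (a + c)" using first_nodes_odd 2(1) by blast
    ultimately have ac: "(a, c) = cell_node f (loc j y = 1)"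
      using x(2) y by (auto simp: cell_node_def f even_of_def odd_of_def split: if_splits)
    have b: "b \<longleftrightarrow> loc j y = 1" using y x(1) st assms(3-5) by (auto simp: coord_def split: if_splits)
    have h using 2(1) ac b by (simp add: h_def)
    then show ?thesis using st x(1) b y by (auto simp: coord_def corners_def split: if_splits)
  next
    case 3
    have y: "loc j y = 1/2" "c = j \<or> c = j + 1" using half_int_loc[OF 3(3)] l by auto
    have x: "loc i x = 0 \<or> loc i x = 1" using int01 l 3(2) by auto
    have "a = (if loc i x = 0 then even_of i else odd_of i)"
      using x 3(2) by (auto simp: loc_def even_of_def odd_of_def split: if_splits)
    moreover have "odd (a + c)" "(a, c) \<notin> first_nodes" using second_nodes_iff 3(1) by auto
    ultimately have ac: "(a, c) = cell_node f (loc i x = 0)"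
      using y(2) x by (auto simp: cell_node_def f even_of_def odd_of_def split: if_splits)
    have b: "b \<longleftrightarrow> loc i x = 0" using y x st assms(3-5) by (auto simp: coord_def split: if_splits)
    have "\<not> h" using \<open>(a, c) \<notin> first_nodes\<close> ac b by (simp add: h_def)
    then show ?thesis using st y(1) b x by (auto simp: coord_def corners_def split: if_splits)
  qed
qed

lemma corner_vertex:
  assumes "cell_coord f b p = (s, t)" "(s, t) \<in> corners"
  shows "p \<in> L_vertices"
proof -
  obtain x y where p: "p = (x, y)" by fastforce
  obtain i j where f: "f = (i, j)" by fastforce
  define h where "h \<longleftrightarrow> cell_node f b \<in> first_nodes"
  have st: "coord b h (loc i x) (loc j y) = (s, t)" using assms(1) by (simp add: cell_coord_def p f h_def)
  show ?thesis
  proof (cases "s = 1/2")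
    case False
    then have "s \<in> \<int>" "t \<in> \<int>" using assms(2) by (auto simp: corners_def)
    then have "x \<in> \<int>" "y \<in> \<int>"
      using st by (auto simp: coord_def split: if_splits)
    then show ?thesis by (simp add: p L_vertices_iff)
  next
    case True
    then have t: "t = 1" using assms(2) by (auto simp: corners_def)
    have snd: "\<not> h \<Longrightarrow> cell_node f b \<in> second_nodes" using odd_cell_node by (simp add: h_def second_nodes_iff)
    show ?thesis
    proof (cases h)
      case True
      have "\<bar>x - of_int (fst (cell_node f b))\<bar> = 1/2 \<and> y = of_int (snd (cell_node f b))"
        using st True \<open>s = 1/2\<close> t
        by (auto simp: coord_def f cell_node_def loc_def even_of_def odd_of_def abs_if split: if_splits)
      then show ?thesis using True unfolding p L_vertices_iff h_def by (metis prod.collapse)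
    next
      case False
      have "x = of_int (fst (cell_node f b)) \<and> \<bar>y - of_int (snd (cell_node f b))\<bar> = 1/2"
        using st False \<open>s = 1/2\<close> t
        by (auto simp: coord_def f cell_node_def loc_def even_of_def odd_of_def abs_if split: if_splits)
      then show ?thesis using snd[OF False] unfolding p L_vertices_iff by (metis prod.collapse)
    qed
  qed
qed

lemma side_in_skeleton:
  assumes "cell_coord f b p = (s, t)" "s = 0 \<or> t = 1 \<or> s = t \<or> t = 2 * s" "0 \<le> s" "s \<le> t" "t \<le> 1"
  shows "p \<in> L_skeleton"
proof -
  obtain x y where p: "p = (x, y)" by fastforce
  obtain i j where f: "f = (i, j)" by fastforce
  define h where "h \<longleftrightarrow> cell_node f b \<in> first_nodes"
  have st: "coord b h (loc i x) (loc j y) = (s, t)" using assms(1) by (simp add: cell_coord_def p f h_def)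
  have l: "0 \<le> loc i x" "loc i x \<le> 1" "0 \<le> loc j y" "loc j y \<le> 1"
    using assms by (auto simp: p f cell_coord_def coord_def split: if_splits)
  consider "s \<in> \<int> \<or> t \<in> \<int>" | "s = t" | "t = 2 * s" using assms(2) by auto
  then show ?thesis
  proof cases
    case 1
    then have "loc i x \<in> \<int> \<or> loc j y \<in> \<int>" using st by (auto simp: coord_def split: if_splits)
    then have "x \<in> \<int> \<or> y \<in> \<int>" by simp
    then show ?thesis unfolding p L_skeleton_iff by blast
  next
    case 2
    then have "loc i x = loc j y" using st by (auto simp: coord_def split: if_splits)
    then show ?thesis using loc_eq_imp_diagonal unfolding p L_skeleton_iff by blast
  next
    case 3
    then have "on_replacement (cell_node f b) p"
      using on_replacement_coord[of f p b] l assms(1) by (simp add: p f)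
    then show ?thesis using odd_cell_node unfolding p L_skeleton_iff by blast
  qed
qed

lemma side_edge:
  assumes "(cell_coord f b p, cell_coord f b q) \<in> sides"
  shows "closed_segment p q \<in> L_edges"
proof -
  have V: "p \<in> L_vertices" "q \<in> L_vertices"
  proof -
    have "cell_coord f b p \<in> corners" "cell_coord f b q \<in> corners"
      using assms by (auto simp: sides_def corners_def)
    then show "p \<in> L_vertices" "q \<in> L_vertices" by (metis corner_vertex surj_pair)+
  qed
  have ne: "p \<noteq> q" using assms by (auto simp: sides_def)
  have "r \<in> L_skeleton - L_vertices" if r: "r \<in> open_segment p q" for r
  proof -
    obtain u where u: "0 < u" "u < 1" "r = (1 - u) *\<^sub>R p + u *\<^sub>R q"
      using r by (auto simp: in_segment)
    obtain s t where st: "cell_coord f b r = (s, t)" by fastforce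
    have "(s, t) = (1 - u) *\<^sub>R cell_coord f b p + u *\<^sub>R cell_coord f b q"
      using st by (simp only: u cell_coord_affine)
    then have "(s, t) \<in> {(u/2, 1), (1/2 + u/2, 1), (0, 1 - u), (u, u), ((1-u)/2, 1-u)}"
      using assms by (auto simp: sides_def field_simps)
    then have "0 \<le> s \<and> s \<le> t \<and> t \<le> 1 \<and> (s = 0 \<or> t = 1 \<or> s = t \<or> t = 2 * s) \<and> (s, t) \<notin> corners"
      using u by (auto simp: corners_def)
    then show ?thesis using st side_in_skeleton vertex_coord by blast
  qed
  then show ?thesis unfolding subdiv_edges_def using V ne by blast
qed

text \<open>The alternatives are the kinds of common sides: the replacement segment, the diagonal of
  a square, and a part of a unit edge at the common node. A cell with \<open>d\<close> has a leg
  only on the axis carrying the new vertices, hence the side conditions.\<close>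

definition cell_adj :: "cell \<Rightarrow> cell \<Rightarrow> bool" where
  "cell_adj c c' = (case c of (f, b, d) \<Rightarrow> case c' of (f', b', d') \<Rightarrow>
     f = f' \<and> b = b' \<and> d \<noteq> d' \<or> f = f' \<and> b \<noteq> b' \<and> d \<and> d' \<or>
     b = b' \<and> d = d' \<and> cell_node f b = cell_node f' b \<and>
       (snd f = snd f' \<and> fst f \<noteq> fst f' \<and> (d \<longrightarrow> cell_node f b \<notin> first_nodes) \<or>
        fst f = fst f' \<and> snd f \<noteq> snd f' \<and> (d \<longrightarrow> cell_node f b \<in> first_nodes)))"

lemma coord_surj': obtains p where "cell_coord f b p = st"
  using cell_coord_surj[of f b "fst st" "snd st"] by auto

lemma edge_of_sides:
  assumes "(P, R) \<in> sides" "\<And>p. cell_coord f b p \<in> {P, R} \<Longrightarrow> p \<in> closed_cell c \<and> p \<in> closed_cell c'"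
  shows "\<exists>e \<in> L_edges. e \<subseteq> closed_cell c \<and> e \<subseteq> closed_cell c'"
proof -
  obtain p where p: "cell_coord f b p = P" by (rule coord_surj')
  obtain q where q: "cell_coord f b q = R" by (rule coord_surj')
  have "closed_segment p q \<in> L_edges" using side_edge[of f b p q] assms(1) p q by simp
  moreover have "closed_segment p q \<subseteq> closed_cell c" "closed_segment p q \<subseteq> closed_cell c'"
    using assms(2)[of p] assms(2)[of q] p q closed_segment_subset convex_closed_cell by blast+
  ultimately show ?thesis by blast
qed

lemma cell_adj_edge:
  assumes "cell_adj c c'"
  shows "\<exists>e \<in> L_edges. e \<subseteq> closed_cell c \<and> e \<subseteq> closed_cell c'"
proof -
  obtain f b d where c: "c = (f, b, d)" by (metis prod_cases3)
  obtain f' b' d' where c': "c' = (f', b', d')" by (metis prod_cases3)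
  define h where "h \<longleftrightarrow> cell_node f b \<in> first_nodes"
  consider "f = f'" "b = b'" "d \<noteq> d'" | "f = f'" "b \<noteq> b'" "d" "d'"
    | "b = b'" "d = d'" "cell_node f b = cell_node f' b" "snd f = snd f'" "fst f \<noteq> fst f'" "d \<longrightarrow> \<not> h"
    | "b = b'" "d = d'" "cell_node f b = cell_node f' b" "fst f = fst f'" "snd f \<noteq> snd f'" "d \<longrightarrow> h"
    using assms unfolding cell_adj_def c c' prod.case h_def by blast
  then show ?thesis
  proof cases
    case 1
    show ?thesis by (rule edge_of_sides[of "(1/2, 1)" "(0, 0)" f b]) (auto simp: sides_def c c' 1 closed_tri_def)
  next
    case 2
    have "cell_coord f b' p \<in> {(0, 0), (1, 1)}" if "cell_coord f b p \<in> {(0, 0), (1, 1)}" for p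
      using that by (auto simp: cell_coord_def coord_def split: if_splits)
    then show ?thesis by (intro edge_of_sides[of "(0, 0)" "(1, 1)" f b]) (force simp: sides_def c c' 2 closed_tri_def)+
  next
    case 3
    \<comment> \<open>On the common leg the reflected coordinate takes the same value in both
      squares, so the two charts agree there.\<close>
    have eq: "cell_coord f' b p = cell_coord f b p" if "if h then fst (cell_coord f b p) = 0 else snd (cell_coord f b p) = 1" for p
    proof -
      have "loc (fst f) (fst p) = (if b then 0 else 1)"
        using that by (auto simp: cell_coord_def coord_def h_def split: if_splits)
      then have "loc (fst f') (fst p) = loc (fst f) (fst p)"
        using 3(3) by (auto simp: loc_def node_defs split: if_splits)
      then show ?thesis using 3 by (simp add: cell_coord_def)
    qed
    show ?thesis
      by (rule edge_of_sides[of "if \<not> h \<and> d then (1/2, 1) else (0, 1)" "if h then (0, 0) else if d then (1, 1) else (1/2, 1)" f b])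
        (use eq 3 in \<open>cases h; cases d; auto simp: sides_def c c' closed_tri_def\<close>)+
  next
    case 4
    have eq: "cell_coord f' b p = cell_coord f b p" if "if h then snd (cell_coord f b p) = 1 else fst (cell_coord f b p) = 0" for p
    proof -
      have "loc (snd f) (snd p) = (if b then 1 else 0)"
        using that by (auto simp: cell_coord_def coord_def h_def split: if_splits)
      then have "loc (snd f') (snd p) = loc (snd f) (snd p)"
        using 4(3) by (auto simp: loc_def node_defs split: if_splits)
      then show ?thesis using 4 by (simp add: cell_coord_def)
    qed
    show ?thesis
      by (rule edge_of_sides[of "if h \<and> d then (1/2, 1) else (0, 1)" "if \<not> h then (0, 0) else if d then (1, 1) else (1/2, 1)" f b])
        (use eq 4 in \<open>cases h; cases d; auto simp: sides_def c c' closed_tri_def\<close>)+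
  qed
qed

text \<open>Two common points do the work of a common edge: both lie on one side line of each
  triangle, and two distinct points on such a line determine the flags.\<close>

lemma cell_adj_if_two_common:
  assumes pq: "p \<noteq> q" "p \<in> closed_cell c" "q \<in> closed_cell c" "p \<in> closed_cell c'" "q \<in> closed_cell c'"
    and ne: "c \<noteq> c'"
  shows "cell_adj c c'"
proof -
  obtain i j b d where c: "c = ((i, j), b, d)" by (metis prod.collapse)
  obtain i' j' b' d' where c': "c' = ((i', j'), b', d')" by (metis prod.collapse)
  obtain x y where p: "p = (x, y)" by fastforce
  obtain x' y' where q: "q = (x', y')" by fastforce
  define h where "h \<longleftrightarrow> cell_node (i, j) b \<in> first_nodes"
  note bp = closed_cell_bounds[OF pq(2)[unfolded c p]] and bq = closed_cell_bounds[OF pq(3)[unfolded c q]]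
    and bp' = closed_cell_bounds[OF pq(4)[unfolded c' p]] and bq' = closed_cell_bounds[OF pq(5)[unfolded c' q]]
  note B = bp bq bp' bq'
  have r: "of_int i \<le> x" "x \<le> of_int i + 1" "of_int j \<le> y" "y \<le> of_int j + 1"
    "of_int i \<le> x'" "x' \<le> of_int i + 1" "of_int j \<le> y'" "y' \<le> of_int j + 1"
    "of_int i' \<le> x" "x \<le> of_int i' + 1" "of_int j' \<le> y" "y \<le> of_int j' + 1"
    "of_int i' \<le> x'" "x' \<le> of_int i' + 1" "of_int j' \<le> y'" "y' \<le> of_int j' + 1"
    using B loc_01 by (metis fst_conv snd_conv)+
  \<comment> \<open>Squares that differ in a coordinate pin that coordinate of both points to one
    grid line; differing in both coordinates would make the points equal.\<close>
  have fi: "x = x' \<and> x = of_int (max i i') \<and> (i' = i + 1 \<or> i = i' + 1)" if "i \<noteq> i'"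
    using that r by linarith
  have fj: "y = y' \<and> y = of_int (max j j') \<and> (j' = j + 1 \<or> j = j' + 1)" if "j \<noteq> j'"
    using that r by linarith
  have inj: "cell_coord f b p \<noteq> cell_coord f b q" for f b using inj_cell_coord pq(1) by blast
  obtain s t where st: "cell_coord (i, j) b p = (s, t)" by fastforce
  obtain s' t' where st': "cell_coord (i, j) b q = (s', t')" by fastforce
  have ct: "(s, t) \<in> closed_tri d" "(s', t') \<in> closed_tri d" "s \<noteq> s' \<or> t \<noteq> t'"
    using pq inj[of "(i, j)" b] st st' by (auto simp: c)
  consider "i = i'" "j = j'" | "i \<noteq> i'" "j = j'" | "i = i'" "j \<noteq> j'"
    using fi fj pq(1) p q by blast
  then show ?thesis
  proof cases
    case 1
    show ?thesis
    proof (cases "b = b'")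
      case True
      then show ?thesis using ne 1 by (simp add: cell_adj_def c c')
    next
      case False
      have eq: "loc i x = loc j y" "loc i x' = loc j y'"
        using B 1 False by (auto split: if_splits)
      have "s = t" "s' = t'" using st st' eq by (auto simp: p q cell_coord_def coord_def split: if_splits)
      then have d using ct by (auto simp: closed_tri_def split: if_splits)
      obtain u v where uv: "cell_coord (i, j) b' p = (u, v)" by fastforce
      obtain u' v' where uv': "cell_coord (i, j) b' q = (u', v')" by fastforce
      have "u = v" "u' = v'" using uv uv' eq by (auto simp: p q cell_coord_def coord_def split: if_splits)
      moreover have "(u, v) \<in> closed_tri d'" "(u', v') \<in> closed_tri d'" "u \<noteq> u' \<or> v \<noteq> v'"
        using pq inj[of "(i, j)" b'] uv uv' 1 by (auto simp: c')
      ultimately have d' by (auto simp: closed_tri_def split: if_splits)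
      then show ?thesis using \<open>d\<close> 1 False by (simp add: cell_adj_def c c')
    qed
  next
    case 2
    note x = fi[OF 2(1)]
    have yne: "y \<noteq> y'" using pq(1) p q x by auto
    then have yne': "loc j y \<noteq> loc j y'" by (metis unloc_loc)
    have lx: "loc i x = (if even (max i i') then 0 else 1)" "loc i' x = (if even (max i i') then 0 else 1)"
      "x' = x"
      using x by (auto simp: loc_def max_def)
    have bb: "b \<longleftrightarrow> even (max i i')" "b' \<longleftrightarrow> even (max i i')"
      using B lx yne' 2 by (auto split: if_splits)
    have node: "cell_node (i', j) b = cell_node (i, j) b"
      using x bb by (auto simp: node_defs max_def split: if_splits)
    then have eq: "cell_coord (i', j) b p = (s, t)" "cell_coord (i', j) b q = (s', t')"
      using st st' lx by (auto simp: cell_coord_def p q)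
    have axis: "if h then s = 0 \<and> s' = 0 else t = 1 \<and> t' = 1"
      using st st' lx bb by (auto simp: cell_coord_def h_def coord_def p q split: if_splits)
    have ct': "(s, t) \<in> closed_tri d'" "(s', t') \<in> closed_tri d'"
      using pq bb eq 2 by (auto simp: c')
    have "d = d'" using ct ct' axis by (auto simp: closed_tri_def split: if_splits)
    moreover have "\<not> h" if d using ct axis that by (auto simp: closed_tri_def split: if_splits)
    ultimately show ?thesis using bb node 2 by (auto simp: cell_adj_def c c' h_def)
  next
    case 3
    note y = fj[OF 3(2)]
    have xne: "x \<noteq> x'" using pq(1) p q y by auto
    then have xne': "loc i x \<noteq> loc i x'" by (metis unloc_loc)
    have ly: "loc j y = (if even (max j j') then 0 else 1)" "loc j' y = (if even (max j j') then 0 else 1)"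
      "y' = y"
      using y by (auto simp: loc_def max_def)
    have bb: "b \<longleftrightarrow> odd (max j j')" "b' \<longleftrightarrow> odd (max j j')"
      using B ly xne' 3 by (auto split: if_splits)
    have node: "cell_node (i, j') b = cell_node (i, j) b"
      using y bb by (auto simp: node_defs max_def split: if_splits)
    then have eq: "cell_coord (i, j') b p = (s, t)" "cell_coord (i, j') b q = (s', t')"
      using st st' ly by (auto simp: cell_coord_def p q)
    have axis: "if h then t = 1 \<and> t' = 1 else s = 0 \<and> s' = 0"
      using st st' ly bb by (auto simp: cell_coord_def h_def coord_def p q split: if_splits)
    have ct': "(s, t) \<in> closed_tri d'" "(s', t') \<in> closed_tri d'"
      using pq bb eq 3 by (auto simp: c')
    have "d = d'" using ct ct' axis by (auto simp: closed_tri_def split: if_splits)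
    moreover have "h" if d using ct axis that by (auto simp: closed_tri_def split: if_splits)
    ultimately show ?thesis using bb node 3 by (auto simp: cell_adj_def c c' h_def)
  qed
qed

lemma edge_iff_cell_adj:
  assumes "c \<noteq> c'"
  shows "(\<exists>e \<in> L_edges. e \<subseteq> closed_cell c \<and> e \<subseteq> closed_cell c') \<longleftrightarrow> cell_adj c c'"
proof
  assume "\<exists>e \<in> L_edges. e \<subseteq> closed_cell c \<and> e \<subseteq> closed_cell c'"
  then obtain a b where "a \<noteq> b" "closed_segment a b \<subseteq> closed_cell c" "closed_segment a b \<subseteq> closed_cell c'"
    unfolding subdiv_edges_def by blast
  then show "cell_adj c c'" using assms by (intro cell_adj_if_two_common[of a b]) auto
qed (rule cell_adj_edge)

section \<open>Tilings as perfect matchings of the dual graph\<close>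

definition matchings :: "('e \<Rightarrow> 'v set) \<Rightarrow> 'v set \<Rightarrow> 'e set \<Rightarrow> 'e set set" where
  "matchings inc V E = {M. M \<subseteq> E \<and> (\<Union>e\<in>M. inc e) = V \<and> disjoint_family_on inc M}"

definition dual_edges :: "cell set set" where
  "dual_edges = {{c, c'} | c c'. cell_adj c c'}"

definition cells_union :: "cell set \<Rightarrow> plane set" where
  "cells_union X = (\<Union>c\<in>X. closed_cell c)"

text \<open>An interior point of a cell lies in no other closed cell, so a union of cells remembers
  which cells it consists of.\<close>

lemma cells_union_mono_iff: "cells_union X \<subseteq> cells_union Y \<longleftrightarrow> X \<subseteq> Y"
proof
  assume *: "cells_union X \<subseteq> cells_union Y"
  show "X \<subseteq> Y"
  proof
    fix c assume "c \<in> X"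
    obtain p where p: "p \<in> open_cell c" using open_cell_nonempty by blast
    then have "p \<in> cells_union Y" using * \<open>c \<in> X\<close> open_cell_subset unfolding cells_union_def by blast
    then show "c \<in> Y" using open_closed_cell_disjoint[OF p] unfolding cells_union_def by blast
  qed
qed (auto simp: cells_union_def)

lemma inj_cells_union: "inj cells_union"
  by (rule injI) (metis cells_union_mono_iff subset_antisym subset_refl)

text \<open>Closed cells are closures of open ones, so a nonempty open set inside
  \<open>cells_union X\<close> meets some open cell of \<open>X\<close>, and that open cell avoids
  all closed cells outside \<open>X\<close>.\<close>

lemma interior_cells_union_disjoint:
  "interior (cells_union X) \<inter> interior (cells_union Y) = {} \<longleftrightarrow> X \<inter> Y = {}"
proof
  assume *: "interior (cells_union X) \<inter> interior (cells_union Y) = {}"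
  show "X \<inter> Y = {}"
  proof (rule ccontr)
    assume "X \<inter> Y \<noteq> {}"
    then obtain c where "c \<in> X" "c \<in> Y" by blast
    then have "open_cell c \<subseteq> cells_union X" "open_cell c \<subseteq> cells_union Y"
      using open_cell_subset unfolding cells_union_def by blast+
    then have "open_cell c \<subseteq> interior (cells_union X) \<inter> interior (cells_union Y)"
      using open_open_cell interior_maximal by blast
    then show False using * open_cell_nonempty by blast
  qed
next
  assume *: "X \<inter> Y = {}"
  define W where "W = interior (cells_union X) \<inter> interior (cells_union Y)"
  have W: "open W" "W \<subseteq> cells_union X" "W \<subseteq> cells_union Y"
    using interior_subset unfolding W_def by blast+
  have False if w: "w \<in> W" for w
  proof -
    obtain c where c: "c \<in> X" "w \<in> closure (open_cell c)"
      using w W(2) unfolding cells_union_def closure_open_cell by blast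
    then have "open_cell c \<inter> W \<noteq> {}" using w W(1) open_Int_closure_eq_empty by blast
    then show False using c * W(3) open_closed_cell_disjoint unfolding cells_union_def by blast
  qed
  then show "interior (cells_union X) \<inter> interior (cells_union Y) = {}" unfolding W_def by blast
qed

lemma closed_cell_eq_iff: "closed_cell c = closed_cell c' \<longleftrightarrow> c = c'"
  using cells_union_mono_iff[of "{c}" "{c'}"] by (auto simp: cells_union_def simp del: closed_cell.simps)

lemma cell_adj_irrefl: "cell_adj c c' \<Longrightarrow> c \<noteq> c'"
  by (auto simp: cell_adj_def split: prod.splits)

lemma tiles_eq: "tiles L_vertices L_skeleton = cells_union ` dual_edges"
proof -
  have pair: "cells_union {c, c'} = closed_cell c \<union> closed_cell c'" for c c'
    by (simp add: cells_union_def del: closed_cell.simps)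
  show ?thesis
  proof (intro equalityI subsetI)
    fix t assume "t \<in> tiles L_vertices L_skeleton"
    then obtain c c' where t: "t = closed_cell c \<union> closed_cell c'" "closed_cell c \<noteq> closed_cell c'"
      "\<exists>e \<in> L_edges. e \<subseteq> closed_cell c \<and> e \<subseteq> closed_cell c'"
      unfolding tiles_def L_regions_eq by blast
    then have "c \<noteq> c'" by metis
    then have "cell_adj c c'" by (rule iffD1[OF edge_iff_cell_adj t(3)])
    then show "t \<in> cells_union ` dual_edges" unfolding t(1) dual_edges_def pair[symmetric] by blast
  next
    fix t assume "t \<in> cells_union ` dual_edges"
    then obtain c c' where t: "t = cells_union {c, c'}" "cell_adj c c'" unfolding dual_edges_def by blast
    have "closed_cell c \<noteq> closed_cell c'" using cell_adj_irrefl[OF t(2)] unfolding closed_cell_eq_iff .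
    then show "t \<in> tiles L_vertices L_skeleton"
      unfolding tiles_def L_regions_eq t(1) pair using cell_adj_edge[OF t(2)] by blast
  qed
qed

lemma T_cells_union: "T (cells_union X) = card (matchings (\<lambda>e. e) X dual_edges)"
proof -
  have un: "\<Union>(cells_union ` M) = cells_union (\<Union>M)" for M by (auto simp: cells_union_def)
  have "tilings L_vertices L_skeleton (cells_union X) = (\<lambda>M. cells_union ` M) ` matchings (\<lambda>e. e) X dual_edges"
  proof (intro equalityI subsetI)
    fix P assume P: "P \<in> tilings L_vertices L_skeleton (cells_union X)"
    then have "P \<subseteq> cells_union ` dual_edges" "\<Union>P = cells_union X"
      by (simp_all add: tilings_def tiles_eq)
    then obtain M where M: "M \<subseteq> dual_edges" "P = cells_union ` M" by (meson subset_imageE)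
    have "cells_union (\<Union>M) = cells_union X" using \<open>\<Union>P = cells_union X\<close> unfolding M un .
    then have "\<Union>M = X" using inj_cells_union by (simp add: inj_eq)
    moreover have "disjoint_family_on (\<lambda>e. e) M"
      using P unfolding tilings_def M disjoint_family_on_def
      by (auto simp: interior_cells_union_disjoint inj_eq[OF inj_cells_union])
    ultimately show "P \<in> (\<lambda>M. cells_union ` M) ` matchings (\<lambda>e. e) X dual_edges"
      using M by (auto simp: matchings_def)
  next
    fix P assume "P \<in> (\<lambda>M. cells_union ` M) ` matchings (\<lambda>e. e) X dual_edges"
    then obtain M where M: "P = cells_union ` M" "M \<subseteq> dual_edges" "\<Union>M = X" "disjoint_family_on (\<lambda>e. e) M"
      by (auto simp: matchings_def)
    then show "P \<in> tilings L_vertices L_skeleton (cells_union X)"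
      unfolding tilings_def tiles_eq
    proof (intro CollectI conjI ballI impI)
      fix t u assume tu: "t \<in> P" "u \<in> P" "t \<noteq> u"
      then obtain e e' where e: "t = cells_union e" "u = cells_union e'" "e \<in> M" "e' \<in> M" unfolding M(1) by blast
      then have "e \<noteq> e'" using tu(3) by auto
      then have "e \<inter> e' = {}" using disjoint_family_onD[OF M(4) e(3,4)] by simp
      then show "interior t \<inter> interior u = {}" unfolding e interior_cells_union_disjoint .
    qed (use M un[of M] in auto)
  qed
  moreover have "inj_on (\<lambda>M. cells_union ` M) S" for S
    by (rule inj_onI) (simp only: inj_image_eq_iff[OF inj_cells_union])
  ultimately show ?thesis unfolding T_def tiling_number_def by (simp add: card_image)
qed

section \<open>The region as a set of cells\<close>

definition l1 :: "nat \<Rightarrow> int \<times> int \<Rightarrow> int" where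
  "l1 n z = \<bar>fst z - int n\<bar> + \<bar>snd z\<bar>"

text \<open>The squares whose diagonal lies on the frontier of the diamond, with the half at the
  (even, odd) corner outside. For positive \<open>n\<close> the outer cells of \<open>Q\<close> are
  the cells of these halves that touch the diagonal.\<close>

definition pendant :: "nat \<Rightarrow> (int \<times> int) set" where
  "pendant n = {f. l1 n (cell_node f True) = int n + 1 \<and> l1 n (cell_node f False) = int n - 1}"

definition region :: "nat \<Rightarrow> cell set" where
  "region n = {(f, b, d). l1 n (cell_node f b) < int n} \<union>
    (\<lambda>f. (f, True, True)) ` pendant n"

lemma node_dist:
  assumes "0 \<le> loc (fst f) x" "loc (fst f) x \<le> 1" "0 \<le> loc (snd f) y" "loc (snd f) y \<le> 1"
  shows "\<bar>x - of_int (fst (cell_node f b))\<bar> + \<bar>y - of_int (snd (cell_node f b))\<bar> =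
    (if b then loc (fst f) x + (1 - loc (snd f) y) else (1 - loc (fst f) x) + loc (snd f) y)"
  using assms by (simp add: cell_node_def abs_loc)

lemma closed_cell_dist:
  assumes "(x, y) \<in> closed_cell (f, b, d)"
  shows "\<bar>x - of_int (fst (cell_node f b))\<bar> + \<bar>y - of_int (snd (cell_node f b))\<bar> \<le> 1"
  unfolding node_dist[OF closed_cell_bounds(1-4)[OF assms]]
  using closed_cell_bounds(5)[OF assms] by auto

lemma open_cell_dist:
  assumes "(x, y) \<in> open_cell (f, b, d)"
  shows "\<bar>x - of_int (fst (cell_node f b))\<bar> + \<bar>y - of_int (snd (cell_node f b))\<bar> < 1"
  unfolding node_dist[OF open_cell_bounds(1-4)[OF assms, THEN less_imp_le]]
  using open_cell_bounds(5)[OF assms] by auto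

text \<open>By parity the distance of such a node from the centre is never exactly \<open>n\<close>,
  so no unit diamond is cut by the frontier of \<open>diamond n\<close>.\<close>

lemma odd_l1: "odd (l1 n (cell_node f b) + int n)"
proof -
  have "even (l1 n z + int n) = even (fst z + snd z)" for z
    unfolding l1_def by presburger
  then show ?thesis using odd_cell_node by blast
qed

lemma closed_cell_subset_diamond: "closed_cell (f, b, d) \<subseteq> diamond n \<longleftrightarrow> l1 n (cell_node f b) < int n"
proof
  assume l: "l1 n (cell_node f b) < int n"
  show "closed_cell (f, b, d) \<subseteq> diamond n"
  proof
    fix p assume "p \<in> closed_cell (f, b, d)"
    moreover obtain x y where p: "p = (x, y)" by fastforce
    ultimately have "\<bar>x - of_int (fst (cell_node f b))\<bar> + \<bar>y - of_int (snd (cell_node f b))\<bar> \<le> 1"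
      using closed_cell_dist by blast
    moreover have "real_of_int (l1 n (cell_node f b)) \<le> real n - 1" using l by linarith
    ultimately show "p \<in> diamond n" unfolding diamond_def p l1_def by simp
  qed
next
  assume sub: "closed_cell (f, b, d) \<subseteq> diamond n"
  show "l1 n (cell_node f b) < int n"
  proof (rule ccontr)
    assume "\<not> l1 n (cell_node f b) < int n"
    then have "l1 n (cell_node f b) \<ge> int n + 1" using odd_l1[of n f b] by presburger
    then have "real_of_int (l1 n (cell_node f b)) \<ge> real n + 1" by linarith
    moreover obtain p where "p \<in> open_cell (f, b, d)" using open_cell_nonempty by blast
    moreover obtain x y where p: "p = (x, y)" by fastforce
    ultimately have "\<bar>x - of_int (fst (cell_node f b))\<bar> + \<bar>y - of_int (snd (cell_node f b))\<bar> < 1" "p \<in> diamond n"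
      using open_cell_dist sub open_cell_subset by blast+
    with \<open>real_of_int (l1 n (cell_node f b)) \<ge> real n + 1\<close> show False
      unfolding diamond_def p l1_def by simp
  qed
qed

text \<open>On a unit square the l1 distance to the centre is affine in the \<open>loc\<close>
  coordinates; this is its slope in one of them.\<close>

definition slope :: "int \<Rightarrow> int \<Rightarrow> int" where
  "slope m i = (if (i \<ge> m) = even i then 1 else -1)"

lemma abs_slope:
  assumes "0 \<le> loc i x" "loc i x \<le> 1"
  shows "\<bar>x - of_int m\<bar> = of_int \<bar>even_of i - m\<bar> + of_int (slope m i) * loc i x"
proof -
  have x: "of_int i \<le> x" "x \<le> of_int i + 1" using loc_01 assms by blast+
  show ?thesis
  proof (cases "i \<ge> m")
    case True
    then have "\<bar>x - of_int m\<bar> = x - of_int m" "\<bar>even_of i - m\<bar> = even_of i - m"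
      using x by (auto simp: even_of_def)
    then show ?thesis using True by (simp add: slope_def loc_def even_of_def)
  next
    case False
    then have "i + 1 \<le> m" by simp
    then have "\<bar>x - of_int m\<bar> = of_int m - x" "\<bar>even_of i - m\<bar> = m - even_of i"
      using x by (auto simp: even_of_def)
    then show ?thesis using False by (simp add: slope_def loc_def even_of_def)
  qed
qed

lemma l1_cell_node:
  "l1 n (cell_node f b) = l1 n (even_of (fst f), even_of (snd f)) + (if b then slope 0 (snd f) else slope n (fst f))"
  by (auto simp: l1_def cell_node_def slope_def even_of_def odd_of_def)

lemma l1_square:
  assumes "0 \<le> loc (fst f) x" "loc (fst f) x \<le> 1" "0 \<le> loc (snd f) y" "loc (snd f) y \<le> 1"
  shows "\<bar>x - of_nat n\<bar> + \<bar>y\<bar> = of_int (l1 n (even_of (fst f), even_of (snd f)))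
    + of_int (slope n (fst f)) * loc (fst f) x + of_int (slope 0 (snd f)) * loc (snd f) y"
  using abs_slope[OF assms(1,2), of "int n"] abs_slope[OF assms(3,4), of 0] by (simp add: l1_def)

lemma slope_cases: "slope m i = 1 \<or> slope m i = -1"
  by (simp add: slope_def)

lemma frontier_diamond:
  assumes "n > 0"
  shows "frontier (diamond n) = {(x, y). \<bar>x - of_nat n\<bar> + \<bar>y\<bar> = of_nat n}"
proof -
  let ?g = "\<lambda>p::plane. \<bar>fst p - of_nat n\<bar> + \<bar>snd p\<bar>"
  have d: "diamond n = {p. ?g p \<le> of_nat n}" by (auto simp: diamond_def)
  have cl: "closed (diamond n)" unfolding d by (intro closed_Collect_le continuous_intros)
  have op: "open {p. ?g p < of_nat n}" by (intro open_Collect_less continuous_intros)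
  have "interior (diamond n) = {p. ?g p < of_nat n}"
  proof (intro equalityI)
    show "{p. ?g p < of_nat n} \<subseteq> interior (diamond n)"
      by (rule interior_maximal[OF _ op]) (auto simp: d)
    show "interior (diamond n) \<subseteq> {p. ?g p < of_nat n}"
    proof
      fix p assume p: "p \<in> interior (diamond n)"
      then have le: "?g p \<le> of_nat n" using interior_subset d by blast
      have "?g p \<noteq> of_nat n"
      proof
        assume eq: "?g p = of_nat n"
        obtain e where e: "e > 0" "ball p e \<subseteq> diamond n" using p by (meson mem_interior)
        \<comment> \<open>Moving \<open>p\<close> slightly away from the centre leaves the diamond,
          because \<open>?g\<close> scales with the factor \<open>1 + t\<close>.\<close>
        define v where "v = p - (of_nat n, 0)"
        have v: "v \<noteq> 0" using eq assms by (auto simp: v_def prod_eq_iff)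
        define t where "t = e / (2 * norm v)"
        have t: "t > 0" "t * norm v < e" using e v by (auto simp: t_def)
        have "dist p (p + t *\<^sub>R v) < e" using t by (simp add: dist_norm)
        then have "p + t *\<^sub>R v \<in> diamond n" using e(2) by auto
        moreover have "fst (p + t *\<^sub>R v) - of_nat n = (1 + t) * (fst p - of_nat n)" "snd (p + t *\<^sub>R v) = (1 + t) * snd p"
          by (auto simp: v_def algebra_simps)
        ultimately have "(1 + t) * (?g p) \<le> of_nat n"
          using t by (simp add: d abs_mult distrib_left)
        then have "t * of_nat n \<le> 0" unfolding eq by (simp add: algebra_simps)
        then show False using t assms by (simp add: mult_le_0_iff)
      qed
      then show "p \<in> {p. ?g p < of_nat n}" using le by simp
    qed
  qed
  then have "frontier (diamond n) = diamond n - {p. ?g p < of_nat n}"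
    by (simp add: frontier_def cl)
  also have "\<dots> = {(x, y). \<bar>x - of_nat n\<bar> + \<bar>y\<bar> = of_nat n}" by (auto simp: diamond_def)
  finally show ?thesis .
qed

text \<open>Two nodes of odd coordinate sum have even l1 distance. Hence a cell that lies in the
  unit diamond of such a node belongs to that node.\<close>

lemma odd_l1_close:
  fixes a b c d :: int
  assumes "odd (a + b)" "odd (c + d)" "\<bar>a - c\<bar> + \<bar>b - d\<bar> < 2"
  shows "a = c \<and> b = d"
proof -
  define s where "s = (a - c) + (b - d)"
  have "even s" using assms(1,2) by (simp add: s_def)
  moreover have "a = c \<and> b = d \<or> s = 1 \<or> s = -1"
    using assms(3) unfolding s_def by linarith
  ultimately show ?thesis by auto
qed

lemma cell_in_unit_diamond:
  assumes "closed_cell (f, b, d) \<subseteq> unit_diamond z" "odd (fst z + snd z)"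
  shows "cell_node f b = z"
proof -
  obtain p where p': "p \<in> open_cell (f, b, d)" using open_cell_nonempty by blast
  moreover obtain x y where p: "p = (x, y)" by fastforce
  ultimately have "\<bar>x - of_int (fst (cell_node f b))\<bar> + \<bar>y - of_int (snd (cell_node f b))\<bar> < 1"
    using open_cell_dist by blast
  moreover have "p \<in> unit_diamond z" using p' assms(1) open_cell_subset by blast
  ultimately have "\<bar>real_of_int (fst (cell_node f b)) - of_int (fst z)\<bar> + \<bar>real_of_int (snd (cell_node f b)) - of_int (snd z)\<bar> < 2"
    unfolding unit_diamond_def p by (simp split: prod.splits)
  then have "\<bar>fst (cell_node f b) - fst z\<bar> + \<bar>snd (cell_node f b) - snd z\<bar> < 2" by linarith
  then show ?thesis using odd_l1_close[OF odd_cell_node assms(2)] by (simp add: prod_eq_iff)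
qed

lemma outer_cells_eq:
  assumes n: "n > 0"
  shows "outer_cells n = (\<lambda>f. closed_cell (f, True, True)) ` pendant n"
proof (intro equalityI subsetI)
  fix C assume C: "C \<in> outer_cells n"
  then obtain f b d where c: "C = closed_cell (f, b, d)"
    unfolding outer_cells_def L_regions_eq by (auto simp del: closed_cell.simps)
  obtain a b' where ab: "even a" "odd b'" "closed_cell (f, b, d) \<subseteq> unit_diamond (a, b')"
    using C unfolding c outer_cells_def by blast
  have "cell_node f b = (a, b')" using cell_in_unit_diamond[OF ab(3)] ab by simp
  then have b: b using ab(1) by (auto simp: cell_node_def odd_of_def split: if_splits)
  have "interior (closed_cell (f, b, d)) \<inter> diamond n = {}"
    using C unfolding c outer_cells_def by blast
  then have "open_cell (f, b, d) \<inter> diamond n = {}" unfolding interior_closed_cell .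
  then have "\<not> l1 n (cell_node f b) < int n"
    using closed_cell_subset_diamond open_cell_subset open_cell_nonempty by blast
  then have ge: "l1 n (cell_node f b) \<ge> int n + 1" using odd_l1[of n f b] by presburger
  define E where "E = l1 n (even_of (fst f), even_of (snd f))"
  define u where "u = slope n (fst f)"
  define v where "v = slope 0 (snd f)"
  have uv: "u = 1 \<or> u = -1" "v = 1 \<or> v = -1" using slope_cases by (auto simp: u_def v_def)
  have A: "l1 n (cell_node f True) = E + v" and B: "l1 n (cell_node f False) = E + u"
    by (simp_all add: l1_cell_node E_def u_def v_def)
  \<comment> \<open>With \<open>lx\<close>, \<open>ly\<close> for the two \<open>loc\<close> values,
    the frontier equation is \<open>u * lx + v * ly = n - E\<close>, where
    \<open>lx \<le> ly\<close> and \<open>n - E \<le> v - 1\<close>. Every choice of signs forces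
    equality and \<open>lx = ly\<close>, so the frontier meets the cell on the diagonal
    only.\<close>
  have key: "loc (fst f) x = loc (snd f) y \<and> E + v = int n + 1 \<and> of_int (u + v) * loc (fst f) x = of_int v - 1"
    if p: "(x, y) \<in> closed_cell (f, b, d)" "(x, y) \<in> frontier (diamond n)" for x y
  proof -
    note l = closed_cell_bounds[OF p(1)]
    have "real n = of_int E + of_int u * loc (fst f) x + of_int v * loc (snd f) y"
      using p(2) l1_square[OF l(1-4), of n] by (simp add: frontier_diamond[OF n] E_def u_def v_def)
    moreover have "loc (fst f) x \<le> loc (snd f) y" using l(5) b by simp
    moreover have "real_of_int (E + v) \<ge> real n + 1" using ge A b by (simp add: of_nat_less_iff)
    ultimately have *: "loc (fst f) x = loc (snd f) y \<and> real_of_int (E + v) = real n + 1 \<and> of_int (u + v) * loc (fst f) x = of_int v - 1"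
      using uv l(1-4) by auto
    moreover have "E + v = int n + 1" using * by linarith
    ultimately show ?thesis by blast
  qed
  obtain e where e: "e \<in> L_edges" "e \<subseteq> closed_cell (f, b, d)" "e \<subseteq> frontier (diamond n)"
    using C unfolding c outer_cells_def by blast
  then obtain p q where pq: "p \<noteq> q" "e = closed_segment p q" unfolding subdiv_edges_def by blast
  then have mem: "p \<in> e" "q \<in> e" by auto
  obtain x y where p: "p = (x, y)" by fastforce
  obtain x' y' where q: "q = (x', y')" by fastforce
  have kp: "loc (fst f) x = loc (snd f) y" "E + v = int n + 1" "of_int (u + v) * loc (fst f) x = of_int v - 1"
    and kq: "loc (fst f) x' = loc (snd f) y'" "of_int (u + v) * loc (fst f) x' = of_int v - 1"
    using key[of x y] key[of x' y'] mem e p q by auto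
  \<comment> \<open>An edge provides two different points on the diagonal. Equal slopes would allow
    a single one, so \<open>u + v = 0\<close>.\<close>
  have ne: "loc (fst f) x \<noteq> loc (fst f) x'"
    using kp kq pq(1) p q by (metis unloc_loc)
  have "(of_int (u + v) :: real) * (loc (fst f) x - loc (fst f) x') = 0" using kp kq by (simp add: algebra_simps)
  then have "(of_int (u + v) :: real) = 0" using ne by simp
  then have uv0: "u + v = 0" by linarith
  then have "(of_int v::real) - 1 = 0" using kp(3) by simp
  then have "v = 1" by linarith
  then have "l1 n (cell_node f True) = int n + 1" "l1 n (cell_node f False) = int n - 1"
    using kp(2) uv0 A B by auto
  \<comment> \<open>The triangle at the node meets the diagonal in \<open>(0, 0)\<close>
    only.\<close>
  moreover have d
  proof -
    obtain s t where st: "cell_coord f b p = (s, t)" by fastforce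
    obtain s' t' where st': "cell_coord f b q = (s', t')" by fastforce
    have "s = t" "s' = t'" using st st' kp(1) kq(1) by (auto simp: p q cell_coord_def coord_def split: if_splits)
    moreover have "s \<noteq> s' \<or> t \<noteq> t'" using st st' inj_cell_coord[of f b p q] pq(1) by auto
    moreover have "(s, t) \<in> closed_tri d" "(s', t') \<in> closed_tri d" using mem e(2) st st' by auto
    ultimately show d by (auto simp: closed_tri_def split: if_splits)
  qed
  ultimately show "C \<in> (\<lambda>f. closed_cell (f, True, True)) ` pendant n"
    unfolding c using b by (auto simp: pendant_def simp del: closed_cell.simps)
next
  fix C assume "C \<in> (\<lambda>f. closed_cell (f, True, True)) ` pendant n"
  then obtain f where f: "C = closed_cell (f, True, True)" "l1 n (cell_node f True) = int n + 1" "l1 n (cell_node f False) = int n - 1"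
    by (auto simp: pendant_def simp del: closed_cell.simps)
  define E where "E = l1 n (even_of (fst f), even_of (snd f))"
  have *: "slope 0 (snd f) = 1" "slope n (fst f) = -1" "E = int n"
    using f(2,3) slope_cases[of 0 "snd f"] slope_cases[of n "fst f"] by (auto simp: l1_cell_node E_def)
  have val: "\<bar>x - of_nat n\<bar> + \<bar>y\<bar> = of_nat n - loc (fst f) x + loc (snd f) y"
    if "0 \<le> loc (fst f) x" "loc (fst f) x \<le> 1" "0 \<le> loc (snd f) y" "loc (snd f) y \<le> 1" for x y
    using l1_square[OF that, of n] * by (simp add: E_def)
  have "open_cell (f, True, True) \<inter> diamond n = {}"
  proof -
    have "(x, y) \<notin> diamond n" if p: "(x, y) \<in> open_cell (f, True, True)" for x y
      using open_cell_bounds[OF p] val[of x y] by (auto simp: diamond_def)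
    then show ?thesis by auto
  qed
  moreover have "\<exists>e \<in> L_edges. e \<subseteq> C \<and> e \<subseteq> frontier (diamond n)"
  proof -
    obtain p where p: "cell_coord f True p = (0, 0)" by (rule coord_surj')
    obtain q where q: "cell_coord f True q = (1, 1)" by (rule coord_surj')
    have "closed_segment p q \<in> L_edges" by (rule side_edge[of f True]) (simp add: p q sides_def)
    moreover have sub: "closed_segment p q \<subseteq> C" unfolding f
      by (rule closed_segment_subset[OF _ _ convex_closed_cell]) (simp_all add: p q closed_tri_def)
    moreover have "r \<in> frontier (diamond n)" if r: "r \<in> closed_segment p q" for r
    proof -
      obtain x y where xy: "r = (x, y)" by fastforce
      obtain u where "r = (1 - u) *\<^sub>R p + u *\<^sub>R q" using r by (auto simp: in_segment)
      then have "cell_coord f True r = (u, u)" by (simp only: cell_coord_affine p q) simp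
      then have "loc (fst f) x = loc (snd f) y" by (auto simp: xy cell_coord_def coord_def split: if_splits)
      moreover have "(x, y) \<in> closed_cell (f, True, True)" using sub r xy f by blast
      note val[OF closed_cell_bounds(1-4)[OF this]]
      ultimately show ?thesis by (simp add: xy frontier_diamond[OF n])
    qed
    ultimately show ?thesis by blast
  qed
  moreover have "C \<subseteq> unit_diamond (cell_node f True)" unfolding f unit_diamond_def
  proof clarify
    fix x y assume "(x, y) \<in> closed_cell (f, True, True)"
    from closed_cell_dist[OF this]
    show "\<bar>x - of_int (fst (cell_node f True))\<bar> + \<bar>y - of_int (snd (cell_node f True))\<bar> \<le> 1" .
  qed
  then have "\<exists>a b. even a \<and> odd b \<and> C \<subseteq> unit_diamond (a, b)"
    by (intro exI[of _ "even_of (fst f)"] exI[of _ "odd_of (snd f)"]) (auto simp: node_defs)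
  moreover have "C \<in> L_regions" unfolding L_regions_eq f by (rule rangeI)
  ultimately show "C \<in> outer_cells n"
    unfolding outer_cells_def mem_Collect_eq by (intro conjI) (simp_all only: f interior_closed_cell)
qed

lemma Q_eq:
  assumes "n > 0"
  shows "Q n = cells_union (region n)"
proof -
  have "{C \<in> L_regions. C \<subseteq> diamond n} = closed_cell ` {(f, b, d). l1 n (cell_node f b) < int n}"
  proof -
    have "{c. closed_cell c \<subseteq> diamond n} = {(f, b, d). l1 n (cell_node f b) < int n}"
      using closed_cell_subset_diamond by (simp add: set_eq_iff split_paired_all del: closed_cell.simps)
    then show ?thesis unfolding L_regions_eq by blast
  qed
  then show ?thesis using assms unfolding Q_def outer_cells_eq[OF assms] cells_union_def region_def by (simp add: image_Un image_image)
qed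

section \<open>Matching sums\<close>

text \<open>Edges are abstract names with an incidence map: one notion covers pairs of cells, with
  the identity as \<open>inc\<close>, and dominoes named by the lattice edge they cross.\<close>

definition msum :: "('e \<Rightarrow> 'v set) \<Rightarrow> 'v set \<Rightarrow> 'e set \<Rightarrow> ('e \<Rightarrow> real) \<Rightarrow> real" where
  "msum inc V E w = (\<Sum>M\<in>matchings inc V E. \<Prod>e\<in>M. w e)"

lemma matchings_restrict: "matchings inc V E = matchings inc V {e \<in> E. inc e \<subseteq> V}"
  unfolding matchings_def by blast

lemma msum_restrict: "msum inc V E w = msum inc V {e \<in> E. inc e \<subseteq> V} w"
  unfolding msum_def by (subst matchings_restrict) simp

lemma msum_edges_cong:
  assumes "\<And>e. inc e \<subseteq> V \<Longrightarrow> e \<in> E \<longleftrightarrow> e \<in> E'"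
  shows "msum inc V E w = msum inc V E' w"
proof -
  have "{e \<in> E. inc e \<subseteq> V} = {e \<in> E'. inc e \<subseteq> V}" using assms by blast
  then show ?thesis using msum_restrict[of inc V E w] msum_restrict[of inc V E' w] by simp
qed

lemma finite_matchings: "finite E \<Longrightarrow> finite (matchings inc V E)"
  by (rule finite_subset[of _ "Pow E"]) (auto simp: matchings_def)

lemma msum_empty: "(\<And>e. e \<in> E \<Longrightarrow> inc e \<noteq> {}) \<Longrightarrow> msum inc {} E w = 1"
proof -
  assume "\<And>e. e \<in> E \<Longrightarrow> inc e \<noteq> {}"
  then have "matchings inc {} E = {{}}" by (auto simp: matchings_def disjoint_family_on_def)
  then show ?thesis by (simp add: msum_def)
qed

lemma msum_uncovered:
  assumes "v \<in> V" "\<And>e. e \<in> E \<Longrightarrow> inc e \<subseteq> V \<Longrightarrow> v \<notin> inc e"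
  shows "msum inc V E w = 0"
proof -
  have "matchings inc V E = {}" using assms unfolding matchings_def by blast
  then show ?thesis by (simp add: msum_def)
qed

lemma disjoint_family_on_Un:
  assumes "disjoint_family_on A M" "disjoint_family_on A N" "(\<Union>e\<in>M. A e) \<inter> (\<Union>e\<in>N. A e) = {}"
  shows "disjoint_family_on A (M \<union> N)"
  unfolding disjoint_family_on_def
proof (intro ballI impI)
  fix e e' assume e: "e \<in> M \<union> N" "e' \<in> M \<union> N" "e \<noteq> e'"
  have x: "A a \<inter> A b = {}" if "a \<in> M" "b \<in> N" for a b using that assms(3) by blast
  show "A e \<inter> A e' = {}"
    using e x[of e e'] x[of e' e] disjoint_family_onD[OF assms(1), of e e'] disjoint_family_onD[OF assms(2), of e e'] by auto
qed

text \<open>Matchings of a disjoint union are pairs of matchings. Nonempty incidence sets keep the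
  two edge sets disjoint, so that weights multiply.\<close>

lemma msum_Un:
  assumes fin: "finite E1" "finite E2" and V: "V1 \<inter> V2 = {}"
    and inc: "\<And>e. e \<in> E1 \<Longrightarrow> inc e \<subseteq> V1 \<and> inc e \<noteq> {}" "\<And>e. e \<in> E2 \<Longrightarrow> inc e \<subseteq> V2 \<and> inc e \<noteq> {}"
  shows "msum inc (V1 \<union> V2) (E1 \<union> E2) w = msum inc V1 E1 w * msum inc V2 E2 w"
proof -
  have dis: "E1 \<inter> E2 = {}" using V inc by blast
  let ?A = "matchings inc V1 E1" and ?B = "matchings inc V2 E2"
  have inj: "inj_on (\<lambda>(M, N). M \<union> N) (?A \<times> ?B)"
  proof (rule inj_onI, clarify)
    fix M N M' N' assume *: "M \<in> ?A" "N \<in> ?B" "M' \<in> ?A" "N' \<in> ?B" "M \<union> N = M' \<union> N'"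
    then have s: "M \<subseteq> E1" "N \<subseteq> E2" "M' \<subseteq> E1" "N' \<subseteq> E2" by (auto simp: matchings_def)
    then have "M = (M \<union> N) \<inter> E1" "N = (M \<union> N) \<inter> E2" "M' = (M' \<union> N') \<inter> E1" "N' = (M' \<union> N') \<inter> E2" using dis by blast+
    then show "M = M' \<and> N = N'" using *(5) by auto
  qed
  have "matchings inc (V1 \<union> V2) (E1 \<union> E2) = (\<lambda>(M, N). M \<union> N) ` (?A \<times> ?B)"
  proof (intro equalityI subsetI)
    fix M assume M: "M \<in> matchings inc (V1 \<union> V2) (E1 \<union> E2)"
    then have m: "M \<subseteq> E1 \<union> E2" "(\<Union>e\<in>M. inc e) = V1 \<union> V2" "disjoint_family_on inc M" by (auto simp: matchings_def)
    have d: "disjoint_family_on inc (M \<inter> E1)" "disjoint_family_on inc (M \<inter> E2)"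
      using m(3) by (auto simp: disjoint_family_on_def)
    have "(M \<inter> E1) \<union> (M \<inter> E2) = M" using m(1) by blast
    then have "(\<Union>e\<in>M \<inter> E1. inc e) \<union> (\<Union>e\<in>M \<inter> E2. inc e) = V1 \<union> V2"
      using m(2) UN_Un[of inc "M \<inter> E1" "M \<inter> E2"] by simp
    moreover have "(\<Union>e\<in>M \<inter> E1. inc e) \<subseteq> V1" "(\<Union>e\<in>M \<inter> E2. inc e) \<subseteq> V2" using inc by blast+
    ultimately have "(\<Union>e\<in>M \<inter> E1. inc e) = V1" "(\<Union>e\<in>M \<inter> E2. inc e) = V2" using V by blast+
    then have "M \<inter> E1 \<in> ?A" "M \<inter> E2 \<in> ?B" using d by (simp_all add: matchings_def)
    moreover have "M = (M \<inter> E1) \<union> (M \<inter> E2)" using m(1) by blast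
    ultimately show "M \<in> (\<lambda>(M, N). M \<union> N) ` (?A \<times> ?B)" by (intro image_eqI[of _ _ "(M \<inter> E1, M \<inter> E2)"]) auto
  next
    fix M assume "M \<in> (\<lambda>(M, N). M \<union> N) ` (?A \<times> ?B)"
    then obtain M1 M2 where M: "M = M1 \<union> M2" "M1 \<in> ?A" "M2 \<in> ?B" by auto
    have u: "(\<Union>e\<in>M1. inc e) = V1" "(\<Union>e\<in>M2. inc e) = V2" "disjoint_family_on inc M1" "disjoint_family_on inc M2"
      using M(2,3) by (simp_all add: matchings_def)
    then have "disjoint_family_on inc (M1 \<union> M2)" using V by (intro disjoint_family_on_Un) auto
    then show "M \<in> matchings inc (V1 \<union> V2) (E1 \<union> E2)" using M by (auto simp: matchings_def)
  qed
  then have "msum inc (V1 \<union> V2) (E1 \<union> E2) w = (\<Sum>(M, N)\<in>?A \<times> ?B. \<Prod>e\<in>M \<union> N. w e)"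
    unfolding msum_def by (simp add: sum.reindex[OF inj[unfolded case_prod_unfold]] case_prod_unfold)
  also have "\<dots> = (\<Sum>(M, N)\<in>?A \<times> ?B. (\<Prod>e\<in>M. w e) * (\<Prod>e\<in>N. w e))"
  proof (intro sum.cong refl, clarify)
    fix M N assume "M \<in> ?A" "N \<in> ?B"
    then have "M \<subseteq> E1" "N \<subseteq> E2" by (auto simp: matchings_def)
    then show "(\<Prod>e\<in>M \<union> N. w e) = (\<Prod>e\<in>M. w e) * (\<Prod>e\<in>N. w e)"
      using dis fin by (intro prod.union_disjoint) (auto dest: finite_subset)
  qed
  also have "\<dots> = msum inc V1 E1 w * msum inc V2 E2 w"
    unfolding msum_def by (simp add: sum_product sum.cartesian_product)
  finally show ?thesis .
qed

lemma msum_UN: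
  assumes "finite I" "\<And>i. i \<in> I \<Longrightarrow> finite (E i)" "disjoint_family_on V I"
    and "\<And>i e. i \<in> I \<Longrightarrow> e \<in> E i \<Longrightarrow> inc e \<subseteq> V i \<and> inc e \<noteq> {}"
  shows "msum inc (\<Union>i\<in>I. V i) (\<Union>i\<in>I. E i) w = (\<Prod>i\<in>I. msum inc (V i) (E i) w)"
  using assms
proof (induction I rule: finite_induct)
  case empty
  then show ?case using msum_empty[of "{}" inc w] by simp
next
  case (insert i I)
  have "V i \<inter> V j = {}" if "j \<in> I" for j
    using disjoint_family_onD[OF insert.prems(2), of i j] insert.hyps(2) that by auto
  then have dis: "V i \<inter> (\<Union>i\<in>I. V i) = {}" by blast
  have "msum inc (V i \<union> (\<Union>i\<in>I. V i)) (E i \<union> (\<Union>i\<in>I. E i)) w = msum inc (V i) (E i) w * msum inc (\<Union>i\<in>I. V i) (\<Union>i\<in>I. E i) w"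
  proof (rule msum_Un)
    fix e assume "e \<in> (\<Union>i\<in>I. E i)"
    then obtain j where "j \<in> I" "e \<in> E j" by blast
    then show "inc e \<subseteq> (\<Union>i\<in>I. V i) \<and> inc e \<noteq> {}" using insert.prems(3)[of j e] by auto
  qed (use insert.prems insert.hyps dis in auto)
  moreover have "disjoint_family_on V I" using insert.prems(2) by (auto simp: disjoint_family_on_def)
  then have "msum inc (\<Union>i\<in>I. V i) (\<Union>i\<in>I. E i) w = (\<Prod>i\<in>I. msum inc (V i) (E i) w)"
    using insert.prems by (intro insert.IH) auto
  ultimately show ?case using insert.hyps by simp
qed

text \<open>A matching assigns to every vertex the class of the edge covering it; for a fixed assignment
  the classes can be matched independently.\<close>

lemma msum_group:
  assumes F: "finite F" and C: "finite C" and E: "\<And>c. c \<in> C \<Longrightarrow> finite (E c)"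
    and disj: "disjoint_family_on E C"
    and ne: "\<And>c e. c \<in> C \<Longrightarrow> e \<in> E c \<Longrightarrow> inc e \<noteq> {}"
  shows "msum inc F (\<Union>c\<in>C. E c) w = (\<Sum>p\<in>F \<rightarrow>\<^sub>E C. \<Prod>c\<in>C. msum inc {f \<in> F. p f = c} (E c) w)"
proof -
  let ?E = "\<Union>c\<in>C. E c"
  define cls where "cls e = (THE c. c \<in> C \<and> e \<in> E c)" for e
  have cls: "cls e = c" if "c \<in> C" "e \<in> E c" for e c
    unfolding cls_def using that disj by (intro the_equality) (auto simp: disjoint_family_on_def)
  \<comment> \<open>The class of the edge covering \<open>f\<close>; in a matching this edge is
    unique.\<close>
  define g where "g M = (\<lambda>f\<in>F. cls (THE e. e \<in> M \<and> f \<in> inc e))" for M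
  have g: "g M f = cls e" if "M \<in> matchings inc F ?E" "e \<in> M" "f \<in> inc e" for M e f
  proof -
    have "(THE e. e \<in> M \<and> f \<in> inc e) = e"
      using that by (intro the_equality) (auto simp: matchings_def disjoint_family_on_def)
    moreover have "f \<in> F" using that by (auto simp: matchings_def)
    ultimately show ?thesis by (simp add: g_def)
  qed
  have gin: "g M \<in> F \<rightarrow>\<^sub>E C" if M: "M \<in> matchings inc F ?E" for M
  proof (rule PiE_I)
    fix f assume "f \<in> F"
    then obtain e where e: "e \<in> M" "f \<in> inc e" using M by (auto simp: matchings_def)
    then obtain c where "c \<in> C" "e \<in> E c" using M by (auto simp: matchings_def)
    then show "g M f \<in> C" using g[OF M e] cls by simp
  qed (auto simp: g_def)
  \<comment> \<open>The matchings with assignment \<open>p\<close> are those built from edges all of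
    whose ends are assigned to the class of the edge.\<close>
  have fib: "{M \<in> matchings inc F ?E. g M = p} = matchings inc F (\<Union>c\<in>C. {e \<in> E c. inc e \<subseteq> {f \<in> F. p f = c}})"
    if p: "p \<in> F \<rightarrow>\<^sub>E C" for p
  proof (intro equalityI subsetI)
    fix M assume "M \<in> {M \<in> matchings inc F ?E. g M = p}"
    then have M: "M \<in> matchings inc F ?E" "g M = p" by auto
    have "e \<in> (\<Union>c\<in>C. {e \<in> E c. inc e \<subseteq> {f \<in> F. p f = c}})" if e: "e \<in> M" for e
    proof -
      obtain c where c: "c \<in> C" "e \<in> E c" using M e by (auto simp: matchings_def)
      have "inc e \<subseteq> F" using M e by (auto simp: matchings_def)
      moreover have "p f = c" if "f \<in> inc e" for f using g[OF M(1) e that] M(2) cls[OF c] by simp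
      ultimately show ?thesis using c by blast
    qed
    then show "M \<in> matchings inc F (\<Union>c\<in>C. {e \<in> E c. inc e \<subseteq> {f \<in> F. p f = c}})"
      using M(1) unfolding matchings_def by blast
  next
    fix M assume M: "M \<in> matchings inc F (\<Union>c\<in>C. {e \<in> E c. inc e \<subseteq> {f \<in> F. p f = c}})"
    then have M': "M \<in> matchings inc F ?E" unfolding matchings_def by blast
    have "g M f = p f" for f
    proof (cases "f \<in> F")
      case True
      then obtain e where e: "e \<in> M" "f \<in> inc e" using M by (auto simp: matchings_def)
      then obtain c where "c \<in> C" "e \<in> E c" "inc e \<subseteq> {f \<in> F. p f = c}" using M unfolding matchings_def by blast
      then show ?thesis using g[OF M' e] cls e(2) by auto
    next
      case False
      then show ?thesis using PiE_arb[OF p False] by (simp add: g_def)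
    qed
    then show "M \<in> {M \<in> matchings inc F ?E. g M = p}" using M' by auto
  qed
  have "msum inc F ?E w = (\<Sum>p\<in>F \<rightarrow>\<^sub>E C. \<Sum>M\<in>{M \<in> matchings inc F ?E. g M = p}. \<Prod>e\<in>M. w e)"
    unfolding msum_def
    by (rule sum.group[symmetric]) (use gin F C E in \<open>auto intro!: finite_matchings finite_PiE\<close>)
  also have "\<dots> = (\<Sum>p\<in>F \<rightarrow>\<^sub>E C. msum inc F (\<Union>c\<in>C. {e \<in> E c. inc e \<subseteq> {f \<in> F. p f = c}}) w)"
    unfolding msum_def by (intro sum.cong refl) (simp add: fib)
  also have "\<dots> = (\<Sum>p\<in>F \<rightarrow>\<^sub>E C. \<Prod>c\<in>C. msum inc {f \<in> F. p f = c} (E c) w)"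
  proof (intro sum.cong refl)
    fix p assume p: "p \<in> F \<rightarrow>\<^sub>E C"
    then have "F = (\<Union>c\<in>C. {f \<in> F. p f = c})" by auto
    then have "msum inc F (\<Union>c\<in>C. {e \<in> E c. inc e \<subseteq> {f \<in> F. p f = c}}) w =
        msum inc (\<Union>c\<in>C. {f \<in> F. p f = c}) (\<Union>c\<in>C. {e \<in> E c. inc e \<subseteq> {f \<in> F. p f = c}}) w" by simp
    also have "\<dots> = (\<Prod>c\<in>C. msum inc {f \<in> F. p f = c} {e \<in> E c. inc e \<subseteq> {f \<in> F. p f = c}} w)"
      by (rule msum_UN) (use C E ne in \<open>auto simp: disjoint_family_on_def\<close>)
    also have "\<dots> = (\<Prod>c\<in>C. msum inc {f \<in> F. p f = c} (E c) w)"
      by (intro prod.cong refl msum_restrict[symmetric])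
    finally show "msum inc F (\<Union>c\<in>C. {e \<in> E c. inc e \<subseteq> {f \<in> F. p f = c}}) w = (\<Prod>c\<in>C. msum inc {f \<in> F. p f = c} (E c) w)" .
  qed
  finally show ?thesis .
qed

text \<open>Matchings are sorted by the set of edges they take from \<open>E2\<close>. Below,
  \<open>E2\<close> consists of the edges at one vertex or of the tiles joining different
  diamonds.\<close>

lemma msum_split:
  assumes fin: "finite E1" "finite E2" and dis: "E1 \<inter> E2 = {}"
    and ne: "\<And>e. e \<in> E1 \<Longrightarrow> inc e \<noteq> {}"
  shows "msum inc V (E1 \<union> E2) w =
    (\<Sum>X\<in>{X. X \<subseteq> E2 \<and> (\<Union>e\<in>X. inc e) \<subseteq> V \<and> disjoint_family_on inc X}. (\<Prod>e\<in>X. w e) * msum inc (V - (\<Union>e\<in>X. inc e)) E1 w)"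
proof -
  let ?S = "{X. X \<subseteq> E2 \<and> (\<Union>e\<in>X. inc e) \<subseteq> V \<and> disjoint_family_on inc X}"
  have finS: "finite ?S" by (rule finite_subset[of _ "Pow E2"]) (use fin in auto)
  have "msum inc V (E1 \<union> E2) w = (\<Sum>X\<in>?S. \<Sum>M\<in>{M \<in> matchings inc V (E1 \<union> E2). M \<inter> E2 = X}. \<Prod>e\<in>M. w e)"
    unfolding msum_def
  proof (rule sum.group[symmetric])
    show "(\<lambda>M. M \<inter> E2) ` matchings inc V (E1 \<union> E2) \<subseteq> ?S"
      unfolding matchings_def disjoint_family_on_def by blast
  qed (use finS finite_matchings[OF finite_UnI[OF fin]] in auto)
  also have "\<dots> = (\<Sum>X\<in>?S. (\<Prod>e\<in>X. w e) * msum inc (V - (\<Union>e\<in>X. inc e)) E1 w)"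
  proof (intro sum.cong refl)
    fix X assume "X \<in> ?S"
    then have X: "X \<subseteq> E2" "(\<Union>e\<in>X. inc e) \<subseteq> V" "disjoint_family_on inc X" by auto
    let ?N = "matchings inc (V - (\<Union>e\<in>X. inc e)) E1"
    have eq: "{M \<in> matchings inc V (E1 \<union> E2). M \<inter> E2 = X} = (\<lambda>N. N \<union> X) ` ?N"
    proof (intro equalityI subsetI)
      fix M assume "M \<in> {M \<in> matchings inc V (E1 \<union> E2). M \<inter> E2 = X}"
      then have M: "M \<subseteq> E1 \<union> E2" "(\<Union>e\<in>M. inc e) = V" "disjoint_family_on inc M" "M \<inter> E2 = X"
        by (auto simp: matchings_def)
      have "inc e \<inter> inc e' = {}" if "e \<in> M \<inter> E1" "e' \<in> X" for e e'
        using that M(4) dis by (intro disjoint_family_onD[OF M(3)]) auto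
      then have "(\<Union>e\<in>M \<inter> E1. inc e) \<inter> (\<Union>e\<in>X. inc e) = {}" by blast
      moreover have "(\<Union>e\<in>M \<inter> E1. inc e) \<union> (\<Union>e\<in>X. inc e) = V" using M(1,2,4) by blast
      ultimately have "(\<Union>e\<in>M \<inter> E1. inc e) = V - (\<Union>e\<in>X. inc e)" by blast
      moreover have "disjoint_family_on inc (M \<inter> E1)" using M(3) by (auto simp: disjoint_family_on_def)
      ultimately have "M \<inter> E1 \<in> ?N" by (simp add: matchings_def)
      moreover have "M = (M \<inter> E1) \<union> X" using M(1,4) by blast
      ultimately show "M \<in> (\<lambda>N. N \<union> X) ` ?N" by (rule rev_image_eqI)
    next
      fix M assume "M \<in> (\<lambda>N. N \<union> X) ` ?N"
      then obtain N where N: "M = N \<union> X" "N \<subseteq> E1" "(\<Union>e\<in>N. inc e) = V - (\<Union>e\<in>X. inc e)" "disjoint_family_on inc N"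
        by (auto simp: matchings_def)
      have "disjoint_family_on inc M" unfolding N(1) by (rule disjoint_family_on_Un[OF N(4) X(3)]) (use N(3) in blast)
      moreover have "(\<Union>e\<in>M. inc e) = V" unfolding N(1) UN_Un N(3) using X(2) by blast
      moreover have "M \<inter> E2 = X" using N(1,2) X(1) dis by blast
      ultimately show "M \<in> {M \<in> matchings inc V (E1 \<union> E2). M \<inter> E2 = X}"
        using N(1,2) X(1) by (auto simp: matchings_def)
    qed
    have NX: "N \<inter> X = {}" "finite N" if "N \<in> ?N" for N
      using that dis X(1) fin by (auto simp: matchings_def intro: finite_subset)
    have inj: "inj_on (\<lambda>N. N \<union> X) ?N"
    proof (rule inj_onI)
      fix N N' assume "N \<in> ?N" "N' \<in> ?N" "N \<union> X = N' \<union> X"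
      then show "N = N'" using NX(1)[of N] NX(1)[of N'] by blast
    qed
    have "(\<Sum>M\<in>{M \<in> matchings inc V (E1 \<union> E2). M \<inter> E2 = X}. \<Prod>e\<in>M. w e) = (\<Sum>N\<in>?N. \<Prod>e\<in>N \<union> X. w e)"
      unfolding eq by (simp add: sum.reindex[OF inj])
    also have "\<dots> = (\<Sum>N\<in>?N. (\<Prod>e\<in>N. w e) * (\<Prod>e\<in>X. w e))"
      using NX X(1) fin by (intro sum.cong refl prod.union_disjoint) (auto dest: finite_subset)
    finally show "(\<Sum>M\<in>{M \<in> matchings inc V (E1 \<union> E2). M \<inter> E2 = X}. \<Prod>e\<in>M. w e) = (\<Prod>e\<in>X. w e) * msum inc (V - (\<Union>e\<in>X. inc e)) E1 w"
      unfolding msum_def by (simp add: sum_distrib_left mult.commute)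
  qed
  finally show ?thesis .
qed

lemma msum_image:
  assumes h: "inj_on h V" and k: "inj_on k E" and inc: "\<And>e. e \<in> E \<Longrightarrow> inc e \<subseteq> V" "\<And>e. e \<in> E \<Longrightarrow> inc' (k e) = h ` inc e"
    and w: "\<And>e. e \<in> E \<Longrightarrow> w' (k e) = w e"
  shows "msum inc' (h ` V) (k ` E) w' = msum inc V E w"
proof -
  have cov: "(\<Union>e\<in>k ` M. inc' e) = h ` (\<Union>e\<in>M. inc e)" if "M \<subseteq> E" for M
  proof -
    have "(\<Union>e\<in>k ` M. inc' e) = (\<Union>e\<in>M. inc' (k e))" by simp
    also have "\<dots> = (\<Union>e\<in>M. h ` inc e)" using inc(2) that by (intro SUP_cong refl) auto
    finally show ?thesis by (simp add: image_UN)
  qed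
  have "matchings inc' (h ` V) (k ` E) = (\<lambda>M. k ` M) ` matchings inc V E"
  proof (intro equalityI subsetI)
    fix N assume N: "N \<in> matchings inc' (h ` V) (k ` E)"
    then obtain M where M: "M \<subseteq> E" "N = k ` M" by (auto simp: matchings_def subset_image_iff)
    have "h ` (\<Union>e\<in>M. inc e) = (\<Union>e\<in>N. inc' e)" using cov[OF M(1)] M(2) by simp
    also have "\<dots> = h ` V" using N by (simp add: matchings_def)
    finally have "(\<Union>e\<in>M. inc e) = V" using h inc(1) M(1) by (subst (asm) inj_on_image_eq_iff[of h V]) blast+
    moreover have "disjoint_family_on inc M" unfolding disjoint_family_on_def
    proof (intro ballI impI)
      fix e e' assume e: "e \<in> M" "e' \<in> M" "e \<noteq> e'"
      then have "k e \<noteq> k e'" using k M(1) by (auto simp: inj_on_def)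
      moreover have "disjoint_family_on inc' N" using N by (simp add: matchings_def)
      ultimately have "inc' (k e) \<inter> inc' (k e') = {}" using e unfolding M(2) by (intro disjoint_family_onD[of inc' "k ` M"]) auto
      then have "h ` (inc e) \<inter> h ` (inc e') = {}" using inc(2) e M(1) by auto
      then show "inc e \<inter> inc e' = {}" by blast
    qed
    ultimately show "N \<in> (\<lambda>M. k ` M) ` matchings inc V E" using M by (auto simp: matchings_def)
  next
    fix N assume "N \<in> (\<lambda>M. k ` M) ` matchings inc V E"
    then obtain M where M: "N = k ` M" "M \<subseteq> E" "(\<Union>e\<in>M. inc e) = V" "disjoint_family_on inc M"
      by (auto simp: matchings_def)
    have "(\<Union>e\<in>N. inc' e) = h ` (\<Union>e\<in>M. inc e)" using cov[OF M(2)] M(1) by simp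
    moreover have "disjoint_family_on inc' N" unfolding disjoint_family_on_def
    proof (intro ballI impI)
      fix a a' assume "a \<in> N" "a' \<in> N" "a \<noteq> a'"
      then obtain e e' where e: "a = k e" "a' = k e'" "e \<in> M" "e' \<in> M" "e \<noteq> e'" using M(1) by blast
      then have "inc e \<inter> inc e' = {}" by (intro disjoint_family_onD[OF M(4)])
      then have "h ` inc e \<inter> h ` inc e' = {}"
        using inj_on_image_Int[OF h, of "inc e" "inc e'"] inc(1) e M(2) by auto
      moreover have "inc' a = h ` inc e" "inc' a' = h ` inc e'" using inc(2) e M(2) by blast+
      ultimately show "inc' a \<inter> inc' a' = {}" by simp
    qed
    ultimately show "N \<in> matchings inc' (h ` V) (k ` E)" using M by (auto simp: matchings_def)
  qed
  moreover have "inj_on (\<lambda>M. k ` M) (matchings inc V E)"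
    by (rule inj_onI) (use k in \<open>auto simp: matchings_def inj_on_image_eq_iff\<close>)
  ultimately have "msum inc' (h ` V) (k ` E) w' = (\<Sum>M\<in>matchings inc V E. \<Prod>e\<in>k ` M. w' e)"
    unfolding msum_def by (simp add: sum.reindex)
  also have "\<dots> = msum inc V E w" unfolding msum_def
  proof (intro sum.cong refl)
    fix M assume "M \<in> matchings inc V E"
    then have "M \<subseteq> E" by (simp add: matchings_def)
    then show "(\<Prod>e\<in>k ` M. w' e) = (\<Prod>e\<in>M. w e)"
      using k w by (subst prod.reindex) (auto intro: inj_on_subset prod.cong)
  qed
  finally show ?thesis .
qed

text \<open>Exactly one edge at \<open>v\<close> is used. Once its ends are removed, the other edges
  at \<open>v\<close> drop out by themselves, so the recursion can keep the edge set
  \<open>E\<close>.\<close>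

lemma msum_vertex:
  assumes fin: "finite E" and v: "v \<in> V" and ne: "\<And>e. e \<in> E \<Longrightarrow> inc e \<noteq> {}"
  shows "msum inc V E w = (\<Sum>e\<in>E. if v \<in> inc e \<and> inc e \<subseteq> V then w e * msum inc (V - inc e) E w else 0)"
proof -
  define E1 where "E1 = {e \<in> E. v \<notin> inc e}"
  define E2 where "E2 = {e \<in> E. v \<in> inc e}"
  have E: "E = E1 \<union> E2" "E1 \<inter> E2 = {}" "finite E1" "finite E2" using fin by (auto simp: E1_def E2_def)
  let ?S = "{X. X \<subseteq> E2 \<and> (\<Union>e\<in>X. inc e) \<subseteq> V \<and> disjoint_family_on inc X}"
  let ?t = "\<lambda>X. (\<Prod>e\<in>X. w e) * msum inc (V - (\<Union>e\<in>X. inc e)) E1 w"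
  have "msum inc V E w = (\<Sum>X\<in>?S. ?t X)"
    unfolding E(1) by (rule msum_split) (use E ne in auto)
  also have "\<dots> = (\<Sum>X\<in>(\<lambda>e. {e}) ` {e \<in> E2. inc e \<subseteq> V}. ?t X)"
  proof (rule sum.mono_neutral_right)
    show "finite ?S" by (rule finite_subset[of _ "Pow E2"]) (use E in auto)
    show "(\<lambda>e. {e}) ` {e \<in> E2. inc e \<subseteq> V} \<subseteq> ?S" by (auto simp: disjoint_family_on_def)
    show "\<forall>X\<in>?S - (\<lambda>e. {e}) ` {e \<in> E2. inc e \<subseteq> V}. ?t X = 0"
    proof
      fix X assume X: "X \<in> ?S - (\<lambda>e. {e}) ` {e \<in> E2. inc e \<subseteq> V}"
      have "X = {}"
      proof (rule ccontr)
        assume "X \<noteq> {}"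
        then obtain e where e: "e \<in> X" by blast
        have "e' = e" if "e' \<in> X" for e'
          using disjoint_family_onD[of inc X e' e] X that e by (auto simp: E2_def)
        then have "X = {e}" using e by blast
        then show False using X by auto
      qed
      have "msum inc V E1 w = 0" by (rule msum_uncovered[OF v]) (auto simp: E1_def)
      then show "?t X = 0" using \<open>X = {}\<close> by simp
    qed
  qed
  also have "\<dots> = (\<Sum>e\<in>{e \<in> E2. inc e \<subseteq> V}. w e * msum inc (V - inc e) E1 w)"
    by (subst sum.reindex) auto
  also have "\<dots> = (\<Sum>e\<in>{e \<in> E2. inc e \<subseteq> V}. w e * msum inc (V - inc e) E w)"
    by (intro sum.cong refl arg_cong2[of _ _ _ _ "(*)"] msum_edges_cong) (auto simp: E1_def E2_def)
  also have "{e \<in> E2. inc e \<subseteq> V} = {e \<in> E. v \<in> inc e \<and> inc e \<subseteq> V}" by (auto simp: E2_def)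
  also have "(\<Sum>e\<in>{e \<in> E. v \<in> inc e \<and> inc e \<subseteq> V}. w e * msum inc (V - inc e) E w) =
      (\<Sum>e\<in>E. if v \<in> inc e \<and> inc e \<subseteq> V then w e * msum inc (V - inc e) E w else 0)"
    using fin by (simp add: sum.inter_filter)
  finally show ?thesis .
qed

section \<open>Weighted Aztec diamonds\<close>

lemma sum_PiE_restrict:
  fixes G :: "'c \<Rightarrow> 'f set \<Rightarrow> real"
  assumes fin: "finite C" "finite F" and G0: "\<And>c S. c \<in> C \<Longrightarrow> \<not> S \<subseteq> N c \<Longrightarrow> G c S = 0"
  shows "(\<Sum>p\<in>F \<rightarrow>\<^sub>E C. \<Prod>c\<in>C. G c {f \<in> F. p f = c}) =
    (\<Sum>p\<in>PiE F (\<lambda>f. {c \<in> C. f \<in> N c}). \<Prod>c\<in>C. G c {f \<in> F. p f = c})"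
proof (rule sum.mono_neutral_right)
  let ?A = "\<lambda>f. {c \<in> C. f \<in> N c}"
  show "finite (F \<rightarrow>\<^sub>E C)" using fin by (intro finite_PiE) auto
  show "PiE F ?A \<subseteq> F \<rightarrow>\<^sub>E C" by (rule PiE_mono) auto
  show "\<forall>p\<in>(F \<rightarrow>\<^sub>E C) - PiE F ?A. (\<Prod>c\<in>C. G c {f \<in> F. p f = c}) = 0"
  proof
    fix p assume p: "p \<in> (F \<rightarrow>\<^sub>E C) - PiE F ?A"
    then obtain f where f: "f \<in> F" "p f \<notin> ?A f" by (auto simp: PiE_iff)
    then have "p f \<in> C" "f \<notin> N (p f)" using p by (auto simp: PiE_iff)
    then have "G (p f) {f' \<in> F. p f' = p f} = 0" using f by (intro G0) auto
    then show "(\<Prod>c\<in>C. G c {f \<in> F. p f = c}) = 0" using \<open>p f \<in> C\<close> fin by (intro prod_zero) auto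
  qed
qed

text \<open>A vertex of \<open>F'\<close> is contested by one class of each colour, so an assignment
  is the set \<open>Y\<close> of contested vertices that choose the colour \<open>\<phi>\<close>. An
  uncontested vertex always lies in the local set of its only class.\<close>

lemma sum_two_colouring:
  fixes G :: "'c \<Rightarrow> 'f set \<Rightarrow> real"
  assumes fin: "finite C" "finite F" and sub: "F' \<subseteq> F"
    and two: "\<And>f. f \<in> F' \<Longrightarrow> {c \<in> C. f \<in> N c} = {\<alpha> f, \<beta> f} \<and> \<phi> (\<alpha> f) \<and> \<not> \<phi> (\<beta> f)"
    and one: "\<And>f. f \<in> F - F' \<Longrightarrow> \<exists>c. {c \<in> C. f \<in> N c} = {c}"
    and G0: "\<And>c S. c \<in> C \<Longrightarrow> \<not> S \<subseteq> N c \<Longrightarrow> G c S = 0"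
  shows "(\<Sum>p\<in>F \<rightarrow>\<^sub>E C. \<Prod>c\<in>C. G c {f \<in> F. p f = c}) =
    (\<Sum>Y\<in>Pow F'. \<Prod>c\<in>C. G c {f \<in> F \<inter> N c. f \<in> F' \<longrightarrow> (f \<in> Y \<longleftrightarrow> \<phi> c)})"
proof -
  define A where "A f = {c \<in> C. f \<in> N c}" for f
  have A2: "A f = {\<alpha> f, \<beta> f}" "\<phi> (\<alpha> f)" "\<not> \<phi> (\<beta> f)" if "f \<in> F'" for f
    using two[OF that] by (simp_all add: A_def)
  have A1: "A f = {THE c. c \<in> A f}" if f: "f \<in> F - F'" for f
  proof -
    obtain c where "A f = {c}" using one[OF f] by (auto simp: A_def)
    then show ?thesis by simp
  qed
  let ?i = "\<lambda>Y. \<lambda>f\<in>F. if f \<in> F' then if f \<in> Y then \<alpha> f else \<beta> f else (THE c. c \<in> A f)"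
  have "(\<Sum>p\<in>F \<rightarrow>\<^sub>E C. \<Prod>c\<in>C. G c {f \<in> F. p f = c}) = (\<Sum>p\<in>PiE F A. \<Prod>c\<in>C. G c {f \<in> F. p f = c})"
    unfolding A_def by (rule sum_PiE_restrict[where N = N]) (use fin G0 in auto)
  also have "\<dots> = (\<Sum>Y\<in>Pow F'. \<Prod>c\<in>C. G c {f \<in> F \<inter> N c. f \<in> F' \<longrightarrow> (f \<in> Y \<longleftrightarrow> \<phi> c)})"
  proof (rule sum.reindex_bij_witness[where i = ?i and j = "\<lambda>p. {f \<in> F'. \<phi> (p f)}"])
    fix p assume p: "p \<in> PiE F A"
    have p1: "p f = (THE c. c \<in> A f)" if "f \<in> F - F'" for f
      using A1[OF that] PiE_mem[OF p, of f] that by blast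
    show "?i {f \<in> F'. \<phi> (p f)} = p"
    proof
      fix f
      show "?i {f \<in> F'. \<phi> (p f)} f = p f"
      proof (cases "f \<in> F")
        case True
        then show ?thesis using A2[of f] p1[of f] PiE_mem[OF p True] by auto
      next
        case False
        then show ?thesis using PiE_arb[OF p False] by simp
      qed
    qed
    show "(\<Prod>c\<in>C. G c {f \<in> F \<inter> N c. f \<in> F' \<longrightarrow> (f \<in> {f \<in> F'. \<phi> (p f)} \<longleftrightarrow> \<phi> c)}) = (\<Prod>c\<in>C. G c {f \<in> F. p f = c})"
    proof (rule prod.cong[OF refl])
      fix c assume c: "c \<in> C"
      have "f \<in> N c \<and> (f \<in> F' \<longrightarrow> (\<phi> (p f) \<longleftrightarrow> \<phi> c)) \<longleftrightarrow> p f = c" if f: "f \<in> F" for f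
      proof -
        have N: "f \<in> N c \<longleftrightarrow> c \<in> A f" using c by (simp add: A_def)
        show ?thesis
        proof (cases "f \<in> F'")
          case True
          then show ?thesis unfolding N using A2[OF True] PiE_mem[OF p f] by auto
        next
          case False
          then have "A f = {p f}" using A1[of f] p1[of f] f by auto
          then show ?thesis unfolding N using False by auto
        qed
      qed
      then have "{f \<in> F \<inter> N c. f \<in> F' \<longrightarrow> (f \<in> {f \<in> F'. \<phi> (p f)} \<longleftrightarrow> \<phi> c)} = {f \<in> F. p f = c}" by auto
      then show "G c {f \<in> F \<inter> N c. f \<in> F' \<longrightarrow> (f \<in> {f \<in> F'. \<phi> (p f)} \<longleftrightarrow> \<phi> c)} = G c {f \<in> F. p f = c}" by simp
    qed
  next
    fix Y assume Y: "Y \<in> Pow F'"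
    then show "{f \<in> F'. \<phi> (?i Y f)} = Y" using A2 sub by auto
    show "?i Y \<in> PiE F A"
    proof (rule PiE_I)
      fix f assume "f \<in> F"
      then show "?i Y f \<in> A f" using A2[of f] A1[of f] by auto
    qed auto
  qed auto
  finally show ?thesis .
qed

text \<open>Swapping the two classes that compete for every vertex of \<open>F'\<close> complements each local set.\<close>

lemma sum_complement:
  fixes G G' :: "'c \<Rightarrow> 'f set \<Rightarrow> real"
  assumes C: "finite C" and F: "F = (\<Union>c\<in>C. N c)" "finite F" "F' \<subseteq> F"
    and two: "\<And>f. f \<in> F' \<Longrightarrow> {c \<in> C. f \<in> N c} = {\<alpha> f, \<beta> f} \<and> \<phi> (\<alpha> f) \<and> \<not> \<phi> (\<beta> f)"
    and one: "\<And>f. f \<in> F - F' \<Longrightarrow> \<exists>c. {c \<in> C. f \<in> N c} = {c}"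
    and G: "\<And>c S. c \<in> C \<Longrightarrow> S \<subseteq> N c \<Longrightarrow> G c S = G' c (N c - S)"
    and Gn: "\<And>c S. c \<in> C \<Longrightarrow> \<not> S \<subseteq> N c \<Longrightarrow> G c S = 0 \<and> G' c S = 0"
  shows "(\<Sum>p\<in>F \<rightarrow>\<^sub>E C. \<Prod>c\<in>C. G c {f \<in> F. p f = c}) = (\<Sum>p\<in>F' \<rightarrow>\<^sub>E C. \<Prod>c\<in>C. G' c {f \<in> F'. p f = c})"
proof -
  have "(\<Sum>p\<in>F \<rightarrow>\<^sub>E C. \<Prod>c\<in>C. G c {f \<in> F. p f = c}) =
      (\<Sum>Y\<in>Pow F'. \<Prod>c\<in>C. G c {f \<in> F \<inter> N c. f \<in> F' \<longrightarrow> (f \<in> Y \<longleftrightarrow> \<phi> c)})"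
    by (rule sum_two_colouring[where \<alpha> = \<alpha> and \<beta> = \<beta>]) (use assms in auto)
  \<comment> \<open>The colours are exchanged while \<open>Y\<close> stays. Each local set becomes
    its complement in \<open>N c\<close>, from which the uncontested vertices have vanished; this is
    why \<open>F\<close> shrinks to \<open>F'\<close>.\<close>
  also have "\<dots> = (\<Sum>Y\<in>Pow F'. \<Prod>c\<in>C. G' c {f \<in> F' \<inter> N c. f \<in> F' \<longrightarrow> (f \<in> Y \<longleftrightarrow> \<not> \<phi> c)})"
  proof (intro sum.cong prod.cong refl)
    fix Y c assume "c \<in> C"
    moreover from this have "N c - {f \<in> F \<inter> N c. f \<in> F' \<longrightarrow> (f \<in> Y \<longleftrightarrow> \<phi> c)} = {f \<in> F' \<inter> N c. f \<in> F' \<longrightarrow> (f \<in> Y \<longleftrightarrow> \<not> \<phi> c)}"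
      using F(1) by auto
    ultimately show "G c {f \<in> F \<inter> N c. f \<in> F' \<longrightarrow> (f \<in> Y \<longleftrightarrow> \<phi> c)} = G' c {f \<in> F' \<inter> N c. f \<in> F' \<longrightarrow> (f \<in> Y \<longleftrightarrow> \<not> \<phi> c)}"
      using G[of c "{f \<in> F \<inter> N c. f \<in> F' \<longrightarrow> (f \<in> Y \<longleftrightarrow> \<phi> c)}"] by auto
  qed
  also have "\<dots> = (\<Sum>p\<in>F' \<rightarrow>\<^sub>E C. \<Prod>c\<in>C. G' c {f \<in> F'. p f = c})"
    by (rule sum_two_colouring[symmetric, where \<alpha> = \<beta> and \<beta> = \<alpha>])
      (use C F Gn two in \<open>auto simp: insert_commute intro: finite_subset\<close>)
  finally show ?thesis .
qed

text \<open>A domino is named by the unit edge it crosses: \<open>(z, True)\<close> is the edge from \<open>z\<close> to \<open>z + (1, 0)\<close> and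
  \<open>(z, False)\<close> the edge from \<open>z\<close> to \<open>z + (0, 1)\<close>.\<close>

fun domino :: "(int \<times> int) \<times> bool \<Rightarrow> (int \<times> int) set" where
  "domino ((x, y), h) = (if h then {(x, y), (x, y - 1)} else {(x, y), (x - 1, y)})"

section \<open>The 4-cycle at a node and its renewal\<close>

fun node_squares :: "int \<times> int \<Rightarrow> (int \<times> int) set" where
  "node_squares (x, y) = {(x, y), (x - 1, y), (x, y - 1), (x - 1, y - 1)}"

abbreviation "east z \<equiv> (z, True)"
abbreviation "west z \<equiv> ((fst z - 1, snd z), True)"
abbreviation "north z \<equiv> (z, False)"
abbreviation "south z \<equiv> ((fst z, snd z - 1), False)"

definition node_edges :: "int \<times> int \<Rightarrow> ((int \<times> int) \<times> bool) set" where
  "node_edges z = {east z, west z, north z, south z}"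

lemma node_local_sum:
  fixes z :: "int \<times> int"
  defines "NE \<equiv> z" and "NW \<equiv> (fst z - 1, snd z)" and "SE \<equiv> (fst z, snd z - 1)" and "SW \<equiv> (fst z - 1, snd z - 1)"
  shows "msum domino {} (node_edges z) w = 1"
    "msum domino {NE, SE} (node_edges z) w = w (east z)"
    "msum domino {NW, SW} (node_edges z) w = w (west z)"
    "msum domino {NE, NW} (node_edges z) w = w (north z)"
    "msum domino {SE, SW} (node_edges z) w = w (south z)"
    "msum domino {NE, NW, SE, SW} (node_edges z) w = w (east z) * w (west z) + w (north z) * w (south z)"
    "msum domino {NE} (node_edges z) w = 0"
    "msum domino {NW} (node_edges z) w = 0"
    "msum domino {SE} (node_edges z) w = 0"
    "msum domino {SW} (node_edges z) w = 0"
    "msum domino {NE, SW} (node_edges z) w = 0"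
    "msum domino {NW, SE} (node_edges z) w = 0"
    "msum domino {NW, SE, SW} (node_edges z) w = 0"
    "msum domino {NE, SE, SW} (node_edges z) w = 0"
    "msum domino {NE, NW, SW} (node_edges z) w = 0"
    "msum domino {NE, NW, SE} (node_edges z) w = 0"
proof -
  obtain x y where z: "z = (x, y)" by fastforce
  note defs = NE_def NW_def SE_def SW_def node_edges_def z fst_conv snd_conv
  have ne: "\<And>e. domino e \<noteq> {}" by (metis domino.elims insert_not_empty)
  have e: "msum domino {} E w = 1" for E by (rule msum_empty) (rule ne)
  note vertex = msum_vertex[where inc = domino and w = w, OF _ _ ne]
  show "msum domino {} (node_edges z) w = 1" by (rule e)
  show "msum domino {NE, SE} (node_edges z) w = w (east z)"
    unfolding defs by (subst vertex[where v = "(x, y)"]) (simp_all add: e insert_Diff_if)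
  show "msum domino {NW, SW} (node_edges z) w = w (west z)"
    unfolding defs by (subst vertex[where v = "(x - 1, y)"]) (simp_all add: e insert_Diff_if)
  show "msum domino {NE, NW} (node_edges z) w = w (north z)"
    unfolding defs by (subst vertex[where v = "(x, y)"]) (simp_all add: e insert_Diff_if)
  show "msum domino {SE, SW} (node_edges z) w = w (south z)"
    unfolding defs by (subst vertex[where v = "(x, y - 1)"]) (simp_all add: e insert_Diff_if)
  then show "msum domino {NE, NW, SE, SW} (node_edges z) w = w (east z) * w (west z) + w (north z) * w (south z)"
    using \<open>msum domino {NW, SW} (node_edges z) w = w (west z)\<close>
    unfolding defs by (subst vertex[where v = "(x, y)"]) (simp_all add: insert_Diff_if)
  show "msum domino {NE} (node_edges z) w = 0" "msum domino {NW} (node_edges z) w = 0"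
    "msum domino {SE} (node_edges z) w = 0" "msum domino {SW} (node_edges z) w = 0"
    unfolding defs by (intro msum_uncovered; force)+
  then have z1: "msum domino {(x, y)} (node_edges z) w = 0" "msum domino {(x - 1, y)} (node_edges z) w = 0"
    "msum domino {(x, y - 1)} (node_edges z) w = 0" "msum domino {(x - 1, y - 1)} (node_edges z) w = 0"
    by (simp_all add: NE_def NW_def SE_def SW_def z)
  show "msum domino {NE, SW} (node_edges z) w = 0" unfolding defs by (intro msum_uncovered[of "(x, y)"]) auto
  show "msum domino {NW, SE} (node_edges z) w = 0" unfolding defs by (intro msum_uncovered[of "(x - 1, y)"]) auto
  note z1' = z1[unfolded defs]
  show "msum domino {NE, SE, SW} (node_edges z) w = 0"
    unfolding defs by (subst vertex[where v = "(x, y)"]) (simp_all add: z1' insert_Diff_if)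
  show "msum domino {NW, SE, SW} (node_edges z) w = 0"
    unfolding defs by (subst vertex[where v = "(x - 1, y)"]) (simp_all add: z1' insert_Diff_if)
  show "msum domino {NE, NW, SW} (node_edges z) w = 0"
    unfolding defs by (subst vertex[where v = "(x, y)"]) (simp_all add: z1' insert_Diff_if)
  show "msum domino {NE, NW, SE} (node_edges z) w = 0"
    unfolding defs by (subst vertex[where v = "(x - 1, y)"]) (simp_all add: z1' insert_Diff_if)
qed

definition cell_factor :: "((int \<times> int) \<times> bool \<Rightarrow> real) \<Rightarrow> int \<times> int \<Rightarrow> real" where
  "cell_factor w z = w (east z) * w (west z) + w (north z) * w (south z)"

text \<open>Opposite weights are exchanged because, among the four squares at a node, the complement
  of a domino is the domino on the opposite side.\<close>

definition renewed :: "((int \<times> int) \<times> bool \<Rightarrow> real) \<Rightarrow> ((int \<times> int) \<times> bool \<Rightarrow> real) \<Rightarrow> int \<times> int \<Rightarrow> bool" where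
  "renewed w w' z \<longleftrightarrow> cell_factor w z \<noteq> 0 \<and>
     w' (east z) = w (west z) / cell_factor w z \<and> w' (west z) = w (east z) / cell_factor w z \<and>
     w' (north z) = w (south z) / cell_factor w z \<and> w' (south z) = w (north z) / cell_factor w z"

lemma subset_four_cases:
  assumes "S \<subseteq> {a, b, c, d}"
    and P: "P {}" "P {a}" "P {b}" "P {c}" "P {d}" "P {a, b}" "P {a, c}" "P {a, d}" "P {b, c}" "P {b, d}" "P {c, d}" "P {a, b, c}" "P {a, b, d}" "P {a, c, d}" "P {b, c, d}" "P {a, b, c, d}"
  shows "P S"
proof -
  have "P ((if A then {a} else {}) \<union> (if B then {b} else {}) \<union> (if C then {c} else {}) \<union> (if D then {d} else {}))" for A B C D
    using P by (cases A; cases B; cases C; cases D) (simp_all add: insert_commute)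
  moreover have "S = (if a \<in> S then {a} else {}) \<union> (if b \<in> S then {b} else {}) \<union> (if c \<in> S then {c} else {}) \<union> (if d \<in> S then {d} else {})"
    using assms(1) by auto
  ultimately show ?thesis by metis
qed

text \<open>For a single domino the exchange of opposite weights gives the identity directly. The
  empty and the full set change places, which fixes the normalisation by the cell factor; for all
  other sets both sides vanish.\<close>

lemma node_renewal:
  assumes S: "S \<subseteq> node_squares z" and r: "renewed w w' z"
  shows "msum domino S (node_edges z) w = cell_factor w z * msum domino (node_squares z - S) (node_edges z) w'"
proof -
  obtain x y where z: "z = (x, y)" by fastforce
  note L = node_local_sum[of z, unfolded z fst_conv snd_conv]
  have D: "cell_factor w z = w ((x, y), True) * w ((x - 1, y), True) + w ((x, y), False) * w ((x, y - 1), False)"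
    by (simp add: cell_factor_def z)
  have r': "cell_factor w z \<noteq> 0" "w' ((x, y), True) = w ((x - 1, y), True) / cell_factor w z"
    "w' ((x - 1, y), True) = w ((x, y), True) / cell_factor w z"
    "w' ((x, y), False) = w ((x, y - 1), False) / cell_factor w z"
    "w' ((x, y - 1), False) = w ((x, y), False) / cell_factor w z"
    using r by (simp_all add: renewed_def z)
  \<comment> \<open>The case of empty \<open>S\<close>: on the full 4-cycle the new weights sum to
    \<open>1 / cell_factor w z\<close>.\<close>
  have all: "w ((x - 1, y), True) * w ((x, y), True) / (cell_factor w z * cell_factor w z) +
      w ((x, y - 1), False) * w ((x, y), False) / (cell_factor w z * cell_factor w z) = 1 / cell_factor w z"
    using r'(1) by (simp add: D[symmetric] mult.commute flip: add_divide_distrib)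
  have s: "S \<subseteq> {(x, y), (x - 1, y), (x, y - 1), (x - 1, y - 1)}" using S by (simp add: z)
  show ?thesis unfolding z node_squares.simps
    using s by (rule subset_four_cases) (insert r'(1)[unfolded z], simp_all add: insert_Diff_if L all[unfolded z] r'(2-5)[unfolded z] D[unfolded z, symmetric])
qed

text \<open>The corner of \<open>f\<close> whose coordinate sum is odd iff \<open>t\<close> and
  whose first coordinate is even iff \<open>b\<close>. Both values of \<open>t\<close> occur because
  successive renewals act at nodes of alternating parity.\<close>

definition corner :: "bool \<Rightarrow> int \<times> int \<Rightarrow> bool \<Rightarrow> int \<times> int" where
  "corner t f b = (if t then cell_node f b
     else if b then (even_of (fst f), even_of (snd f)) else (odd_of (fst f), odd_of (snd f)))"

text \<open>The centres of the 4-cycles of an Aztec diamond of order \<open>m\<close> around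
  \<open>(n, 0)\<close>. Lowering \<open>m\<close> by one switches to the nodes of the other
  parity.\<close>

definition nodes :: "nat \<Rightarrow> nat \<Rightarrow> (int \<times> int) set" where
  "nodes n m = {z. l1 n z < int m \<and> odd (l1 n z + int m)}"

definition squares :: "nat \<Rightarrow> nat \<Rightarrow> (int \<times> int) set" where
  "squares n m = (\<Union>z\<in>nodes n m. node_squares z)"

definition aztec :: "nat \<Rightarrow> nat \<Rightarrow> ((int \<times> int) \<times> bool \<Rightarrow> real) \<Rightarrow> real" where
  "aztec n m w = msum domino (squares n m) UNIV w"

text \<open>The distance between \<open>(n, 0)\<close> and the nearest corner of the square.\<close>

definition depth :: "nat \<Rightarrow> int \<times> int \<Rightarrow> int" where
  "depth n f = (if fst f \<ge> int n then fst f - int n else int n - fst f - 1) + (if snd f \<ge> 0 then snd f else - snd f - 1)"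

lemma parity_l1: "even (l1 n z) \<longleftrightarrow> even (fst z + snd z + int n)"
  unfolding l1_def by presburger

lemma node_squares_iff:
  "f \<in> node_squares z \<longleftrightarrow> (fst z = fst f \<or> fst z = fst f + 1) \<and> (snd z = snd f \<or> snd z = snd f + 1)"
  by (cases z; cases f) auto

lemma corner_iff:
  "f \<in> node_squares z \<and> (t \<longleftrightarrow> odd (fst z + snd z)) \<longleftrightarrow> z = corner t f True \<or> z = corner t f False"
proof -
  obtain x y a b where "f = (x, y)" "z = (a, b)" by fastforce
  then show ?thesis unfolding node_squares_iff
    by (auto simp: corner_def node_defs)
qed

lemma even_corner: "even (fst (corner t f b)) \<longleftrightarrow> b"
  by (auto simp: corner_def node_defs)

text \<open>The corners of a square at depth \<open>d\<close> have the distances \<open>d\<close>,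
  \<open>d + 1\<close>, \<open>d + 1\<close> and \<open>d + 2\<close>. A parity class contains
  either the two extreme ones or the two middle ones.\<close>

lemma l1_corner_min:
  "min (l1 n (corner t f True)) (l1 n (corner t f False)) = depth n f + (if even (depth n f) = even (l1 n (corner t f True)) then 0 else 1)" (is "?l = ?r")
  "max (l1 n (corner t f True)) (l1 n (corner t f False)) = depth n f + (if even (depth n f) = even (l1 n (corner t f True)) then 2 else 1)" (is "?l' = ?r'")
proof -
  obtain x y where f: "f = (x, y)" by fastforce
  consider "x \<ge> int n" "y \<ge> 0" | "x \<ge> int n" "y \<le> -1" | "x + 1 \<le> int n" "y \<ge> 0" | "x + 1 \<le> int n" "y \<le> -1" by linarith
  then have "?l = ?r \<and> ?l' = ?r'"
    by cases (auto simp: corner_def node_defs l1_def depth_def f min_def max_def)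
  then show "?l = ?r" "?l' = ?r'" by blast+
qed

lemma in_nodes_iff:
  "z \<in> nodes n m \<longleftrightarrow> l1 n z < int m \<and> (even (n + m) \<longleftrightarrow> odd (fst z + snd z))"
  using parity_l1[of n z] by (auto simp: nodes_def)

lemma nodes_square_iff:
  "z \<in> nodes n m \<and> f \<in> node_squares z \<longleftrightarrow>
    l1 n z < int m \<and> (z = corner (even (n + m)) f True \<or> z = corner (even (n + m)) f False)"
  unfolding in_nodes_iff corner_iff[symmetric] by blast

lemma parity_corner: "odd (l1 n (corner (even (n + m)) f b) + int m)"
proof -
  have "z \<in> {corner (even (n + m)) f True, corner (even (n + m)) f False} \<Longrightarrow> odd (l1 n z + int m)" for z
    using corner_iff[of f z "even (n + m)"] parity_l1[of n z] by auto
  then show ?thesis by (cases b) auto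
qed

lemma squares_iff: "f \<in> squares n m \<longleftrightarrow> depth n f < int m"
proof -
  let ?a = "l1 n (corner (even (n + m)) f True)" and ?b = "l1 n (corner (even (n + m)) f False)"
  have "f \<in> squares n m \<longleftrightarrow> min ?a ?b < int m"
    unfolding squares_def UN_iff Bex_def nodes_square_iff min_less_iff_disj by blast
  also have "\<dots> \<longleftrightarrow> depth n f < int m"
    using l1_corner_min(1)[of n "even (n + m)" f] parity_corner[of n m f True]
    by (simp split: if_splits) presburger+
  finally show ?thesis .
qed

text \<open>Identifies the contested squares of order \<open>m\<close>, those claimed by two nodes,
  with the Aztec diamond of order \<open>m - 1\<close>. It supplies the set \<open>F'\<close> of the
  complementation argument.\<close>

lemma squares_pred_iff:
  assumes "m > 0"
  shows "f \<in> squares n (m - 1) \<longleftrightarrow> l1 n (corner (even (n + m)) f True) < int m \<and> l1 n (corner (even (n + m)) f False) < int m"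
proof -
  let ?a = "l1 n (corner (even (n + m)) f True)" and ?b = "l1 n (corner (even (n + m)) f False)"
  have "?a < int m \<and> ?b < int m \<longleftrightarrow> max ?a ?b < int m" by simp
  also have "\<dots> \<longleftrightarrow> depth n f < int (m - 1)"
    using l1_corner_min(2)[of n "even (n + m)" f] parity_corner[of n m f True] assms
    by (simp split: if_splits) presburger+
  finally show ?thesis by (simp add: squares_iff)
qed

lemma finite_nodes: "finite (nodes n m)"
proof (rule finite_subset)
  show "nodes n m \<subseteq> {int n - int m..int n + int m} \<times> {- int m..int m}"
    unfolding nodes_def l1_def by auto
qed auto

lemma finite_node_squares: "finite (node_squares z)"
  by (cases z) auto

lemma finite_squares: "finite (squares n m)"
  unfolding squares_def using finite_nodes finite_node_squares by blast

lemma squares_mono: "squares n (m - 1) \<subseteq> squares n m"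
  by (auto simp: squares_iff)

lemma node_edges_domino: "e \<in> node_edges z \<Longrightarrow> domino e \<subseteq> node_squares z \<and> domino e \<noteq> {}"
  by (cases z) (auto simp: node_edges_def)

text \<open>The ends of the crossed edge have opposite parities and distances at most
  \<open>m\<close>; the end with the parity required in \<open>nodes n m\<close> is strictly
  closer.\<close>

lemma domino_in_squares:
  assumes "domino e \<subseteq> squares n m"
  shows "e \<in> (\<Union>z\<in>nodes n m. node_edges z)"
proof -
  obtain x y h where e: "e = ((x, y), h)" by (metis prod.collapse)
  have node: "z \<in> nodes n m" if "odd (l1 n z + int m)" "l1 n z \<le> int m" for z
  proof -
    have "l1 n z \<noteq> int m" using that(1) by auto
    then show ?thesis using that by (simp add: nodes_def)
  qed
  show ?thesis
  proof (cases h)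
    case True
    then have "depth n (x, y) < int m" "depth n (x, y - 1) < int m" using assms by (auto simp: e squares_iff)
    then have "l1 n (x, y) \<le> int m" "l1 n (x + 1, y) \<le> int m" by (auto simp: l1_def depth_def split: if_splits)
    moreover have "odd (l1 n (x, y) + int m) \<or> odd (l1 n (x + 1, y) + int m)" by (auto simp: parity_l1)
    ultimately have "(x, y) \<in> nodes n m \<or> (x + 1, y) \<in> nodes n m" using node by blast
    moreover have "e \<in> node_edges (x, y)" "e \<in> node_edges (x + 1, y)" using True by (auto simp: e node_edges_def)
    ultimately show ?thesis by blast
  next
    case False
    then have "depth n (x, y) < int m" "depth n (x - 1, y) < int m" using assms by (auto simp: e squares_iff)
    then have "l1 n (x, y) \<le> int m" "l1 n (x, y + 1) \<le> int m" by (auto simp: l1_def depth_def split: if_splits)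
    moreover have "odd (l1 n (x, y) + int m) \<or> odd (l1 n (x, y + 1) + int m)" by (auto simp: parity_l1)
    ultimately have "(x, y) \<in> nodes n m \<or> (x, y + 1) \<in> nodes n m" using node by blast
    moreover have "e \<in> node_edges (x, y)" "e \<in> node_edges (x, y + 1)" using False by (auto simp: e node_edges_def)
    ultimately show ?thesis by blast
  qed
qed

lemma disjoint_node_edges: "disjoint_family_on node_edges (nodes n m)"
  unfolding disjoint_family_on_def
proof (intro ballI impI)
  fix z z' assume z: "z \<in> nodes n m" "z' \<in> nodes n m" "z \<noteq> z'"
  then have "even (fst z + snd z) = even (fst z' + snd z')" by (auto simp: in_nodes_iff)
  with z(3) show "node_edges z \<inter> node_edges z' = {}"
    by (cases z; cases z') (auto simp: node_edges_def)
qed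

lemma node_edges_uncovered:
  assumes ns: "\<not> S \<subseteq> node_squares c"
  shows "msum domino S (node_edges c) w = 0"
proof -
  obtain f where "f \<in> S" "f \<notin> node_squares c" using ns by blast
  then show ?thesis using node_edges_domino by (intro msum_uncovered[of f]) blast+
qed

text \<open>The smaller diamond, too, is grouped by the nodes of order \<open>m\<close>:
  complementation compares the two orders over the same 4-cycles.\<close>

lemma aztec_group:
  assumes "squares n m' \<subseteq> squares n m"
  shows "aztec n m' w = (\<Sum>p\<in>squares n m' \<rightarrow>\<^sub>E nodes n m. \<Prod>c\<in>nodes n m. msum domino {f \<in> squares n m'. p f = c} (node_edges c) w)"
proof -
  have fin: "finite (node_edges z)" for z by (simp add: node_edges_def)
  have "aztec n m' w = msum domino (squares n m') (\<Union>z\<in>nodes n m. node_edges z) w"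
    unfolding aztec_def using domino_in_squares assms by (intro msum_edges_cong) blast
  also have "\<dots> = (\<Sum>p\<in>squares n m' \<rightarrow>\<^sub>E nodes n m. \<Prod>c\<in>nodes n m. msum domino {f \<in> squares n m'. p f = c} (node_edges c) w)"
    using fin finite_nodes finite_squares disjoint_node_edges node_edges_domino by (intro msum_group) auto
  finally show ?thesis .
qed

lemma aztec_reduce:
  assumes m: "m > 0" and r: "\<And>z. z \<in> nodes n m \<Longrightarrow> renewed w w' z"
  shows "aztec n m w = (\<Prod>z\<in>nodes n m. cell_factor w z) * aztec n (m - 1) w'"
proof -
  let ?C = "nodes n m"
  let ?\<alpha> = "\<lambda>f. corner (even (n + m)) f True" and ?\<beta> = "\<lambda>f. corner (even (n + m)) f False"
  have A: "{c \<in> nodes n m. f \<in> node_squares c} = {z. l1 n z < int m \<and> (z = ?\<alpha> f \<or> z = ?\<beta> f)}" for f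
    by (simp only: nodes_square_iff)
  have "aztec n m w = (\<Sum>p\<in>squares n (m - 1) \<rightarrow>\<^sub>E ?C. \<Prod>c\<in>?C. cell_factor w c * msum domino {f \<in> squares n (m - 1). p f = c} (node_edges c) w')"
    unfolding aztec_group[OF subset_refl]
  proof (rule sum_complement[where N = node_squares and \<alpha> = ?\<alpha> and \<beta> = ?\<beta> and \<phi> = "\<lambda>z. even (fst z)"])
    show "squares n m = \<Union> (node_squares ` nodes n m)" by (simp add: squares_def)
    show "{c \<in> nodes n m. f \<in> node_squares c} = {?\<alpha> f, ?\<beta> f} \<and> even (fst (?\<alpha> f)) \<and> \<not> even (fst (?\<beta> f))" if "f \<in> squares n (m - 1)" for f
      using that even_corner unfolding squares_pred_iff[OF m] A by auto
    show "\<exists>c. {c \<in> nodes n m. f \<in> node_squares c} = {c}" if "f \<in> squares n m - squares n (m - 1)" for f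
    proof -
      have "\<exists>z. z \<in> nodes n m \<and> f \<in> node_squares z" using that unfolding squares_def by blast
      moreover have "\<not> (l1 n (?\<alpha> f) < int m \<and> l1 n (?\<beta> f) < int m)"
        using that squares_pred_iff[OF m] by blast
      ultimately consider "l1 n (?\<alpha> f) < int m" "\<not> l1 n (?\<beta> f) < int m" | "\<not> l1 n (?\<alpha> f) < int m" "l1 n (?\<beta> f) < int m"
        unfolding nodes_square_iff by blast
      then show ?thesis
      proof cases
        case 1
        then have "{c \<in> nodes n m. f \<in> node_squares c} = {?\<alpha> f}" unfolding A by auto
        then show ?thesis ..
      next
        case 2
        then have "{c \<in> nodes n m. f \<in> node_squares c} = {?\<beta> f}" unfolding A by auto
        then show ?thesis ..
      qed
    qed
  qed (use finite_nodes finite_squares squares_mono node_renewal r node_edges_uncovered in auto)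
  also have "\<dots> = (\<Prod>z\<in>nodes n m. cell_factor w z) * aztec n (m - 1) w'"
    unfolding aztec_group[OF squares_mono] by (simp add: prod.distrib sum_distrib_left)
  finally show ?thesis .
qed

lemma aztec_0: "aztec n 0 w = 1"
proof -
  have "depth n f \<ge> 0" for f by (simp add: depth_def)
  then have "f \<notin> squares n 0" for f by (simp add: squares_iff not_less)
  then have "squares n 0 = {}" by blast
  then show ?thesis unfolding aztec_def by (simp, intro msum_empty) (metis domino.elims insert_not_empty)
qed

section \<open>Ladders\<close>

text \<open>Edges may leave \<open>V i\<close> as long as they stay in the disjoint ambient sets
  \<open>G i\<close>. This suits ladders that have lost some of their corners.\<close>

lemma msum_UN':
  assumes "finite I" "\<And>i. i \<in> I \<Longrightarrow> finite (E i)" and dis: "disjoint_family_on G I" and sub: "\<And>i. i \<in> I \<Longrightarrow> V i \<subseteq> G i"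
    and inc: "\<And>i e. i \<in> I \<Longrightarrow> e \<in> E i \<Longrightarrow> inc e \<subseteq> G i \<and> inc e \<noteq> {}"
  shows "msum inc (\<Union>i\<in>I. V i) (\<Union>i\<in>I. E i) w = (\<Prod>i\<in>I. msum inc (V i) (E i) w)"
proof -
  have "msum inc (\<Union>i\<in>I. V i) (\<Union>i\<in>I. E i) w = msum inc (\<Union>i\<in>I. V i) (\<Union>i\<in>I. {e \<in> E i. inc e \<subseteq> V i}) w"
  proof (rule msum_edges_cong)
    fix e assume e: "inc e \<subseteq> (\<Union>i\<in>I. V i)"
    have "inc e \<subseteq> V i" if i: "i \<in> I" "e \<in> E i" for i
    proof
      fix v assume v: "v \<in> inc e"
      then obtain j where j: "j \<in> I" "v \<in> V j" using e by blast
      then have "v \<in> G i \<inter> G j" using inc[OF i] sub v by blast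
      then have "i = j" using disjoint_family_onD[OF dis i(1) j(1)] by blast
      then show "v \<in> V i" using j by simp
    qed
    then show "e \<in> (\<Union>i\<in>I. E i) \<longleftrightarrow> e \<in> (\<Union>i\<in>I. {e \<in> E i. inc e \<subseteq> V i})" by blast
  qed
  also have "\<dots> = (\<Prod>i\<in>I. msum inc (V i) {e \<in> E i. inc e \<subseteq> V i} w)"
  proof (rule msum_UN)
    show "disjoint_family_on V I" unfolding disjoint_family_on_def
    proof (intro ballI impI)
      fix i j assume ij: "i \<in> I" "j \<in> I" "i \<noteq> j"
      show "V i \<inter> V j = {}" using disjoint_family_onD[OF dis ij] sub ij by blast
    qed
  qed (use assms in auto)
  also have "\<dots> = (\<Prod>i\<in>I. msum inc (V i) (E i) w)" by (intro prod.cong refl msum_restrict[symmetric])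
  finally show ?thesis .
qed

function count_matchings :: "('a \<Rightarrow> 'a \<Rightarrow> bool) \<Rightarrow> 'a list \<Rightarrow> nat" where
  "count_matchings adj [] = 1"
| "count_matchings adj (v # vs) = sum_list (map (\<lambda>u. if adj v u then count_matchings adj (remove1 u vs) else 0) vs)"
  by pat_completeness auto
termination
  by (relation "Wellfounded.measure (\<lambda>(adj, vs). length vs)") (auto simp: length_remove1)

lemma msum_count_matchings:
  fixes adj :: "'a::finite \<Rightarrow> 'a \<Rightarrow> bool"
  assumes sym: "\<And>u v. adj u v \<Longrightarrow> adj v u" and irr: "\<And>u. \<not> adj u u" and "distinct vs"
  shows "msum (\<lambda>e. e) (set vs) {{u, v} | u v. adj u v} (\<lambda>_. 1) = real (count_matchings adj vs)"
  using assms(3)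
proof (induction vs rule: length_induct)
  case (1 vs)
  let ?E = "{{u, v} | u v. adj u v}"
  show ?case
  proof (cases vs)
    case Nil
    then show ?thesis by (simp, intro msum_empty) auto
  next
    case (Cons v us)
    have d: "distinct us" "v \<notin> set us" using 1 Cons by auto
    have eq: "{e \<in> ?E. v \<in> e \<and> e \<subseteq> set vs} = (\<lambda>u. {v, u}) ` {u \<in> set us. adj v u}"
    proof (intro equalityI subsetI)
      fix e assume "e \<in> {e \<in> ?E. v \<in> e \<and> e \<subseteq> set vs}"
      then obtain a b where e: "e = {a, b}" "adj a b" "v \<in> e" "e \<subseteq> set vs" by blast
      define u where "u = (if v = a then b else a)"
      have u: "e = {v, u}" "adj v u" using e sym by (auto simp: u_def)
      moreover have "u \<noteq> v" using u(2) irr by auto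
      then have "u \<in> set us" using e(4) u(1) by (auto simp: Cons)
      ultimately show "e \<in> (\<lambda>u. {v, u}) ` {u \<in> set us. adj v u}" by blast
    next
      fix e assume "e \<in> (\<lambda>u. {v, u}) ` {u \<in> set us. adj v u}"
      then show "e \<in> {e \<in> ?E. v \<in> e \<and> e \<subseteq> set vs}" by (auto simp: Cons)
    qed
    have inj: "inj_on (\<lambda>u. {v, u}) {u \<in> set us. adj v u}"
      by (rule inj_onI) (auto simp: doubleton_eq_iff)
    have "msum (\<lambda>e. e) (set vs) ?E (\<lambda>_. 1) = (\<Sum>e\<in>?E. if v \<in> e \<and> e \<subseteq> set vs then 1 * msum (\<lambda>e. e) (set vs - e) ?E (\<lambda>_. 1) else 0)"
      by (rule msum_vertex) (auto simp: Cons)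
    also have "\<dots> = (\<Sum>e\<in>{e \<in> ?E. v \<in> e \<and> e \<subseteq> set vs}. msum (\<lambda>e. e) (set vs - e) ?E (\<lambda>_. 1))"
      by (simp only: sum.inter_filter[OF finite_class.finite] mult_1)
    also have "\<dots> = (\<Sum>u\<in>{u \<in> set us. adj v u}. msum (\<lambda>e. e) (set vs - {v, u}) ?E (\<lambda>_. 1))"
      unfolding eq by (simp add: sum.reindex[OF inj])
    also have "\<dots> = (\<Sum>u\<in>{u \<in> set us. adj v u}. real (count_matchings adj (remove1 u us)))"
    proof (rule sum.cong[OF refl])
      fix u assume u: "u \<in> {u \<in> set us. adj v u}"
      have "set vs - {v, u} = set (remove1 u us)" using d by (auto simp: Cons)
      moreover have "length (remove1 u us) < length vs" "distinct (remove1 u us)"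
        using d by (auto simp: Cons length_remove1)
      ultimately show "msum (\<lambda>e. e) (set vs - {v, u}) ?E (\<lambda>_. 1) = real (count_matchings adj (remove1 u us))"
        using 1 by auto
    qed
    also have "\<dots> = (\<Sum>u\<in>set us. if adj v u then real (count_matchings adj (remove1 u us)) else 0)"
      by (simp add: sum.inter_filter)
    also have "\<dots> = real (count_matchings adj vs)"
      using d by (simp add: Cons sum_list_distinct_conv_sum_set of_nat_sum if_distrib cong: if_cong)
    finally show ?thesis .
  qed
qed

type_synonym ladder_cell = "bool \<times> bool \<times> bool"

text \<open>The flags \<open>p\<close> and \<open>q\<close> say whether the square is east and north
  of the node. The cells with \<open>d\<close> are the ladder corners; they form end rungs across
  the axis that carries the new vertices.\<close>

fun ladder_adj :: "bool \<Rightarrow> ladder_cell \<Rightarrow> ladder_cell \<Rightarrow> bool" where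
  "ladder_adj h (p, q, d) (p', q', d') \<longleftrightarrow> p = p' \<and> q = q' \<and> d \<noteq> d' \<or>
     d = d' \<and> (q = q' \<and> p \<noteq> p' \<and> (d \<longrightarrow> \<not> h) \<or> p = p' \<and> q \<noteq> q' \<and> (d \<longrightarrow> h))"

definition ladder_edges :: "bool \<Rightarrow> ladder_cell set set" where
  "ladder_edges h = {{u, v} | u v. ladder_adj h u v}"

definition ladder_count :: "bool \<Rightarrow> (bool \<times> bool) set \<Rightarrow> real" where
  "ladder_count h S = msum (\<lambda>e. e) {(p, q, d). \<not> (d \<and> (p, q) \<in> S)} (ladder_edges h) (\<lambda>_. 1)"

lemma ladder_count_eq:
  "ladder_count h S = real (count_matchings (ladder_adj h) (filter (\<lambda>(p, q, d). \<not> (d \<and> (p, q) \<in> S))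
     [(True, True, False), (True, False, False), (False, True, False), (False, False, False),
      (True, True, True), (True, False, True), (False, True, True), (False, False, True)]))"
  (is "_ = real (count_matchings _ ?vs)")
proof -
  have "{(p, q, d). \<not> (d \<and> (p, q) \<in> S)} = set ?vs"
  proof (rule set_eqI)
    fix u :: ladder_cell
    obtain p q d where "u = (p, q, d)" by (rule prod_cases3)
    then show "u \<in> {(p, q, d). \<not> (d \<and> (p, q) \<in> S)} \<longleftrightarrow> u \<in> set ?vs"
      by (cases p; cases q; cases d) simp_all
  qed
  moreover have "msum (\<lambda>e. e) (set ?vs) (ladder_edges h) (\<lambda>_. 1) = real (count_matchings (ladder_adj h) ?vs)"
    unfolding ladder_edges_def by (rule msum_count_matchings) auto
  ultimately show ?thesis by (simp add: ladder_count_def)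
qed

text \<open>Without an end rung a ladder with three rungs remains (3 matchings), without both ends
  of a rail everything is forced (1), without all corners the inner 4-cycle remains (2). All other
  removals unbalance the bipartition.\<close>

lemma ladder_counts:
  defines "NE \<equiv> (True, True)" and "NW \<equiv> (False, True)" and "SE \<equiv> (True, False)" and "SW \<equiv> (False, False)"
  shows "ladder_count h {} = 5" "ladder_count h {NE, NW, SE, SW} = 2"
    "ladder_count h {NE, SE} = (if h then 3 else 1)" "ladder_count h {NW, SW} = (if h then 3 else 1)"
    "ladder_count h {NE, NW} = (if h then 1 else 3)" "ladder_count h {SE, SW} = (if h then 1 else 3)"
    "ladder_count h {NE, SW} = 0" "ladder_count h {NW, SE} = 0"
    "ladder_count h {NE} = 0" "ladder_count h {NW} = 0" "ladder_count h {SE} = 0" "ladder_count h {SW} = 0"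
    "ladder_count h {NW, SE, SW} = 0" "ladder_count h {NE, SE, SW} = 0" "ladder_count h {NE, NW, SW} = 0" "ladder_count h {NE, NW, SE} = 0"
  unfolding assms ladder_count_eq by (cases h; simp)+

section \<open>Ladders inside the subdivision\<close>

fun local_square :: "int \<times> int \<Rightarrow> bool \<times> bool \<Rightarrow> int \<times> int" where
  "local_square z (p, q) = (if p then fst z else fst z - 1, if q then snd z else snd z - 1)"

fun local_cell :: "int \<times> int \<Rightarrow> ladder_cell \<Rightarrow> cell" where
  "local_cell z (p, q, d) = (local_square z (p, q), even (fst z), d)"

definition gadget :: "int \<times> int \<Rightarrow> cell set" where
  "gadget z = {(f, b, d). cell_node f b = z}"

definition gadget_edges :: "int \<times> int \<Rightarrow> cell set set" where
  "gadget_edges z = {{c, c'} | c c'. cell_adj c c' \<and> c \<in> gadget z \<and> c' \<in> gadget z}"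

lemma cell_node_local_square:
  "odd (fst z + snd z) \<Longrightarrow> cell_node (local_square z (p, q)) (even (fst z)) = z"
  by (cases z) (auto simp: node_defs)

lemma cell_node_eqD: "cell_node f b = z \<Longrightarrow> \<exists>p q. f = local_square z (p, q) \<and> b = even (fst z)"
proof -
  assume *: "cell_node f b = z"
  obtain x y where f: "f = (x, y)" by fastforce
  show ?thesis
    using * by (intro exI[of _ "fst z = x"] exI[of _ "snd z = y"])
      (auto simp: f node_defs split: if_splits)
qed

lemma gadget_eq: "odd (fst z + snd z) \<Longrightarrow> gadget z = range (local_cell z)"
proof (intro equalityI subsetI)
  fix c assume "c \<in> gadget z"
  then obtain f b d where c: "c = (f, b, d)" "cell_node f b = z" by (auto simp: gadget_def)
  then obtain p q where "f = local_square z (p, q)" "b = even (fst z)" using cell_node_eqD by blast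
  then have "c = local_cell z (p, q, d)" by (simp add: c)
  then show "c \<in> range (local_cell z)" by blast
next
  fix c assume z: "odd (fst z + snd z)" and "c \<in> range (local_cell z)"
  then obtain u where "c = local_cell z u" by blast
  moreover obtain p q d where "u = (p, q, d)" by (rule prod_cases3)
  ultimately show "c \<in> gadget z"
    using cell_node_local_square[OF z, of p q] by (simp add: gadget_def del: local_square.simps)
qed

lemma inj_local_square: "inj (local_square z)"
  by (rule injI) (auto split: if_splits)

lemma inj_local_cell: "inj (local_cell z)"
  by (rule injI) (auto split: if_splits)

lemma cell_adj_local_cell:
  assumes "odd (fst z + snd z)"
  shows "cell_adj (local_cell z u) (local_cell z v) \<longleftrightarrow> ladder_adj (z \<in> first_nodes) u v"
proof -
  obtain p q d where u: "u = (p, q, d)" by (rule prod_cases3)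
  obtain p' q' d' where v: "v = (p', q', d')" by (rule prod_cases3)
  have n: "cell_node (local_square z (p, q)) (even (fst z)) = z" "cell_node (local_square z (p', q')) (even (fst z)) = z"
    using cell_node_local_square[OF assms] by blast+
  have eq: "local_square z (p, q) = local_square z (p', q') \<longleftrightarrow> p = p' \<and> q = q'"
    using inj_local_square[of z] by (auto simp: inj_eq simp del: local_square.simps)
  have f: "fst (local_square z (p, q)) = fst (local_square z (p', q')) \<longleftrightarrow> p = p'"
    "snd (local_square z (p, q)) = snd (local_square z (p', q')) \<longleftrightarrow> q = q'"
    by auto
  show ?thesis unfolding u v cell_adj_def local_cell.simps prod.case n eq f ladder_adj.simps by blast
qed

lemma gadget_edges_eq:
  assumes "odd (fst z + snd z)"
  shows "gadget_edges z = image (local_cell z) ` ladder_edges (z \<in> first_nodes)"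
proof (intro equalityI subsetI)
  fix e assume "e \<in> gadget_edges z"
  then obtain c c' where e: "e = {c, c'}" "cell_adj c c'" "c \<in> gadget z" "c' \<in> gadget z" unfolding gadget_edges_def by blast
  then obtain u v where uv: "c = local_cell z u" "c' = local_cell z v" unfolding gadget_eq[OF assms] by blast
  then have "ladder_adj (z \<in> first_nodes) u v" using e(2) cell_adj_local_cell[OF assms] by simp
  then have "{u, v} \<in> ladder_edges (z \<in> first_nodes)" unfolding ladder_edges_def by blast
  moreover have "e = local_cell z ` {u, v}" by (simp add: e(1) uv)
  ultimately show "e \<in> image (local_cell z) ` ladder_edges (z \<in> first_nodes)" by blast
next
  fix e assume "e \<in> image (local_cell z) ` ladder_edges (z \<in> first_nodes)"
  then obtain u v where "e = local_cell z ` {u, v}" "ladder_adj (z \<in> first_nodes) u v" unfolding ladder_edges_def by blast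
  then have "e = {local_cell z u, local_cell z v}" "cell_adj (local_cell z u) (local_cell z v)"
    using cell_adj_local_cell[OF assms] by simp_all
  then show "e \<in> gadget_edges z" unfolding gadget_edges_def gadget_eq[OF assms] by blast
qed

lemma image_restrict: "inj k \<Longrightarrow> {e \<in> image k ` L. e \<subseteq> k ` V} = image k ` {e \<in> L. e \<subseteq> V}"
  using inj_image_subset_iff[of k] by blast

lemma gadget_sum:
  assumes "odd (fst z + snd z)"
  shows "msum (\<lambda>e. e) (gadget z - {(f, b, d). d \<and> f \<in> Y}) (gadget_edges z) (\<lambda>_. 1)
    = ladder_count (z \<in> first_nodes) {u. local_square z u \<in> Y}"
proof -
  let ?V = "{(p, q, d). \<not> (d \<and> (p, q) \<in> {u. local_square z u \<in> Y})}"
  let ?L = "ladder_edges (z \<in> first_nodes)"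
  have V: "gadget z - {(f, b, d). d \<and> f \<in> Y} = local_cell z ` ?V"
    unfolding gadget_eq[OF assms] by (auto simp del: local_square.simps)
  have E: "{e \<in> gadget_edges z. e \<subseteq> local_cell z ` ?V} = image (local_cell z) ` {e \<in> ?L. e \<subseteq> ?V}"
    unfolding gadget_edges_eq[OF assms] by (rule image_restrict[OF inj_local_cell])
  have "msum (\<lambda>e. e) (local_cell z ` ?V) (image (local_cell z) ` {e \<in> ?L. e \<subseteq> ?V}) (\<lambda>_. 1) = msum (\<lambda>e. e) ?V {e \<in> ?L. e \<subseteq> ?V} (\<lambda>_. 1)"
    by (rule msum_image) (auto intro: inj_on_subset[OF inj_local_cell] inj_onI simp: inj_image_eq_iff[OF inj_local_cell])
  then have "msum (\<lambda>e. e) (local_cell z ` ?V) (gadget_edges z) (\<lambda>_. 1) = msum (\<lambda>e. e) ?V ?L (\<lambda>_. 1)"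
    using msum_restrict[of "\<lambda>e. e" "local_cell z ` ?V" "gadget_edges z"] msum_restrict[of "\<lambda>e. e" ?V ?L]
    unfolding E by simp
  then show ?thesis unfolding V ladder_count_def .
qed

definition odd_end :: "(int \<times> int) \<times> bool \<Rightarrow> int \<times> int" where
  "odd_end e = (case e of (f, h) \<Rightarrow>
     if odd (fst f + snd f) then f else if h then (fst f + 1, snd f) else (fst f, snd f + 1))"

text \<open>Every weight that occurs depends on the odd end of the edge and on its direction only.\<close>

definition edge_weight :: "bool \<Rightarrow> bool \<Rightarrow> (int \<times> int) \<times> bool \<Rightarrow> real" where
  "edge_weight k t e = (if even (fst (odd_end e)) = k then 5 else 2) * (if snd e = (odd_end e \<in> first_nodes) \<longleftrightarrow> t then 3 else 1)"

lemma edge_weight_odd_node: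
  assumes "odd (fst z + snd z)"
  shows "edge_weight k t (east z) = (if even (fst z) = k then 5 else 2) * (if z \<in> first_nodes \<longleftrightarrow> t then 3 else 1)"
    "edge_weight k t (west z) = (if even (fst z) = k then 5 else 2) * (if z \<in> first_nodes \<longleftrightarrow> t then 3 else 1)"
    "edge_weight k t (north z) = (if even (fst z) = k then 5 else 2) * (if z \<in> first_nodes \<longleftrightarrow> t then 1 else 3)"
    "edge_weight k t (south z) = (if even (fst z) = k then 5 else 2) * (if z \<in> first_nodes \<longleftrightarrow> t then 1 else 3)"
  using assms by (cases z; auto simp: edge_weight_def odd_end_def)+

text \<open>With the factor 5 the domino weights must be 3/5 and 1/5, and the full cycle is right
  since \<open>5 * (9/25 + 1/25) = 2\<close>. On complements with the factor 2 they must be 3/2 and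
  1/2, and \<open>2 * (9/4 + 1/4) = 5\<close>. The common denominator 10 leaves the integers 2 and 5
  times 3 or 1 of \<open>edge_weight\<close>.\<close>

lemma ladder_count_domino:
  assumes "odd (fst z + snd z)"
  shows "ladder_count (z \<in> first_nodes) {u. local_square z u \<in> Y} =
    (if even (fst z) then 5 * msum domino (node_squares z \<inter> Y) (node_edges z) (\<lambda>e. edge_weight False True e / 10)
     else 2 * msum domino (node_squares z - Y) (node_edges z) (\<lambda>e. edge_weight False True e / 10))"
proof -
  define S where "S = {u. local_square z u \<in> Y}"
  have U: "UNIV = {(True, True), (False, True), (True, False), (False, False)}" by auto
  have N: "node_squares z = range (local_square z)" unfolding U by (cases z) auto
  have "node_squares z \<inter> Y = local_square z ` S" "node_squares z - Y = local_square z ` (UNIV - S)"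
    unfolding N S_def by auto
  note sets = this[unfolded U]
  note L = node_local_sum[of z "\<lambda>e. edge_weight False True e / 10"]
  have "S \<subseteq> {(True, True), (False, True), (True, False), (False, False)}" using U by auto
  then have "ladder_count (z \<in> first_nodes) S =
    (if even (fst z) then 5 * msum domino (local_square z ` S) (node_edges z) (\<lambda>e. edge_weight False True e / 10)
     else 2 * msum domino (local_square z ` ({(True, True), (False, True), (True, False), (False, False)} - S)) (node_edges z) (\<lambda>e. edge_weight False True e / 10))"
    by (rule subset_four_cases) (simp_all add: insert_Diff_if ladder_counts L edge_weight_odd_node[OF assms])
  then show ?thesis unfolding sets S_def .
qed

section \<open>From the region to the Aztec diamond\<close>

definition crossing :: "int \<times> int \<Rightarrow> cell set" where
  "crossing f = {(f, True, True), (f, False, True)}"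

lemma inj_crossing: "inj crossing"
  by (rule injI) (auto simp: crossing_def doubleton_eq_iff)

lemma cell_adj_cases:
  assumes "cell_adj c c'"
  shows "(\<exists>z. c \<in> gadget z \<and> c' \<in> gadget z) \<or> (\<exists>f. {c, c'} = crossing f)"
proof -
  obtain f b d where c: "c = (f, b, d)" by (rule prod_cases3)
  obtain f' b' d' where c': "c' = (f', b', d')" by (rule prod_cases3)
  from assms consider "cell_node f b = cell_node f' b'" | "f = f'" "b \<noteq> b'" d d'
    unfolding cell_adj_def c c' prod.case by blast
  then show ?thesis
  proof cases
    case 1
    then show ?thesis by (auto simp: c c' gadget_def)
  next
    case 2
    then have "{c, c'} = crossing f" by (cases b) (auto simp: c c' crossing_def)
    then show ?thesis by blast
  qed
qed

lemma crossing_dual_edge: "crossing f \<in> dual_edges"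
  unfolding dual_edges_def crossing_def cell_adj_def by blast

lemma cell_node_in_nodes: "cell_node f b \<in> nodes n n \<longleftrightarrow> l1 n (cell_node f b) < int n"
  using odd_l1[of n f b] by (simp add: nodes_def)

lemma inner_squares:
  assumes "n > 0"
  shows "f \<in> squares n (n - 1) \<longleftrightarrow> l1 n (cell_node f True) < int n \<and> l1 n (cell_node f False) < int n"
  unfolding squares_pred_iff[OF assms] by (simp add: corner_def)

lemma region_iff:
  "(f, b, d) \<in> region n \<longleftrightarrow> cell_node f b \<in> nodes n n \<or> b \<and> d \<and> f \<in> pendant n"
  unfolding region_def cell_node_in_nodes pendant_def by auto

lemma pendant_not_node: "f \<in> pendant n \<Longrightarrow> cell_node f True \<notin> nodes n n"
  unfolding cell_node_in_nodes pendant_def by simp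

text \<open>In both coordinates a pendant square lies on the side of its outside node that faces the
  centre, so the node determines it. Hence no two pendant cells are adjacent, and each has only the
  partner across the frontier.\<close>

lemma pendant_node_inj:
  assumes "f \<in> pendant n" "f' \<in> pendant n" "cell_node f True = cell_node f' True"
  shows "f = f'"
proof -
  obtain x y where f: "f = (x, y)" by fastforce
  obtain x' y' where f': "f' = (x', y')" by fastforce
  have x: "x' = x \<or> x' = x + 1 \<and> odd x \<or> x = x' + 1 \<and> odd x'" and y: "y' = y \<or> y' = y + 1 \<and> even y \<or> y = y' + 1 \<and> even y'"
    using assms(3) by (auto simp: f f' node_defs split: if_splits)
  have g: "l1 n (cell_node f True) = int n + 1" "l1 n (cell_node f False) = int n - 1"
    "l1 n (cell_node f' True) = int n + 1" "l1 n (cell_node f' False) = int n - 1"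
    using assms by (auto simp: pendant_def)
  have d: "\<bar>even_of i - k\<bar> \<le> \<bar>odd_of i - k\<bar> + 1" "\<bar>odd_of i - k\<bar> \<le> \<bar>even_of i - k\<bar> + 1" for i k
    by (auto simp: even_of_def odd_of_def)
  have 1: "\<bar>odd_of x - int n\<bar> = \<bar>even_of x - int n\<bar> - 1" "\<bar>even_of y\<bar> = \<bar>odd_of y\<bar> - 1"
    "\<bar>odd_of x' - int n\<bar> = \<bar>even_of x' - int n\<bar> - 1" "\<bar>even_of y'\<bar> = \<bar>odd_of y'\<bar> - 1"
    using g d(1)[of x "int n"] d(1)[of x' "int n"] d(2)[of y 0] d(2)[of y' 0]
    by (simp_all add: f f' l1_def cell_node_def)
  have "x = x'" using x 1(1,3) by (auto simp: even_of_def odd_of_def split: if_splits)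
  moreover have "y = y'" using y 1(2,4) by (auto simp: even_of_def odd_of_def split: if_splits)
  ultimately show ?thesis by (simp add: f f')
qed

lemma region_edges:
  assumes n: "n > 0" and e: "e \<subseteq> region n"
  shows "e \<in> dual_edges \<longleftrightarrow> e \<in> (\<Union>z\<in>nodes n n. gadget_edges z) \<union> crossing ` (squares n (n - 1) \<union> pendant n)"
proof
  assume "e \<in> dual_edges"
  then obtain c c' where c: "e = {c, c'}" "cell_adj c c'" by (auto simp: dual_edges_def)
  from cell_adj_cases[OF c(2)] show "e \<in> (\<Union>z\<in>nodes n n. gadget_edges z) \<union> crossing ` (squares n (n - 1) \<union> pendant n)"
  proof (elim disjE exE)
    fix z assume z: "c \<in> gadget z \<and> c' \<in> gadget z"
    show ?thesis
    proof (cases "z \<in> nodes n n")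
      case True
      moreover have "e \<in> gadget_edges z" using z c unfolding gadget_edges_def by blast
      ultimately show ?thesis by blast
    next
      case False
      obtain f b d where f: "c = (f, b, d)" by (rule prod_cases3)
      obtain f' b' d' where f': "c' = (f', b', d')" by (rule prod_cases3)
      have "c \<in> region n" "c' \<in> region n" using e c(1) by auto
      then have "b \<and> d \<and> f \<in> pendant n" "b' \<and> d' \<and> f' \<in> pendant n"
        using z False by (auto simp: f f' region_iff gadget_def)
      moreover from this have "f = f'" using z pendant_node_inj[of f n f'] by (auto simp: f f' gadget_def)
      ultimately have "c = c'" by (simp add: f f')
      then show ?thesis using cell_adj_irrefl[OF c(2)] by simp
    qed
  next
    fix f assume f: "{c, c'} = crossing f"
    then have "(f, True, True) \<in> region n" "(f, False, True) \<in> region n" using e c(1) by (auto simp: crossing_def)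
    then have "f \<in> squares n (n - 1) \<union> pendant n"
      unfolding Un_iff inner_squares[OF n] by (auto simp: region_iff cell_node_in_nodes)
    then show ?thesis using f c(1) by blast
  qed
next
  assume "e \<in> (\<Union>z\<in>nodes n n. gadget_edges z) \<union> crossing ` (squares n (n - 1) \<union> pendant n)"
  moreover have "gadget_edges z \<subseteq> dual_edges" for z unfolding gadget_edges_def dual_edges_def by blast
  ultimately show "e \<in> dual_edges" using crossing_dual_edge by blast
qed

lemma nodes_odd: "z \<in> nodes n n \<Longrightarrow> odd (fst z + snd z)"
  by (simp add: in_nodes_iff)

lemma finite_pendant: "finite (pendant n)"
proof (rule finite_subset)
  show "pendant n \<subseteq> squares n n"
  proof
    fix f assume "f \<in> pendant n"
    then have "cell_node f False \<in> nodes n n" by (simp add: cell_node_in_nodes pendant_def)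
    moreover have "f \<in> node_squares (cell_node f False)"
      by (auto simp: node_squares_iff node_defs)
    ultimately show "f \<in> squares n n" unfolding squares_def by blast
  qed
qed (rule finite_squares)

lemma finite_gadget_edges: "odd (fst z + snd z) \<Longrightarrow> finite (gadget_edges z)"
  unfolding gadget_edges_eq by (intro finite_imageI) (rule finite)

text \<open>Once the squares whose diagonal is crossed by a tile are fixed, independent ladders
  remain, each without its corners in those squares.\<close>

lemma region_sum:
  assumes n: "n > 0"
  shows "msum (\<lambda>e. e) (region n) dual_edges (\<lambda>_. 1) =
    (\<Sum>Y\<in>Pow (squares n (n - 1)). \<Prod>z\<in>nodes n n. ladder_count (z \<in> first_nodes) {u. local_square z u \<in> Y \<union> pendant n})"
proof -
  let ?C = "nodes n n" and ?F = "squares n (n - 1)" and ?P = "pendant n"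
  let ?E1 = "\<Union>z\<in>?C. gadget_edges z" and ?E2 = "crossing ` (?F \<union> ?P)"
  let ?t = "\<lambda>Y. msum (\<lambda>e. e) (region n - \<Union>(crossing ` Y)) ?E1 (\<lambda>_. 1)"
  have fin: "finite ?E1" "finite ?E2" "finite (?F \<union> ?P)"
    using finite_nodes finite_gadget_edges nodes_odd finite_squares finite_pendant by auto
  have FP: "?F \<inter> ?P = {}" using inner_squares[OF n] by (auto simp: pendant_def)
  have dis: "?E1 \<inter> ?E2 = {}"
  proof -
    have "crossing f \<notin> gadget_edges z" for f z
    proof
      assume "crossing f \<in> gadget_edges z"
      then obtain c c' where "crossing f = {c, c'}" "c \<in> gadget z" "c' \<in> gadget z"
        unfolding gadget_edges_def by blast
      then have "crossing f \<subseteq> gadget z" by simp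
      then have "(f, True, True) \<in> gadget z" "(f, False, True) \<in> gadget z"
        unfolding crossing_def by simp_all
      then have "cell_node f True = cell_node f False" by (simp add: gadget_def)
      then show False using even_corner[of True f True] even_corner[of True f False] by (simp add: corner_def)
    qed
    then show ?thesis by blast
  qed
  have cr: "\<Union>(crossing ` Y) \<subseteq> region n" if "Y \<subseteq> ?F \<union> ?P" for Y
  proof -
    have "crossing f \<subseteq> region n" if f: "f \<in> ?F \<union> ?P" for f
      using f unfolding Un_iff inner_squares[OF n]
      by (auto simp: crossing_def region_iff cell_node_in_nodes pendant_def)
    then show ?thesis using that by blast
  qed
  have "msum (\<lambda>e. e) (region n) dual_edges (\<lambda>_. 1) = msum (\<lambda>e. e) (region n) (?E1 \<union> ?E2) (\<lambda>_. 1)"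
    using region_edges[OF n] by (rule msum_edges_cong)
  also have "\<dots> = (\<Sum>X\<in>{X. X \<subseteq> ?E2 \<and> \<Union>X \<subseteq> region n \<and> disjoint_family_on (\<lambda>e. e) X}.
      msum (\<lambda>e. e) (region n - \<Union>X) ?E1 (\<lambda>_. 1))"
    by (subst msum_split[OF fin(1,2) dis]) (auto simp: gadget_edges_def)
  also have "{X. X \<subseteq> ?E2 \<and> \<Union>X \<subseteq> region n \<and> disjoint_family_on (\<lambda>e. e) X} = (\<lambda>Y. crossing ` Y) ` Pow (?F \<union> ?P)"
  proof (intro equalityI subsetI)
    fix X assume "X \<in> (\<lambda>Y. crossing ` Y) ` Pow (?F \<union> ?P)"
    then obtain Y where Y: "X = crossing ` Y" "Y \<subseteq> ?F \<union> ?P" by blast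
    moreover have "disjoint_family_on (\<lambda>e. e) (crossing ` Y)"
      by (auto simp: disjoint_family_on_def crossing_def)
    ultimately show "X \<in> {X. X \<subseteq> ?E2 \<and> \<Union>X \<subseteq> region n \<and> disjoint_family_on (\<lambda>e. e) X}" using cr[OF Y(2)] by blast
  qed (auto simp: subset_image_iff)
  also have "(\<Sum>X\<in>(\<lambda>Y. crossing ` Y) ` Pow (?F \<union> ?P). msum (\<lambda>e. e) (region n - \<Union>X) ?E1 (\<lambda>_. 1)) = (\<Sum>Y\<in>Pow (?F \<union> ?P). ?t Y)"
    by (subst sum.reindex) (auto intro!: inj_onI simp: inj_image_eq_iff[OF inj_crossing])
  \<comment> \<open>A pendant cell can only be matched across the diagonal, so every pendant square
    must be crossed; all other choices contribute 0.\<close>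
  also have "\<dots> = (\<Sum>Y\<in>(\<lambda>Y. Y \<union> ?P) ` Pow ?F. ?t Y)"
  proof (rule sum.mono_neutral_right)
    show "finite (Pow (?F \<union> ?P))" using fin(3) by simp
    show "\<forall>Y\<in>Pow (?F \<union> ?P) - (\<lambda>Y. Y \<union> ?P) ` Pow ?F. ?t Y = 0"
    proof
      fix Y assume Y: "Y \<in> Pow (?F \<union> ?P) - (\<lambda>Y. Y \<union> ?P) ` Pow ?F"
      have "\<not> ?P \<subseteq> Y"
      proof
        assume "?P \<subseteq> Y"
        then have "Y = (Y \<inter> ?F) \<union> ?P" using Y by blast
        then show False using Y by blast
      qed
      then obtain f where f: "f \<in> ?P" "f \<notin> Y" by blast
      show "?t Y = 0"
      proof (rule msum_uncovered)
        show "(f, True, True) \<in> region n - \<Union>(crossing ` Y)" using f by (auto simp: region_iff crossing_def)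
        show "(f, True, True) \<notin> e" if "e \<in> ?E1" for e
          using that pendant_not_node[OF f(1)] by (auto simp: gadget_edges_def gadget_def)
      qed
    qed
  qed auto
  also have "\<dots> = (\<Sum>Y\<in>Pow ?F. ?t (Y \<union> ?P))"
    using FP by (subst sum.reindex) (auto intro!: inj_onI)
  also have "\<dots> = (\<Sum>Y\<in>Pow ?F. \<Prod>z\<in>?C. ladder_count (z \<in> first_nodes) {u. local_square z u \<in> Y \<union> ?P})"
  proof (rule sum.cong[OF refl])
    fix Y assume Y: "Y \<in> Pow ?F"
    let ?V = "\<lambda>z. gadget z - {(f, b, d). d \<and> f \<in> Y \<union> ?P}"
    have V: "region n - \<Union>(crossing ` (Y \<union> ?P)) = (\<Union>z\<in>?C. ?V z)"
    proof (rule set_eqI)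
      fix c :: cell
      obtain f b d where c: "c = (f, b, d)" by (rule prod_cases3)
      have "c \<in> \<Union>(crossing ` (Y \<union> ?P)) \<longleftrightarrow> d \<and> f \<in> Y \<union> ?P" by (auto simp: c crossing_def)
      then show "c \<in> region n - \<Union>(crossing ` (Y \<union> ?P)) \<longleftrightarrow> c \<in> (\<Union>z\<in>?C. ?V z)"
        by (auto simp: c region_iff gadget_def)
    qed
    have "?t (Y \<union> ?P) = (\<Prod>z\<in>?C. msum (\<lambda>e. e) (?V z) (gadget_edges z) (\<lambda>_. 1))"
      unfolding V
    proof (rule msum_UN'[where G = gadget])
      show "disjoint_family_on gadget ?C" by (auto simp: disjoint_family_on_def gadget_def)
    qed (use finite_nodes finite_gadget_edges nodes_odd in \<open>auto simp: gadget_edges_def\<close>)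
    also have "\<dots> = (\<Prod>z\<in>?C. ladder_count (z \<in> first_nodes) {u. local_square z u \<in> Y \<union> ?P})"
      by (intro prod.cong refl gadget_sum nodes_odd)
    finally show "?t (Y \<union> ?P) = (\<Prod>z\<in>?C. ladder_count (z \<in> first_nodes) {u. local_square z u \<in> Y \<union> ?P})" .
  qed
  finally show ?thesis .
qed

lemma T_Q_eq_aztec:
  assumes n: "n > 0"
  shows "real (T (Q n)) = (\<Prod>z\<in>nodes n n. if even (fst z) then 5 else 2) * aztec n (n - 1) (\<lambda>e. edge_weight False True e / 10)"
proof -
  let ?C = "nodes n n" and ?F = "squares n (n - 1)" and ?P = "pendant n"
  let ?w = "\<lambda>e. edge_weight False True e / 10"
  let ?G = "\<lambda>z S. msum domino S (node_edges z) ?w"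
  let ?S = "\<lambda>z Y. {f \<in> ?F \<inter> node_squares z. f \<in> ?F \<longrightarrow> (f \<in> Y \<longleftrightarrow> even (fst z))}"
  have "real (T (Q n)) = msum (\<lambda>e. e) (region n) dual_edges (\<lambda>_. 1)"
    unfolding Q_eq[OF n] T_cells_union msum_def by simp
  also have "\<dots> = (\<Sum>Y\<in>Pow ?F. \<Prod>z\<in>?C. ladder_count (z \<in> first_nodes) {u. local_square z u \<in> Y \<union> ?P})"
    by (rule region_sum[OF n])
  also have "\<dots> = (\<Sum>Y\<in>Pow ?F. \<Prod>z\<in>?C. (if even (fst z) then 5 else 2) *
      ?G z (?S z Y))"
  proof (intro sum.cong prod.cong refl)
    fix Y z assume Y: "Y \<in> Pow ?F" and z: "z \<in> ?C"
    have node: "z = cell_node f (even (fst z))" if "f \<in> node_squares z" for f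
      using that corner_iff[of f z True] nodes_odd[OF z]
      by (auto simp: corner_def node_defs split: if_splits)
    \<comment> \<open>A pendant square has its (even, odd) corner outside, so none lies at an inside
      node with even first coordinate.\<close>
    have A: "node_squares z \<inter> (Y \<union> ?P) = ?S z Y" if "even (fst z)"
    proof -
      have "?P \<inter> node_squares z = {}" using node that z pendant_not_node by fastforce
      then show ?thesis using that Y by auto
    qed
    \<comment> \<open>At these nodes the squares without a second inside node are exactly the
      pendant ones, so the complement discards them.\<close>
    have B: "node_squares z - (Y \<union> ?P) = ?S z Y" if z': "odd (fst z)"
    proof -
      have "f \<in> ?P \<longleftrightarrow> f \<notin> ?F" if f: "f \<in> node_squares z" for f
      proof -
        have "cell_node f False \<in> nodes n n" using node[OF f] z z' by simp
        then have b: "l1 n (cell_node f False) < int n" by (simp add: cell_node_in_nodes)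
        have "l1 n (cell_node f True) \<le> l1 n (cell_node f False) + 2"
          using slope_cases[of 0 "snd f"] slope_cases[of n "fst f"] by (auto simp: l1_cell_node)
        moreover have "l1 n (cell_node f True) \<noteq> int n" using odd_l1[of n f True] by auto
        ultimately show ?thesis using b unfolding pendant_def inner_squares[OF n] by auto
      qed
      then show ?thesis using z' by auto
    qed
    show "ladder_count (z \<in> first_nodes) {u. local_square z u \<in> Y \<union> ?P} = (if even (fst z) then 5 else 2) *
      ?G z (?S z Y)"
      unfolding ladder_count_domino[OF nodes_odd[OF z]] using A B by simp
  qed
  also have "\<dots> = (\<Prod>z\<in>?C. if even (fst z) then 5 else 2) * (\<Sum>Y\<in>Pow ?F. \<Prod>z\<in>?C.
      ?G z (?S z Y))"
    by (simp add: prod.distrib sum_distrib_left)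
  \<comment> \<open>Every square of order \<open>n - 1\<close> has two inside nodes, and
    \<open>Y\<close> records which squares go to the one with even first coordinate.\<close>
  also have "(\<Sum>Y\<in>Pow ?F. \<Prod>z\<in>?C. ?G z (?S z Y))
      = aztec n (n - 1) ?w"
    unfolding aztec_group[OF squares_mono[of n n]]
  proof (rule sum_two_colouring[symmetric, where \<alpha> = "\<lambda>f. cell_node f True" and \<beta> = "\<lambda>f. cell_node f False"])
    fix f assume "f \<in> ?F"
    then have l: "l1 n (cell_node f True) < int n" "l1 n (cell_node f False) < int n" using inner_squares[OF n] by blast+
    have "{c \<in> ?C. f \<in> node_squares c} = {z. l1 n z < int n \<and> (z = cell_node f True \<or> z = cell_node f False)}"
      unfolding nodes_square_iff by (simp add: corner_def)
    also have "\<dots> = {cell_node f True, cell_node f False}" using l by auto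
    finally have "{c \<in> ?C. f \<in> node_squares c} = {cell_node f True, cell_node f False}" .
    moreover have "even (fst (cell_node f True))" "\<not> even (fst (cell_node f False))"
      by (auto simp: node_defs)
    ultimately show "{c \<in> ?C. f \<in> node_squares c} = {cell_node f True, cell_node f False} \<and> even (fst (cell_node f True)) \<and> \<not> even (fst (cell_node f False))"
      by blast
  qed (use finite_nodes finite_squares node_edges_uncovered in auto)
  finally show ?thesis .
qed

section \<open>Evaluation\<close>

text \<open>Diagonal coordinates turn the nodes into an \<open>m\<close> by \<open>m\<close>
  grid.\<close>

lemma prod_nodes:
  fixes h :: "int \<times> int \<Rightarrow> real"
  shows "(\<Prod>z\<in>nodes n m. h z) = (\<Prod>i<m. \<Prod>j<m. h (int n - int m + 1 + int i + int j, int i - int j))"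
proof -
  let ?f = "\<lambda>(i, j). (int n - int m + 1 + int i + int j, int i - int j)"
  have inj: "inj_on ?f ({..<m} \<times> {..<m})" by (rule inj_onI) auto
  have "nodes n m = ?f ` ({..<m} \<times> {..<m})"
  proof (intro equalityI subsetI)
    fix z assume z: "z \<in> nodes n m"
    obtain x y where xy: "z = (x, y)" by fastforce
    have l: "\<bar>x - int n\<bar> + \<bar>y\<bar> < int m" "odd (x + y + int n + int m)"
      using z parity_l1[of n z] by (auto simp: nodes_def xy l1_def)
    define a where "a = (x + y - (int n - int m + 1)) div 2"
    define b where "b = (x - y - (int n - int m + 1)) div 2"
    have "even (x + y - (int n - int m + 1))" "even (x - y - (int n - int m + 1))" using l(2) by presburger+
    then have ab: "2 * a = x + y - (int n - int m + 1)" "2 * b = x - y - (int n - int m + 1)"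
      by (simp_all add: a_def b_def)
    then have "0 \<le> a" "a < int m" "0 \<le> b" "b < int m" using l(1) by linarith+
    moreover from this have "z = ?f (nat a, nat b)" using ab by (simp add: xy)
    ultimately show "z \<in> ?f ` ({..<m} \<times> {..<m})" by (intro image_eqI[of _ _ "(nat a, nat b)"]) auto
  next
    fix z assume "z \<in> ?f ` ({..<m} \<times> {..<m})"
    then obtain i j where ij: "i < m" "j < m" and z: "z = (int n - int m + 1 + int i + int j, int i - int j)" by auto
    have "l1 n z < int m" using ij unfolding z l1_def fst_conv snd_conv by linarith
    moreover have "fst z + snd z + int n + int m = 2 * (int n + int i) + 1" by (simp add: z)
    then have "odd (fst z + snd z + int n + int m)" by presburger
    then have "odd (l1 n z + int m)" using parity_l1[of n z] by simp
    ultimately show "z \<in> nodes n m" by (simp add: nodes_def)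
  qed
  then show ?thesis by (simp add: prod.reindex[OF inj[unfolded case_prod_unfold]] prod.cartesian_product case_prod_unfold)
qed

text \<open>In diagonal coordinates the pattern becomes simple: it alternates with \<open>j\<close>
  and changes its phase with period 4 in \<open>i\<close>. Each of the eight listed families is one
  pair of residues modulo 4.\<close>

lemma first_nodes_iff:
  "(1 + i + j, i - j) \<in> first_nodes \<longleftrightarrow> (odd j \<longleftrightarrow> i mod 4 = 0 \<or> i mod 4 = 3)"
proof -
  have e: "(\<exists>k l. 1 + i + j = 8 * k + 4 * l + 5 \<and> i - j = 4 * l) \<longleftrightarrow> i mod 4 = 2 \<and> j mod 4 = 2"
    "(\<exists>k l. 1 + i + j = 8 * k + 4 * l + 7 \<and> i - j = 4 * l) \<longleftrightarrow> i mod 4 = 3 \<and> j mod 4 = 3"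
    "(\<exists>k l. 1 + i + j = 8 * k + 4 * l \<and> i - j = 4 * l + 1) \<longleftrightarrow> i mod 4 = 0 \<and> j mod 4 = 3"
    "(\<exists>k l. 1 + i + j = 8 * k + 4 * l + 2 \<and> i - j = 4 * l + 1) \<longleftrightarrow> i mod 4 = 1 \<and> j mod 4 = 0"
    "(\<exists>k l. 1 + i + j = 8 * k + 4 * l + 3 \<and> i - j = 4 * l + 2) \<longleftrightarrow> i mod 4 = 2 \<and> j mod 4 = 0"
    "(\<exists>k l. 1 + i + j = 8 * k + 4 * l + 5 \<and> i - j = 4 * l + 2) \<longleftrightarrow> i mod 4 = 3 \<and> j mod 4 = 1"
    "(\<exists>k l. 1 + i + j = 8 * k + 4 * l + 6 \<and> i - j = 4 * l + 3) \<longleftrightarrow> i mod 4 = 0 \<and> j mod 4 = 1"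
    "(\<exists>k l. 1 + i + j = 8 * k + 4 * l \<and> i - j = 4 * l + 3) \<longleftrightarrow> i mod 4 = 1 \<and> j mod 4 = 2"
    by presburger+
  have "(1 + i + j, i - j) \<in> first_nodes \<longleftrightarrow>
     i mod 4 = 2 \<and> j mod 4 = 2 \<or> i mod 4 = 3 \<and> j mod 4 = 3 \<or> i mod 4 = 0 \<and> j mod 4 = 3 \<or> i mod 4 = 1 \<and> j mod 4 = 0 \<or>
     i mod 4 = 2 \<and> j mod 4 = 0 \<or> i mod 4 = 3 \<and> j mod 4 = 1 \<or> i mod 4 = 0 \<and> j mod 4 = 1 \<or> i mod 4 = 1 \<and> j mod 4 = 2"
    unfolding first_nodes_def e[symmetric] by (simp only: UN_iff insert_iff empty_iff prod.inject UNIV_I bex_UNIV ex_disj_distrib simp_thms disj_assoc)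
  also have "\<dots> \<longleftrightarrow> (odd j \<longleftrightarrow> i mod 4 = 0 \<or> i mod 4 = 3)" by presburger
  finally show ?thesis .
qed

text \<open>The exponent of 3 in the product of the cell factors of one diagonal row. Here
  \<open>s\<close> is the row number shifted by the number of completed pairs of renewals;
  \<open>node_exponent\<close> is the share of one node.\<close>

definition row_exponent :: "nat \<Rightarrow> nat \<Rightarrow> nat" where
  "row_exponent s m = (if s mod 4 = 0 then 2 * (m div 2) else if s mod 4 = 2 then 2 * ((m + 1) div 2) else m)"

definition node_exponent :: "nat \<Rightarrow> nat \<Rightarrow> nat" where
  "node_exponent s j = (if s mod 4 = 0 then (if even j then 0 else 2) else if s mod 4 = 2 then (if even j then 2 else 0) else 1)"

lemma sum_node_exponent: "(\<Sum>j<m. node_exponent s j) = row_exponent s m"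
  by (induction m) (auto simp: node_exponent_def row_exponent_def)

lemma alternate_prod:
  fixes a b :: real
  shows "(\<Prod>j<m. if even (j + s) then a else b) = (a * b) ^ (m div 2) * (if even m then 1 else if even s then a else b)"
  by (induction m) auto

text \<open>Both colours of a chessboard are equally frequent for even \<open>m\<close>; for odd
  \<open>m\<close> the colour of the corner occurs once more.\<close>

lemma checkerboard_prod:
  fixes a b :: real
  shows "(\<Prod>i<m. \<Prod>j<m. if even (i + j + k) then a else b) =
    (if even m then (a * b) ^ (m * (m div 2)) else (a * b) ^ ((m + 1) * (m div 2)) * (if even k then a else b))"
proof -
  have "(\<Prod>i<m. \<Prod>j<m. if even (i + j + k) then a else b) = (\<Prod>i<m. \<Prod>j<m. if even (j + (i + k)) then a else b)"
    by (simp add: ac_simps)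
  also have "\<dots> = (\<Prod>i<m. (a * b) ^ (m div 2) * (if even m then 1 else if even (i + k) then a else b))"
    unfolding alternate_prod ..
  also have "\<dots> = ((a * b) ^ (m div 2)) ^ m * (\<Prod>i<m. if even m then 1 else if even (i + k) then a else b)"
    by (simp add: prod.distrib)
  also have "\<dots> = (if even m then (a * b) ^ (m * (m div 2)) else (a * b) ^ ((m + 1) * (m div 2)) * (if even k then a else b))"
  proof (cases "even m")
    case True
    then show ?thesis by (simp add: power_mult[symmetric] mult.commute)
  next
    case False
    then have "(\<Prod>i<m. if even m then 1 else if even (i + k) then a else b) = (a * b) ^ (m div 2) * (if even k then a else b)"
      using alternate_prod[where s = k and m = m and a = a and b = b] by simp
    then show ?thesis using False by (simp only: if_False) (simp add: power_mult[symmetric] power_add mult.commute)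
  qed
  finally show ?thesis .
qed

section \<open>Action of the renewals on the weights\<close>

lemma even_node_weights:
  fixes a b :: int and k :: bool
  defines "z \<equiv> (a + b, a - b)"
    and "e \<equiv> (odd b \<longleftrightarrow> a mod 4 = 0 \<or> a mod 4 = 3)" and "f \<equiv> (even b \<longleftrightarrow> a mod 4 = 0 \<or> a mod 4 = 1)"
    and "p \<equiv> (if odd (a + b) = k then 5 else 2 :: real)" and "q \<equiv> (if even (a + b) = k then 5 else 2 :: real)"
  shows "edge_weight k t (east z) = p * (if e = t then 3 else 1)" "edge_weight k t (west z) = p * (if f = t then 3 else 1)"
    "edge_weight k t (north z) = q * (if e = t then 3 else 1)" "edge_weight k t (south z) = q * (if f = t then 3 else 1)"
proof -
  have m: "(a - 1) mod 4 = 0 \<longleftrightarrow> a mod 4 = 1" "(a - 1) mod 4 = 3 \<longleftrightarrow> a mod 4 = 0" by presburger+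
  have F: "(1 + a + b, a - b) \<in> first_nodes \<longleftrightarrow> e" "(1 + (a - 1) + (b - 1), (a - 1) - (b - 1)) \<in> first_nodes \<longleftrightarrow> f"
    "(1 + a + (b - 1), a - (b - 1)) \<in> first_nodes \<longleftrightarrow> \<not> e" "(1 + (a - 1) + b, (a - 1) - b) \<in> first_nodes \<longleftrightarrow> \<not> f"
    unfolding first_nodes_iff m e_def f_def by auto
  have "odd_end (east z) = (1 + a + b, a - b)" "odd_end (west z) = (1 + (a - 1) + (b - 1), (a - 1) - (b - 1))"
    "odd_end (north z) = (1 + a + (b - 1), a - (b - 1))" "odd_end (south z) = (1 + (a - 1) + b, (a - 1) - b)"
    by (auto simp: odd_end_def z_def)
  then show "edge_weight k t (east z) = p * (if e = t then 3 else 1)" "edge_weight k t (west z) = p * (if f = t then 3 else 1)"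
    "edge_weight k t (north z) = q * (if e = t then 3 else 1)" "edge_weight k t (south z) = q * (if f = t then 3 else 1)"
    unfolding edge_weight_def using F by (auto simp: p_def q_def)
qed

text \<open>East and north share a factor \<open>\<alpha>\<close>, west and south a factor
  \<open>\<beta>\<close>, each 1 or 3; east and west carry one of the numbers 5 and 2, north and
  south the other. So the cell factor is \<open>29 * \<alpha> * \<beta>\<close> up to the scalar.
  Renewal replaces \<open>\<alpha>\<close> by a multiple of \<open>3 / \<alpha>\<close>, which
  interchanges 1 and 3, flips \<open>t\<close>, and accounts for 87 = 29 * 3.\<close>

lemma renew_even_node:
  fixes a b :: int
  assumes "\<rho> > 0"
  defines "z \<equiv> (a + b, a - b)"
    and "e \<equiv> (odd b \<longleftrightarrow> a mod 4 = 0 \<or> a mod 4 = 3)" and "f \<equiv> (even b \<longleftrightarrow> a mod 4 = 0 \<or> a mod 4 = 1)"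
  shows "cell_factor (\<lambda>e. \<rho> * edge_weight k (\<not> k) e) z = \<rho>\<^sup>2 * (29 * (if e = k then 1 else 3) * (if f = k then 1 else 3))"
    and "renewed (\<lambda>e. \<rho> * edge_weight k (\<not> k) e) (\<lambda>e. 1 / (87 * \<rho>) * edge_weight k k e) z"
proof -
  note W = even_node_weights[where a = a and b = b and k = k, folded z_def e_def f_def]
  show cf: "cell_factor (\<lambda>e. \<rho> * edge_weight k (\<not> k) e) z = \<rho>\<^sup>2 * (29 * (if e = k then 1 else 3) * (if f = k then 1 else 3))"
    unfolding cell_factor_def W by (cases "even (a + b)"; cases k; cases e; cases f) (simp_all add: power2_eq_square)
  show "renewed (\<lambda>e. \<rho> * edge_weight k (\<not> k) e) (\<lambda>e. 1 / (87 * \<rho>) * edge_weight k k e) z"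
    unfolding renewed_def cf W using assms(1)
    by (cases "even (a + b)"; cases k; cases e; cases f) (simp_all add: power2_eq_square)
qed

text \<open>Opposite edges have equal weights, \<open>3 * c\<close> and \<open>c\<close> with
  \<open>c\<close> equal to 5 or 2, so the factor is \<open>10 * c\<^sup>2\<close>. Dividing by it
  turns \<open>c\<close> into \<open>1 / (10 * c)\<close>, which is 1/100 of the other number
  because 5 * 2 = 10. Thus \<open>k\<close> flips and \<open>t\<close> stays.\<close>

lemma renew_odd_node:
  assumes "\<sigma> > 0" "odd (fst z + snd z)"
  shows "cell_factor (\<lambda>e. \<sigma> * edge_weight k t e) z = \<sigma>\<^sup>2 * (if even (fst z) = k then 250 else 40)"
    and "renewed (\<lambda>e. \<sigma> * edge_weight k t e) (\<lambda>e. 1 / (100 * \<sigma>) * edge_weight (\<not> k) t e) z"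
proof -
  note W = edge_weight_odd_node[OF assms(2)]
  show cf: "cell_factor (\<lambda>e. \<sigma> * edge_weight k t e) z = \<sigma>\<^sup>2 * (if even (fst z) = k then 250 else 40)"
    unfolding cell_factor_def W by (cases "even (fst z)"; cases k; cases t; cases "z \<in> first_nodes") (simp_all add: power2_eq_square)
  show "renewed (\<lambda>e. \<sigma> * edge_weight k t e) (\<lambda>e. 1 / (100 * \<sigma>) * edge_weight (\<not> k) t e) z"
    unfolding renewed_def cf W using assms(1)
    by (cases "even (fst z)"; cases k; cases t; cases "z \<in> first_nodes") (simp_all add: power2_eq_square)
qed

lemma aztec_even_step:
  assumes n: "n = m + 1 + 2 * k" and m: "m > 0" and "\<rho> > 0"
  shows "aztec n m (\<lambda>e. \<rho> * edge_weight (odd k) (even k) e) =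
    (\<rho>\<^sup>2 * 29) ^ (m * m) * 3 ^ (\<Sum>i<m. row_exponent (i + k) m) * aztec n (m - 1) (\<lambda>e. 1 / (87 * \<rho>) * edge_weight (odd k) (odd k) e)"
proof -
  let ?w = "\<lambda>e. \<rho> * edge_weight (odd k) (even k) e"
  have red: "aztec n m ?w = (\<Prod>z\<in>nodes n m. cell_factor ?w z) * aztec n (m - 1) (\<lambda>e. 1 / (87 * \<rho>) * edge_weight (odd k) (odd k) e)"
  proof (rule aztec_reduce[OF m])
    fix z assume "z \<in> nodes n m"
    then have "even (fst z + snd z)" using n by (simp add: in_nodes_iff)
    then obtain a where a: "fst z + snd z = 2 * a" by (rule evenE)
    then have "z = (a + (fst z - a), a - (fst z - a))" by (simp add: prod_eq_iff)
    then show "renewed ?w (\<lambda>e. 1 / (87 * \<rho>) * edge_weight (odd k) (odd k) e) z"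
      using renew_even_node(2)[OF assms(3), of "odd k" a "fst z - a"] by simp
  qed
  have cf: "cell_factor ?w (int n - int m + 1 + int i + int j, int i - int j) = \<rho>\<^sup>2 * 29 * 3 ^ node_exponent (i + k) j" for i j
  proof -
    \<comment> \<open>Each completed pair of renewals shifts both diagonal coordinates by 1. The
      shift of \<open>?b\<close> is absorbed by the flag \<open>odd k\<close>, so only the row
      number \<open>i + k\<close> remains.\<close>
    let ?a = "int (i + k + 1)" and ?b = "int (j + k + 1)"
    have z: "(int n - int m + 1 + int i + int j, int i - int j) = (?a + ?b, ?a - ?b)" using n by simp
    have s: "?a mod 4 = 0 \<longleftrightarrow> (i + k) mod 4 = 3" "?a mod 4 = 3 \<longleftrightarrow> (i + k) mod 4 = 2" "?a mod 4 = 1 \<longleftrightarrow> (i + k) mod 4 = 0"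
      by presburger+
    have c: "(i + k) mod 4 = 0 \<or> (i + k) mod 4 = 1 \<or> (i + k) mod 4 = 2 \<or> (i + k) mod 4 = 3" by presburger
    show ?thesis unfolding z using renew_even_node(1)[OF assms(3), of "odd k" ?a ?b] c
      unfolding s by (auto simp: node_exponent_def)
  qed
  have "(\<Prod>z\<in>nodes n m. cell_factor ?w z) = (\<Prod>i<m. (\<rho>\<^sup>2 * 29) ^ m * 3 ^ row_exponent (i + k) m)"
    unfolding prod_nodes cf by (simp add: prod.distrib power_sum[symmetric] sum_node_exponent)
  also have "\<dots> = (\<rho>\<^sup>2 * 29) ^ (m * m) * 3 ^ (\<Sum>i<m. row_exponent (i + k) m)"
    by (simp add: prod.distrib power_sum power_mult)
  finally show ?thesis unfolding red by simp
qed

lemma aztec_odd_step: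
  assumes n: "n = m + 2 + 2 * k" and m: "m > 0" and "\<sigma> > 0"
  shows "aztec n m (\<lambda>e. \<sigma> * edge_weight (odd k) (odd k) e) =
    (\<sigma>\<^sup>2) ^ (m * m) * (\<Prod>i<m. \<Prod>j<m. if even (i + j + k) then 250 else 40) * aztec n (m - 1) (\<lambda>e. 1 / (100 * \<sigma>) * edge_weight (even k) (odd k) e)"
proof -
  let ?w = "\<lambda>e. \<sigma> * edge_weight (odd k) (odd k) e"
  have odd: "odd (fst z + snd z)" if "z \<in> nodes n m" for z using that n by (simp add: in_nodes_iff)
  have red: "aztec n m ?w = (\<Prod>z\<in>nodes n m. cell_factor ?w z) * aztec n (m - 1) (\<lambda>e. 1 / (100 * \<sigma>) * edge_weight (even k) (odd k) e)"
    by (rule aztec_reduce[OF m]) (use renew_odd_node(2)[OF assms(3) odd, of _ "odd k" "odd k"] in simp)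
  have "(\<Prod>z\<in>nodes n m. cell_factor ?w z) = (\<Prod>z\<in>nodes n m. \<sigma>\<^sup>2 * (if even (fst z) = odd k then 250 else 40))"
    by (intro prod.cong refl renew_odd_node(1)[OF assms(3) odd])
  also have "\<dots> = (\<Prod>i<m. \<Prod>j<m. \<sigma>\<^sup>2 * (if even (i + j + k) then 250 else 40))"
    unfolding prod_nodes using n by (intro prod.cong refl) auto
  also have "\<dots> = (\<sigma>\<^sup>2) ^ (m * m) * (\<Prod>i<m. \<Prod>j<m. if even (i + j + k) then 250 else 40)"
    by (simp add: prod.distrib power_mult)
  finally show ?thesis unfolding red by simp
qed

text \<open>For odd \<open>m\<close> the exponent of a row falls short of \<open>m\<close> in rows 0 modulo 4 and exceeds it in rows 2
  modulo 4; \<open>half_drift\<close> accumulates these deviations, and \<open>drift\<close> sums them once more over the renewal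
  steps.\<close>

definition half_drift :: "nat \<Rightarrow> int" where
  "half_drift s = (if s mod 4 = 1 \<or> s mod 4 = 2 then -1 else 0)"

text \<open>The deviation from \<open>m\<close> is a difference of values of
  \<open>half_drift\<close>, so that sums over rows telescope.\<close>

lemma row_exponent_odd:
  assumes "odd m"
  shows "int (row_exponent s m) = int m + half_drift (s + 1) - half_drift s"
proof -
  have c: "s mod 4 = 0 \<and> (s + 1) mod 4 = 1 \<or> s mod 4 = 1 \<and> (s + 1) mod 4 = 2 \<or> s mod 4 = 2 \<and> (s + 1) mod 4 = 3 \<or> s mod 4 = 3 \<and> (s + 1) mod 4 = 0"
    by presburger
  obtain q where "m = 2 * q + 1" using assms by (rule oddE)
  then show ?thesis using c by (auto simp: row_exponent_def half_drift_def)
qed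

lemma row_exponent_even: "even m \<Longrightarrow> row_exponent s m = m"
  by (auto simp: row_exponent_def)

lemma sum_row_exponent_odd:
  assumes "odd m"
  shows "int (\<Sum>i<l. row_exponent (i + k) m) = int l * int m + half_drift (k + l) - half_drift k"
  by (induction l) (simp_all add: row_exponent_odd[OF assms] algebra_simps)

definition drift :: "nat \<Rightarrow> int" where
  "drift s = (\<Sum>u<s. half_drift u)"

lemma drift_Suc: "drift (Suc s) = drift s + half_drift s"
  by (simp add: drift_def)

text \<open>Products of powers whose exponents are polynomials are compared through their logarithms.\<close>

lemma eq_if_ln_eq: "0 < a \<Longrightarrow> 0 < b \<Longrightarrow> ln a = ln b \<Longrightarrow> a = (b::real)"
  by simp

lemma ln_constants: "ln (87::real) = ln 29 + ln 3" (is ?a) "ln (100::real) = 2 * ln 10" (is ?b) "ln (10000::real) = 4 * ln 10" (is ?c)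
proof -
  have "(87::real) = 29 * 3" "(100::real) = 10 ^ 2" "(10000::real) = 10 ^ 4" by simp_all
  then show ?a ?b ?c
    by (simp_all only: ln_mult ln_realpow) simp_all
qed

text \<open>The scalar passes from \<open>\<rho>\<close> through \<open>1 / (87 * \<rho>)\<close> to
  \<open>87 * \<rho> / 100\<close>; both flags have flipped, which is their form for
  \<open>Suc k\<close>.\<close>

lemma aztec_two_steps:
  assumes n: "n = m + 2 + 2 * k" and m: "m > 0" and \<rho>: "\<rho> > 0"
  shows "aztec n (m + 1) (\<lambda>e. \<rho> * edge_weight (odd k) (even k) e) =
    (\<rho>\<^sup>2 * 29) ^ ((m + 1) * (m + 1)) * 3 ^ (\<Sum>i<m + 1. row_exponent (i + k) (m + 1)) *
    (((1 / (87 * \<rho>))\<^sup>2) ^ (m * m) * (\<Prod>i<m. \<Prod>j<m. if even (i + j + k) then 250 else 40) *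
     aztec n (m - 1) (\<lambda>e. (87 * \<rho> / 100) * edge_weight (odd (Suc k)) (even (Suc k)) e))"
proof -
  have "1 / (87 * \<rho>) > 0" using \<rho> by simp
  from aztec_odd_step[OF n m this]
  have "aztec n m (\<lambda>e. 1 / (87 * \<rho>) * edge_weight (odd k) (odd k) e) =
    ((1 / (87 * \<rho>))\<^sup>2) ^ (m * m) * (\<Prod>i<m. \<Prod>j<m. if even (i + j + k) then 250 else 40) *
     aztec n (m - 1) (\<lambda>e. (87 * \<rho> / 100) * edge_weight (odd (Suc k)) (even (Suc k)) e)"
    by simp
  then show ?thesis using aztec_even_step[of n "m + 1" k \<rho>] n \<rho> by simp
qed

text \<open>The telescoped deviations of the successive renewals add up to a second difference of
  \<open>drift\<close>, centred at \<open>k + r + 1\<close>. Its sign varies, hence the integer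
  exponent and \<open>powr\<close>.\<close>

lemma aztec_odd_order:
  assumes "n = 2 * r + 2 + 2 * k" "\<rho> > 0"
  shows "aztec n (2 * r + 1) (\<lambda>e. \<rho> * edge_weight (odd k) (even k) e) =
    \<rho> ^ ((2 * r + 1) * (2 * r + 2)) * 29 ^ ((r + 1)\<^sup>2) * 100 ^ (r * (r + 1)) *
    3 powr of_int (int ((r + 1)\<^sup>2) + (drift (k + 2 * r + 2) - 2 * drift (k + r + 1) + drift k))"
  using assms
proof (induction r arbitrary: k \<rho>)
  case 0
  have e: "int (row_exponent k 1) = 1 + (drift (k + 2) - 2 * drift (k + 1) + drift k)"
    using row_exponent_odd[of 1 k] by (simp add: drift_Suc)
  have "aztec n 1 (\<lambda>e. \<rho> * edge_weight (odd k) (even k) e) = (\<rho>\<^sup>2 * 29) * 3 ^ row_exponent k 1"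
    using aztec_even_step[of n 1 k \<rho>] 0 by (simp add: aztec_0)
  also have "(3::real) ^ row_exponent k 1 = 3 powr of_int (int (row_exponent k 1))"
    by (simp add: powr_realpow)
  finally show ?case unfolding e by (simp add: power2_eq_square)
next
  case (Suc r)
  let ?m = "2 * r + 2"
  let ?X = "int ((r + 1)\<^sup>2) + (drift (Suc k + 2 * r + 2) - 2 * drift (Suc k + r + 1) + drift (Suc k))"
  let ?Y = "int ((Suc r + 1)\<^sup>2) + (drift (k + 2 * Suc r + 2) - 2 * drift (k + Suc r + 1) + drift k)"
  let ?E = "\<Sum>i<?m + 1. row_exponent (i + k) (?m + 1)"
  have \<rho>: "\<rho> > 0" "87 * \<rho> / 100 > 0" using Suc.prems by auto
  have a: "k + (?m + 1) = k + 2 * r + 3" "k + 2 * Suc r + 2 = Suc (k + 2 * r + 3)"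
    "Suc k + 2 * r + 2 = k + 2 * r + 3" "Suc k + r + 1 = k + Suc r + 1" by simp_all
  have "int ?E = int (?m + 1) * int (?m + 1) + half_drift (k + 2 * r + 3) - half_drift k"
    unfolding a(1)[symmetric] by (rule sum_row_exponent_odd) simp
  \<comment> \<open>The left side collects the powers of 3, including those inside 87. Both second
    differences are centred at \<open>k + r + 2\<close> and differ only in their end terms, by just
    the two half drifts in \<open>?E\<close>.\<close>
  then have EX: "int ?E - 2 * int (?m * ?m) + int (2 * r + 1) * int (2 * r + 2) + ?X = ?Y"
    unfolding a drift_Suc by (simp add: algebra_simps power2_eq_square)
  have EXr: "real ?E = of_int ?Y - of_int ?X + 2 * real (?m * ?m) - real (2 * r + 1) * real (2 * r + 2)"
    using arg_cong[OF EX, of real_of_int] by simp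
  have ck: "(\<Prod>i<?m. \<Prod>j<?m. if even (i + j + k) then 250 else 40 :: real) = 10000 ^ (?m * (r + 1))"
    unfolding checkerboard_prod by simp
  have "aztec n (2 * Suc r + 1) (\<lambda>e. \<rho> * edge_weight (odd k) (even k) e) =
    (\<rho>\<^sup>2 * 29) ^ ((?m + 1) * (?m + 1)) * 3 ^ ?E * (((1 / (87 * \<rho>))\<^sup>2) ^ (?m * ?m) * 10000 ^ (?m * (r + 1)) *
      ((87 * \<rho> / 100) ^ ((2 * r + 1) * (2 * r + 2)) * 29 ^ ((r + 1)\<^sup>2) * 100 ^ (r * (r + 1)) * 3 powr of_int ?X))"
    using aztec_two_steps[of n ?m k \<rho>] Suc.IH[of "Suc k" "87 * \<rho> / 100"] Suc.prems \<rho> unfolding ck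
    by (simp add: algebra_simps)
  also have "\<dots> = \<rho> ^ ((2 * Suc r + 1) * (2 * Suc r + 2)) * 29 ^ ((Suc r + 1)\<^sup>2) * 100 ^ (Suc r * (Suc r + 1)) * 3 powr of_int ?Y" (is "?L = ?R")
  proof (rule eq_if_ln_eq)
    show "ln ?L = ln ?R"
      using \<rho>
      by (simp only: ln_mult ln_div ln_realpow ln_powr ln_constants mult_pos_pos zero_less_power divide_pos_pos zero_less_one zero_less_numeral powr_gt_zero ln_one EXr)
        (simp add: algebra_simps power2_eq_square)
  qed (use \<rho> in simp_all)
  finally show ?case .
qed

text \<open>Each pair of renewals leaves one unpaired factor 250 or 40, that is 100 times 5/2 or
  2/5. These alternate with \<open>k\<close>, so at most the first one survives.\<close>

definition parity_factor :: "nat \<Rightarrow> nat \<Rightarrow> real" where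
  "parity_factor r k = (if even r then 1 else if even k then 5/2 else 2/5)"

lemma aztec_even_order:
  assumes "n = 2 * r + 1 + 2 * k" "\<rho> > 0"
  shows "aztec n (2 * r) (\<lambda>e. \<rho> * edge_weight (odd k) (even k) e) =
    \<rho> ^ (2 * r * (2 * r + 1)) * 87 ^ (r * (r + 1)) * 100 ^ (r * r) * parity_factor r k"
  using assms
proof (induction r arbitrary: k \<rho>)
  case 0
  then show ?case by (simp add: aztec_0 parity_factor_def)
next
  case (Suc r)
  let ?m = "2 * r + 1"
  have \<rho>: "\<rho> > 0" "87 * \<rho> / 100 > 0" using Suc.prems by auto
  have E: "(\<Sum>i<?m + 1. row_exponent (i + k) (?m + 1)) = (?m + 1) * (?m + 1)"
    by (subst sum.cong[OF refl row_exponent_even]) simp_all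
  have ck: "(\<Prod>i<?m. \<Prod>j<?m. if even (i + j + k) then 250 else 40 :: real) = 10000 ^ ((2 * r + 2) * r) * (if even k then 250 else 40)"
    unfolding checkerboard_prod by simp
  have pf: "(if even k then 250 else 40) * parity_factor r (Suc k) = 100 * parity_factor (Suc r) k"
    by (simp add: parity_factor_def)
  let ?L = "(\<rho>\<^sup>2 * 29) ^ ((?m + 1) * (?m + 1)) * 3 ^ ((?m + 1) * (?m + 1)) * (((1 / (87 * \<rho>))\<^sup>2) ^ (?m * ?m) *
      10000 ^ ((2 * r + 2) * r) * ((87 * \<rho> / 100) ^ (2 * r * (2 * r + 1)) * 87 ^ (r * (r + 1)) * 100 ^ (r * r)))"
  let ?R = "\<rho> ^ (2 * Suc r * (2 * Suc r + 1)) * 87 ^ (Suc r * (Suc r + 1)) * 100 ^ (Suc r * Suc r)"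
  have "aztec n (2 * Suc r) (\<lambda>e. \<rho> * edge_weight (odd k) (even k) e) = ?L * ((if even k then 250 else 40) * parity_factor r (Suc k))"
    using aztec_two_steps[of n ?m k \<rho>] Suc.IH[of "Suc k" "87 * \<rho> / 100"] Suc.prems \<rho> unfolding ck E
    by (simp add: algebra_simps)
  also have "\<dots> = ?L * 100 * parity_factor (Suc r) k"
    unfolding pf by (simp only: mult_ac)
  also have "?L * 100 = ?R"
  proof (rule eq_if_ln_eq)
    show "ln (?L * 100) = ln ?R"
      using \<rho>
      by (simp only: ln_mult ln_div ln_realpow ln_constants mult_pos_pos zero_less_power divide_pos_pos zero_less_one zero_less_numeral ln_one)
        (simp add: algebra_simps power2_eq_square)
  qed (use \<rho> in simp_all)
  finally show ?case .
qed

section \<open>The tiling numbers\<close>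

lemma prod_gadget_factors:
  "(\<Prod>z\<in>nodes n n. if even (fst z) then 5 else 2 :: real) =
    (if even n then 10 ^ (n * (n div 2)) else 10 ^ ((n + 1) * (n div 2)) * 2)"
proof -
  have "(\<Prod>z\<in>nodes n n. if even (fst z) then 5 else 2 :: real) = (\<Prod>i<n. \<Prod>j<n. if even (i + j + 0) then 2 else 5)"
    unfolding prod_nodes by (intro prod.cong refl) auto
  also have "\<dots> = (if even n then 10 ^ (n * (n div 2)) else 10 ^ ((n + 1) * (n div 2)) * 2)"
    unfolding checkerboard_prod by simp
  finally show ?thesis .
qed

lemma cancel_factor:
  fixes a b c d f :: real
  assumes "a * (b * d) = 1"
  shows "a * 2 * (b * c * d * f) = 2 * f * c" "a * (b * c * d * f) = c * f"
  using assms by algebra+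

text \<open>The powers of 10 cancel. For odd order the grid has one surplus node of the colour of
  its corner \<open>(1, 0)\<close>, which contributes 2; with the parity factor 1 or 5/2 this gives
  the leading constants 2 and 5.\<close>

lemma T_Q_odd:
  "real (T (Q (2 * p + 1))) = 2 * parity_factor p 0 * 87 ^ (p * (p + 1))"
proof -
  have "aztec (2 * p + 1) (2 * p) (\<lambda>e. edge_weight False True e / 10) =
      (1/10) ^ (2 * p * (2 * p + 1)) * 87 ^ (p * (p + 1)) * 100 ^ (p * p) * parity_factor p 0"
    using aztec_even_order[of "2 * p + 1" p 0 "1/10"] by simp
  then have "real (T (Q (2 * p + 1))) = 10 ^ ((2 * p + 2) * p) * 2 *
      ((1/10) ^ (2 * p * (2 * p + 1)) * 87 ^ (p * (p + 1)) * 100 ^ (p * p) * parity_factor p 0)"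
    using T_Q_eq_aztec[of "2 * p + 1"] by (simp add: prod_gadget_factors)
  moreover have "10 ^ ((2 * p + 2) * p) * ((1/10) ^ (2 * p * (2 * p + 1)) * 100 ^ (p * p)) = (1::real)"
    by (rule eq_if_ln_eq) (simp_all add: ln_mult ln_div ln_realpow ln_constants algebra_simps)
  ultimately show ?thesis by (simp only: cancel_factor(1))
qed

text \<open>The correction \<open>drift (2 * p) - 2 * drift p\<close> is 0, -1, 0, 1 for
  \<open>p\<close> congruent to 0, 1, 2, 3 modulo 4; this yields the three even cases of the
  theorem.\<close>

lemma T_Q_even:
  assumes "p > 0"
  shows "real (T (Q (2 * p))) = 29 ^ (p * p) * 3 powr of_int (int (p * p) + drift (2 * p) - 2 * drift p)"
proof -
  obtain r where p: "p = r + 1" using assms by (metis Suc_eq_plus1 not0_implies_Suc not_gr0)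
  have A: "aztec (2 * p) (2 * p - 1) (\<lambda>e. edge_weight False True e / 10) =
      (1/10) ^ ((2 * r + 1) * (2 * r + 2)) * 29 ^ ((r + 1)\<^sup>2) * 100 ^ (r * (r + 1)) *
      3 powr of_int (int ((r + 1)\<^sup>2) + (drift (2 * r + 2) - 2 * drift (r + 1) + drift 0))"
    using aztec_odd_order[of "2 * p" r 0 "1/10"] p by simp
  have D: "int ((r + 1)\<^sup>2) + (drift (2 * r + 2) - 2 * drift (r + 1) + drift 0) = int (p * p) + drift (2 * p) - 2 * drift p"
    by (simp add: p drift_def power2_eq_square)
  have pp: "(r + 1)\<^sup>2 = p * p" by (simp add: p power2_eq_square)
  have T: "real (T (Q (2 * p))) = 10 ^ (2 * p * p) * aztec (2 * p) (2 * p - 1) (\<lambda>e. edge_weight False True e / 10)"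
    using T_Q_eq_aztec[of "2 * p"] assms by (simp add: prod_gadget_factors)
  have "real (T (Q (2 * p))) = 10 ^ (2 * p * p) * ((1/10) ^ ((2 * r + 1) * (2 * r + 2)) * 29 ^ (p * p) * 100 ^ (r * (r + 1)) *
      3 powr of_int (int (p * p) + drift (2 * p) - 2 * drift p))"
    unfolding T A D unfolding pp ..
  moreover have "10 ^ (2 * p * p) * ((1/10) ^ ((2 * r + 1) * (2 * r + 2)) * 100 ^ (r * (r + 1))) = (1::real)"
    by (rule eq_if_ln_eq) (simp_all add: p ln_mult ln_div ln_realpow ln_constants algebra_simps)
  ultimately show ?thesis by (simp only: cancel_factor(2))
qed

lemma drift_small: "drift 0 = 0" "drift 1 = 0" "drift 2 = -1" "drift 3 = -2"
proof -
  show 0: "drift 0 = 0" by (simp add: drift_def)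
  show 1: "drift 1 = 0" using drift_Suc[of 0] 0 by (simp add: half_drift_def)
  show 2: "drift 2 = -1" using drift_Suc[of 1] 1 by (simp add: half_drift_def numeral_2_eq_2)
  show "drift 3 = -2" using drift_Suc[of 2] 2 by (simp add: half_drift_def)
qed

lemma half_drift_add_mult_4: "half_drift (4 * u + s) = half_drift s"
  by (simp add: half_drift_def)

lemma drift_add_4: "drift (s + 4) = drift s - 2"
proof -
  define u v where "u = s div 4" and "v = s mod 4"
  have s: "s = 4 * u + v" and "v < 4" by (simp_all add: u_def v_def)
  then have v: "v = 0 \<or> v = 1 \<or> v = 2 \<or> v = 3" by linarith
  have "drift (s + 4) = drift s + half_drift s + half_drift (s + 1) + half_drift (s + 2) + half_drift (s + 3)"
    using drift_Suc[of s] drift_Suc[of "s + 1"] drift_Suc[of "s + 2"] drift_Suc[of "s + 3"] by (simp add: eval_nat_numeral)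
  moreover have "half_drift s + half_drift (s + 1) + half_drift (s + 2) + half_drift (s + 3) = -2"
    unfolding s add.assoc[of "4 * u"] half_drift_add_mult_4 using v by (auto simp: half_drift_def)
  ultimately show ?thesis by simp
qed

lemma drift_mult_4: "drift (4 * q + s) = drift s - 2 * int q"
proof (induction q)
  case (Suc q)
  have "drift (4 * Suc q + s) = drift ((4 * q + s) + 4)" by (rule arg_cong) simp
  then show ?case using Suc unfolding drift_add_4 by simp
qed simp

lemma of_nat_T_eqI: "real (T R) = real m \<Longrightarrow> T R = m"
  by simp

theorem theorem5p5:
  fixes q :: nat
  shows "T (Q (4 * q)) = 3 ^ (4 * q\<^sup>2) * 29 ^ (4 * q\<^sup>2) \<and>
         T (Q (8 * q + 2)) = 3 ^ (2 * q * (8 * q + 4)) * 29 ^ ((4 * q + 1)\<^sup>2) \<and>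
         T (Q (8 * q + 6)) = 3 ^ (8 * (q + 1) * (2 * q + 1) + 2) * 29 ^ ((4 * q + 3)\<^sup>2) \<and>
         T (Q (4 * q + 1)) = 2 * 3 ^ (2 * q * (2 * q + 1)) * 29 ^ (2 * q * (2 * q + 1)) \<and>
         T (Q (4 * q + 3)) =
           5 * 3 ^ ((2 * q + 1) * (2 * q + 2)) * 29 ^ ((2 * q + 1) * (2 * q + 2))"
proof (intro conjI)
  have pow: "(3::real) powr of_int e = 3 ^ d" if "e = int d" for e d
    using that by (simp add: powr_realpow)
  have even: "T (Q (2 * p)) = 3 ^ d * 29 ^ (p * p)" if "p > 0" "int (p * p) + drift (2 * p) - 2 * drift p = int d" for p d
  proof (rule of_nat_T_eqI)
    show "real (T (Q (2 * p))) = real (3 ^ d * 29 ^ (p * p))"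
      unfolding T_Q_even[OF that(1)] pow[OF that(2)] by (simp add: mult.commute)
  qed
  show "T (Q (4 * q)) = 3 ^ (4 * q\<^sup>2) * 29 ^ (4 * q\<^sup>2)"
  proof (cases "q = 0")
    case True
    then show ?thesis by (simp add: Q_def T_empty)
  next
    case False
    have "drift (2 * (2 * q)) - 2 * drift (2 * q) = 0"
    proof (cases "even q")
      case True
      then obtain h where "q = 2 * h" by (rule evenE)
      then show ?thesis using drift_mult_4[of "2 * h" 0] drift_mult_4[of h 0] by (simp add: drift_small)
    next
      case False
      then obtain h where "q = 2 * h + 1" by (rule oddE)
      then have "2 * (2 * q) = 4 * (2 * h + 1) + 0" "2 * q = 4 * h + 2" by simp_all
      then have "drift (2 * (2 * q)) = drift (4 * (2 * h + 1) + 0)" "drift (2 * q) = drift (4 * h + 2)" by (simp_all only:)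
      then show ?thesis unfolding drift_mult_4 by (simp add: drift_small)
    qed
    then show ?thesis using even[of "2 * q" "4 * q\<^sup>2"] False by (simp add: power2_eq_square)
  qed
  show "T (Q (8 * q + 2)) = 3 ^ (2 * q * (8 * q + 4)) * 29 ^ ((4 * q + 1)\<^sup>2)"
  proof -
    have e: "8 * q + 2 = 2 * (4 * q + 1)" "2 * (4 * q + 1) = 4 * (2 * q) + 2" by simp_all
    show ?thesis unfolding e(1) power2_eq_square
    proof (rule even)
      \<comment> \<open>Here the correction is -1, and
        \<open>(4 * q + 1)\<^sup>2 - 1 = 4 * q * (4 * q + 2)\<close>. In the next case it is
        +1.\<close>
      show "int ((4 * q + 1) * (4 * q + 1)) + drift (2 * (4 * q + 1)) - 2 * drift (4 * q + 1) = int (2 * q * (8 * q + 4))"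
        unfolding e(2) drift_mult_4 drift_small by (simp add: algebra_simps)
    qed simp
  qed
  show "T (Q (8 * q + 6)) = 3 ^ (8 * (q + 1) * (2 * q + 1) + 2) * 29 ^ ((4 * q + 3)\<^sup>2)"
  proof -
    have e: "8 * q + 6 = 2 * (4 * q + 3)" "2 * (4 * q + 3) = 4 * (2 * q + 1) + 2" by simp_all
    show ?thesis unfolding e(1) power2_eq_square
    proof (rule even)
      show "int ((4 * q + 3) * (4 * q + 3)) + drift (2 * (4 * q + 3)) - 2 * drift (4 * q + 3) = int (8 * (q + 1) * (2 * q + 1) + 2)"
        unfolding e(2) drift_mult_4 drift_small by (simp add: algebra_simps)
    qed simp
  qed
  have "(87::real) ^ d = 3 ^ d * 29 ^ d" for d by (simp flip: power_mult_distrib)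
  note odd = T_Q_odd[unfolded this]
  show "T (Q (4 * q + 1)) = 2 * 3 ^ (2 * q * (2 * q + 1)) * 29 ^ (2 * q * (2 * q + 1))" (is "?l = ?r")
  proof (rule of_nat_T_eqI)
    have "4 * q + 1 = 2 * (2 * q) + 1" by simp
    then show "real ?l = real ?r"
      by (simp only: odd) (simp add: parity_factor_def)
  qed
  show "T (Q (4 * q + 3)) = 5 * 3 ^ ((2 * q + 1) * (2 * q + 2)) * 29 ^ ((2 * q + 1) * (2 * q + 2))" (is "?l = ?r")
  proof (rule of_nat_T_eqI)
    have "4 * q + 3 = 2 * (2 * q + 1) + 1" by simp
    then show "real ?l = real ?r"
      by (simp only: odd) (simp add: parity_factor_def)
  qed
qed

end
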